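(* Let $M$ be a hypercomplex subspace of $A$ with $m=\dim(M)-1\ge3$ odd, and let $\Omega=\Omega_D\cap M$ be an axially symmetric domain of $M$ which is star-like with centre $0$. Let $f:\Omega\to A$ be slice-regular. If $A$ is not associative, assume that $f$ and $xf$ are $M$-admissible. If $f$ is in the kernel of the $\overline\partial\Delta$-Fueter mapping, i.e. $\mathcal F_{\overline\partial\Delta}(f)=0$, then $f$ is an affine function, namely there exist $a,b\in A$ such that $f(x)=xa+b$.
   Context: $A$ is a finite-dimensional real alternative algebra with unity $1\ne0$ (the associator $(x,y,z)=(xy)z-x(yz)$ is alternating), $\mathbb R$ is identified with $\mathbb R\cdot 1$, and $A$ is a *-algebra with real linear anti-involution $x\mapsto x^c$, $(xy)^c=y^cx^c$, $x^c=x$ for $x\in\mathbb R$. Put $t(x)=x+x^c$, $n(x)=xx^c$, $\mathbb S_A=\{J\in A: t(J)=0,\ n(J)=1\}\neq\emptyset$, $\mathbb C_J=\mathrm{span}(1,J)$, $Q_A=\bigcup_{J\in\mathbb S_A}\mathbb C_J$. For $x\in Q_A$, $\mathrm{Im}(x)=\frac{x-x^c}2$. A hypercomplex subspace is a real vector subspace $M$ of $A$ with $\mathbb R\subset M\subset Q_A$ and $\dim(M)>2$. On $M$, $\langle x,y\rangle=\frac12t(xy^c)$ is a scalar product with norm $\|x\|=n(x)^{1/2}$. $\mathcal B=(v_0=1,v_1,\dots,v_m)$ is an orthonormal basis of $M$, $x=\sum_{i=0}^mx_iv_i$, $\partial_i$ is the partial derivative w.r.t. $x_i$ of $A$-valued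 functions (componentwise), $\overline\partial_{\mathcal B}=\frac12(\partial_0+\sum_{i=1}^mv_i\partial_i)$, $\Delta_{\mathcal B}=\sum_{i=0}^m\partial_i^2$. A $\mathcal C^1$ function $f:\Omega\to A$ is $M$-admissible if $f(x),\overline\partial_{\mathcal B}f(x)\in M$ for all $x\in\Omega$. $xf$ is the pointwise product $x\mapsto xf(x)$. Slice-regular functions: let $D\subseteq\mathbb C$ be open and conjugation-invariant, $\Omega_D=\{\alpha+J\beta:\alpha+i\beta\in D,\ J\in\mathbb S_A\}$. A stem function is $F=F_1+\imath F_2:D\to A\otimes_{\mathbb R}\mathbb C$ ($\imath^2=-1$) with $F(\overline z)=\overline{F(z)}$, where $\overline{a+\imath b}=a-\imath b$; it induces the slice function $\mathcal I(F):\Omega_D\to A$, $\alpha+J\beta\mapsto F_1(\alpha+i\beta)+JF_2(\alpha+i\beta)$, which is slice-regular if $F$ is holomorphic w.r.t. left multiplication by $\imath$. Slice-regular functions on $\Omega=\Omega_D\cap M$ are restrictions of such functions on $\Omega_D$. The spherical derivative is $f'_s(x)=\frac12\mathrm{Im}(x)^{-1}(f(x)-f(x^c))$ for $x\notin\mathbb R$, extended by continuity to real points. The $\overline\partial\Delta$-Fueter mapping: for $f$ as in the claim, put $h_1=(xf)'_s$, $h_2=f'_s$, so that $f=h_1-x^ch_2$; $h_1,h_2$ are in the kernel of $\Delta_{\mathcal B}^{(m-1)/2}$ on $\Omega$. By Almansi's Theorem on the star-like domain $\Omega$ there are unique $A$-valued $\Delta_{\mathcal B}$-harmonic functions $u_k,v_k$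 on $\Omega$ ($0\le k\le\frac{m-3}2$) with $h_1=\sum_{k=0}^{(m-3)/2}\|x\|^{2k}u_k$ and $h_2=\sum_{k=0}^{(m-3)/2}\|x\|^{2k}v_k$. Put $f_k=u_k-x^cv_k$ (so $f=\sum_k\|x\|^{2k}f_k$) and $$\mathcal F_{\overline\partial\Delta}(f)=(\Delta_{\mathcal B}f_0,\dots,\Delta_{\mathcal B}f_{(m-3)/2}).$$ *)

theory Defs
  imports "HOL-Analysis.Analysis"
begin

class associator_magma = minus + times
begin

definition associator :: "'a \<Rightarrow> 'a \<Rightarrow> 'a \<Rightarrow> 'a" where
  "associator x y z = (x * y) * z - x * (y * z)"

end

text \<open>
  Finite-dimensional real alternative *-algebras with unity. The class \<^class>\<open>euclidean_space\<close>
  only supplies the finite-dimensional real vector space and its topology: its inner product and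
  norm are auxiliary, unrelated to the multiplication, and play no role in the definitions below.
  The real numbers are identified with the multiples \<open>r *\<^sub>R 1\<close> of the unity.
\<close>

class alternative_star_algebra = euclidean_space + associator_magma + one +
  fixes star_conj :: "'a \<Rightarrow> 'a"  ("_\<^sup>c" [1000] 999)
  assumes mult_add_left: "(x + y) * z = x * z + y * z"
    and mult_add_right: "x * (y + z) = x * y + x * z"
    and mult_scale_left: "(r *\<^sub>R x) * y = r *\<^sub>R (x * y)"
    and mult_scale_right: "x * (r *\<^sub>R y) = r *\<^sub>R (x * y)"
    and unity_left: "1 * x = x"
    and unity_right: "x * 1 = x"
    and unity_neq_zero: "1 \<noteq> 0"
    and associator_left: "associator x x y = 0"
    and associator_right: "associator x y y = 0"
    and associator_outer: "associator x y x = 0"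
    and conj_add: "(x + y)\<^sup>c = x\<^sup>c + y\<^sup>c"
    and conj_scale: "(r *\<^sub>R x)\<^sup>c = r *\<^sub>R x\<^sup>c"
    and conj_conj: "(x\<^sup>c)\<^sup>c = x"
    and conj_mult: "(x * y)\<^sup>c = y\<^sup>c * x\<^sup>c"
    and conj_real: "(r *\<^sub>R 1)\<^sup>c = r *\<^sub>R 1"

definition real_line :: "'a::alternative_star_algebra set" where
  "real_line = range (\<lambda>r. r *\<^sub>R 1)"

text \<open>The real number corresponding to an element of the real line of the algebra.\<close>

definition real_of_alg :: "'a::alternative_star_algebra \<Rightarrow> real" where
  "real_of_alg x = (THE r. x = r *\<^sub>R 1)"

definition alg_trace :: "'a::alternative_star_algebra \<Rightarrow> 'a" where
  "alg_trace x = x + x\<^sup>c"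

definition alg_nsq :: "'a::alternative_star_algebra \<Rightarrow> 'a" where
  "alg_nsq x = x * x\<^sup>c"

definition imag_units :: "'a::alternative_star_algebra set" where
  "imag_units = {J. alg_trace J = 0 \<and> alg_nsq J = 1}"

definition quadratic_cone :: "'a::alternative_star_algebra set" where
  "quadratic_cone = (\<Union>J\<in>imag_units. span {1, J})"

definition alg_Im :: "'a::alternative_star_algebra \<Rightarrow> 'a" where
  "alg_Im x = (1/2) *\<^sub>R (x - x\<^sup>c)"

definition alg_inverse :: "'a::alternative_star_algebra \<Rightarrow> 'a" where
  "alg_inverse x = (THE y. x * y = 1 \<and> y * x = 1)"

definition hypercomplex_subspace :: "'a::alternative_star_algebra set \<Rightarrow> bool" where
  "hypercomplex_subspace M \<longleftrightarrow>
     subspace M \<and> real_line \<subseteq> M \<and> M \<subseteq> quadratic_cone \<and> dim M > 2"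

definition hc_inner :: "'a::alternative_star_algebra \<Rightarrow> 'a \<Rightarrow> real" where
  "hc_inner x y = real_of_alg ((1/2) *\<^sub>R alg_trace (x * y\<^sup>c))"

definition hc_norm :: "'a::alternative_star_algebra \<Rightarrow> real" where
  "hc_norm x = sqrt (real_of_alg (alg_nsq x))"

definition hc_orthonormal_basis ::
    "'a::alternative_star_algebra set \<Rightarrow> nat \<Rightarrow> (nat \<Rightarrow> 'a) \<Rightarrow> bool" where
  "hc_orthonormal_basis M m v \<longleftrightarrow>
     v 0 = 1 \<and> (\<forall>i\<le>m. v i \<in> M) \<and> span (v ` {..m}) = M \<and>
     (\<forall>i\<le>m. \<forall>j\<le>m. hc_inner (v i) (v j) = (if i = j then 1 else 0))"

text \<open>
  Functions on a (relatively open) subset of \<open>M\<close> are total functions of which only the values on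
  that subset matter. The partial derivative with respect to the coordinate \<open>x\<^sub>i\<close> is the
  derivative along \<open>v i\<close>, so at a point of a relatively open subset of \<open>M\<close> it is determined by the
  values of the function on that subset.
\<close>

definition partial_deriv ::
    "(nat \<Rightarrow> 'a::alternative_star_algebra) \<Rightarrow> nat \<Rightarrow> ('a \<Rightarrow> 'a) \<Rightarrow> 'a \<Rightarrow> 'a" where
  "partial_deriv v i f x = vector_derivative (\<lambda>t. f (x + t *\<^sub>R v i)) (at 0)"

primrec Ck_on ::
    "nat \<Rightarrow> nat \<Rightarrow> (nat \<Rightarrow> 'a::alternative_star_algebra) \<Rightarrow> 'a set \<Rightarrow> ('a \<Rightarrow> 'a) \<Rightarrow> bool" where
  "Ck_on 0 m v \<Omega> f \<longleftrightarrow> continuous_on \<Omega> f"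
| "Ck_on (Suc k) m v \<Omega> f \<longleftrightarrow> continuous_on \<Omega> f \<and>
     (\<forall>i\<le>m. (\<forall>x\<in>\<Omega>. (\<lambda>t::real. f (x + t *\<^sub>R v i)) differentiable at 0) \<and>
        Ck_on k m v \<Omega> (partial_deriv v i f))"

definition dbar ::
    "nat \<Rightarrow> (nat \<Rightarrow> 'a::alternative_star_algebra) \<Rightarrow> ('a \<Rightarrow> 'a) \<Rightarrow> 'a \<Rightarrow> 'a" where
  "dbar m v f x =
     (1/2) *\<^sub>R (partial_deriv v 0 f x + (\<Sum>i=1..m. v i * partial_deriv v i f x))"

definition laplacian ::
    "nat \<Rightarrow> (nat \<Rightarrow> 'a::alternative_star_algebra) \<Rightarrow> ('a \<Rightarrow> 'a) \<Rightarrow> 'a \<Rightarrow> 'a" where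
  "laplacian m v f x = (\<Sum>i\<le>m. partial_deriv v i (partial_deriv v i f) x)"

definition harmonic_on ::
    "nat \<Rightarrow> (nat \<Rightarrow> 'a::alternative_star_algebra) \<Rightarrow> 'a set \<Rightarrow> ('a \<Rightarrow> 'a) \<Rightarrow> bool" where
  "harmonic_on m v \<Omega> u \<longleftrightarrow> Ck_on 2 m v \<Omega> u \<and> (\<forall>x\<in>\<Omega>. laplacian m v u x = 0)"

definition admissible ::
    "'a::alternative_star_algebra set \<Rightarrow> nat \<Rightarrow> (nat \<Rightarrow> 'a) \<Rightarrow> 'a set \<Rightarrow> ('a \<Rightarrow> 'a) \<Rightarrow> bool" where
  "admissible M m v \<Omega> f \<longleftrightarrow>
     Ck_on 1 m v \<Omega> f \<and> (\<forall>x\<in>\<Omega>. f x \<in> M \<and> dbar m v f x \<in> M)"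

definition circular_set :: "complex set \<Rightarrow> 'a::alternative_star_algebra set" where
  "circular_set D = {\<alpha> *\<^sub>R 1 + \<beta> *\<^sub>R J | \<alpha> \<beta> J. Complex \<alpha> \<beta> \<in> D \<and> J \<in> imag_units}"

text \<open>
  The complexification of the algebra is modelled by pairs, \<open>(a, b)\<close> standing for \<open>a + \<i> b\<close>.
\<close>

definition cplx_conj :: "'a \<times> 'a \<Rightarrow> 'a \<times> 'a::alternative_star_algebra" where
  "cplx_conj p = (fst p, - snd p)"

definition cplx_imath :: "'a \<times> 'a \<Rightarrow> 'a \<times> 'a::alternative_star_algebra" where
  "cplx_imath p = (- snd p, fst p)"

definition stem_function ::
    "complex set \<Rightarrow> (complex \<Rightarrow> 'a \<times> 'a::alternative_star_algebra) \<Rightarrow> bool" where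
  "stem_function D F \<longleftrightarrow> (\<forall>z\<in>D. F (cnj z) = cplx_conj (F z))"

definition stem_holomorphic ::
    "complex set \<Rightarrow> (complex \<Rightarrow> 'a \<times> 'a::alternative_star_algebra) \<Rightarrow> bool" where
  "stem_holomorphic D F \<longleftrightarrow>
     (\<forall>z\<in>D. \<exists>F'. (F has_derivative F') (at z) \<and> (\<forall>w. F' (\<i> * w) = cplx_imath (F' w)))"

definition induces_slice_function ::
    "complex set \<Rightarrow> (complex \<Rightarrow> 'a \<times> 'a) \<Rightarrow> ('a::alternative_star_algebra \<Rightarrow> 'a) \<Rightarrow> bool" where
  "induces_slice_function D F f \<longleftrightarrow>
     (\<forall>\<alpha> \<beta>. \<forall>J\<in>imag_units. Complex \<alpha> \<beta> \<in> D \<longrightarrow>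
        f (\<alpha> *\<^sub>R 1 + \<beta> *\<^sub>R J) = fst (F (Complex \<alpha> \<beta>)) + J * snd (F (Complex \<alpha> \<beta>)))"

definition slice_regular ::
    "complex set \<Rightarrow> ('a::alternative_star_algebra \<Rightarrow> 'a) \<Rightarrow> bool" where
  "slice_regular D f \<longleftrightarrow>
     (\<exists>F. stem_function D F \<and> stem_holomorphic D F \<and> induces_slice_function D F f)"

definition slice_regular_restr ::
    "complex set \<Rightarrow> 'a set \<Rightarrow> ('a::alternative_star_algebra \<Rightarrow> 'a) \<Rightarrow> bool" where
  "slice_regular_restr D \<Omega> f \<longleftrightarrow> (\<exists>g. slice_regular D g \<and> (\<forall>x\<in>\<Omega>. f x = g x))"

definition spherical_quotient ::
    "('a::alternative_star_algebra \<Rightarrow> 'a) \<Rightarrow> 'a \<Rightarrow> 'a" where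
  "spherical_quotient f x = (1/2) *\<^sub>R (alg_inverse (alg_Im x) * (f x - f (x\<^sup>c)))"

definition spherical_deriv ::
    "'a set \<Rightarrow> ('a::alternative_star_algebra \<Rightarrow> 'a) \<Rightarrow> 'a \<Rightarrow> 'a" where
  "spherical_deriv \<Omega> f x =
     (if x \<in> real_line then Lim (at x within (\<Omega> - real_line)) (spherical_quotient f)
      else spherical_quotient f x)"

text \<open>
  On a star-like domain with centre \<open>0\<close> (and \<open>m\<close> odd) the harmonic components of a function in the
  kernel of the \<open>(m-1)/2\<close>-th power of the Laplacian exist and are unique on the domain by
  Almansi's theorem; the choice operator only fixes their irrelevant values outside of the domain.
\<close>

definition is_almansi_decomposition :: "nat \<Rightarrow> (nat \<Rightarrow> 'a::alternative_star_algebra) \<Rightarrow> 'a set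
    \<Rightarrow> ('a \<Rightarrow> 'a) \<Rightarrow> (nat \<Rightarrow> 'a \<Rightarrow> 'a) \<Rightarrow> bool" where
  "is_almansi_decomposition m v \<Omega> h u \<longleftrightarrow>
     (\<forall>k\<le>(m - 3) div 2. harmonic_on m v \<Omega> (u k)) \<and>
     (\<forall>x\<in>\<Omega>. h x = (\<Sum>k\<le>(m - 3) div 2. (hc_norm x ^ (2 * k)) *\<^sub>R u k x))"

definition almansi_component :: "nat \<Rightarrow> (nat \<Rightarrow> 'a::alternative_star_algebra) \<Rightarrow> 'a set
    \<Rightarrow> ('a \<Rightarrow> 'a) \<Rightarrow> nat \<Rightarrow> 'a \<Rightarrow> 'a" where
  "almansi_component m v \<Omega> h = (SOME u. is_almansi_decomposition m v \<Omega> h u)"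

definition fueter_component :: "nat \<Rightarrow> (nat \<Rightarrow> 'a::alternative_star_algebra) \<Rightarrow> 'a set
    \<Rightarrow> ('a \<Rightarrow> 'a) \<Rightarrow> nat \<Rightarrow> 'a \<Rightarrow> 'a" where
  "fueter_component m v \<Omega> f k x =
     almansi_component m v \<Omega> (spherical_deriv \<Omega> (\<lambda>y. y * f y)) k x
       - x\<^sup>c * almansi_component m v \<Omega> (spherical_deriv \<Omega> f) k x"

text \<open>The \<open>k\<close>-th entry, \<open>k \<le> (m-3)/2\<close>, of the image of \<open>f\<close> under the Fueter mapping.\<close>

definition fueter_map :: "nat \<Rightarrow> (nat \<Rightarrow> 'a::alternative_star_algebra) \<Rightarrow> 'a set
    \<Rightarrow> ('a \<Rightarrow> 'a) \<Rightarrow> nat \<Rightarrow> 'a \<Rightarrow> 'a" where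
  "fueter_map m v \<Omega> f k = laplacian m v (fueter_component m v \<Omega> f k)"

end

theory Submission
  imports Defs "HOL-Complex_Analysis.Complex_Analysis"
begin

text \<open>
  For a stem function \<open>F\<close> inducing \<open>f\<close>, the spherical derivative is \<open>F\<^sub>2 / \<beta>\<close>. Coordinatewise it is
  the sum of the residues at \<open>z = \<alpha> + \<i>\<beta>\<close> and \<open>cnj z\<close> of \<open>G w / Q\<close>, with \<open>G\<close> holomorphic and
  \<open>Q = (w - \<alpha>)\<^sup>2 + \<beta>\<^sup>2 = (w - x\<^sub>0)\<^sup>2 + x\<^sub>1\<^sup>2 + \<dots> + x\<^sub>m\<^sup>2\<close>. Replacing \<open>Q\<close> by \<open>Q ^ ((m - 1) / 2)\<close>, a Newton
  kernel with complex centre, gives harmonic functions, smooth across the real axis since the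
  residues are locally contour integrals over fixed circles. An integration by parts in \<open>w\<close> raises
  the power of \<open>Q\<close> by one and thus yields an Almansi decomposition with components \<open>U\<^sub>k\<close> that depend
  only on \<open>\<alpha>\<close> and \<open>\<beta>\<close>.

  If \<open>w\<^sub>k\<close> are the Almansi components of \<open>f'\<^sub>s\<close>, then the vanishing of the Fueter mapping says that
  \<open>\<partial>\<^sub>0 w\<^sub>k = \<Sum>\<^sub>i v\<^sub>i \<partial>\<^sub>i w\<^sub>k\<close>. Fix a small \<open>r\<close>. The harmonic functions \<open>\<Sum> r\<^sup>2\<^sup>k w\<^sub>k\<close> and \<open>\<Sum> r\<^sup>2\<^sup>k U\<^sub>k\<close> agree with
  \<open>f'\<^sub>s\<close> on the sphere of radius \<open>r\<close>, hence with each other inside, by the maximum principle. Comparing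
  the equation at \<open>x\<close> and \<open>x\<^sup>c\<close> for this function of \<open>\<alpha>\<close> and \<open>\<beta>\<close> shows that it is a constant \<open>C\<close>. So
  \<open>F\<^sub>2 = \<beta> C\<close> on the circle \<open>\<bar>z\<bar> = r\<close>, and the maximum principle for \<open>Im (G - C z)\<close> together with the
  identity theorem makes \<open>F\<close> affine on \<open>D\<close>.
\<close>

section \<open>Residues at a conjugate pair of poles\<close>

text \<open>\<open>D\<close> need not be connected, so the residue theorem is applied on a
  concentric disc of slightly larger radius; compactness of the closed disc leaves room for it
  inside \<open>D\<close>.\<close>

lemma contour_integral_circlepath_residues:
  assumes "open D" "cball p R \<subseteq> D" "0 < R" "finite P"
    and "f holomorphic_on D - P" "P \<inter> sphere p R = {}"
  shows "contour_integral (circlepath p R) f = 2 * pi * \<i> * (\<Sum>a\<in>P \<inter> ball p R. residue f a)"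
proof -
  obtain e where e: "e > 0" "(\<Union>x\<in>cball p R. ball x e) \<subseteq> D"
    using compact_subset_open_imp_ball_epsilon_subset[of "cball p R" D] assms by auto
  have sub: "ball p (R + e) \<subseteq> D"
  proof
    fix x assume x: "x \<in> ball p (R + e)"
    show "x \<in> D"
    proof (cases "x \<in> cball p R")
      case False
      \<comment> \<open>\<open>y\<close> is the radial projection of \<open>x\<close> to the circle,
        at distance \<open>dist p x - R\<close> from \<open>x\<close>.\<close>
      define y where "y = p + (R / dist p x) *\<^sub>R (x - p)"
      have d: "dist p x > R" using False by auto
      have ne: "p \<noteq> x" using d assms(3) by (metis dist_self order.asym)
      then have "y \<in> cball p R"
        using assms(3) by (auto simp: y_def dist_norm norm_minus_commute)
      moreover have "dist y x < e"
      proof -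
        have "y - x = (R / dist p x - 1) *\<^sub>R (x - p)" by (simp add: y_def algebra_simps)
        then have "dist y x = \<bar>R / dist p x - 1\<bar> * dist p x"
          by (simp add: dist_norm norm_minus_commute)
        also have "\<dots> = dist p x - R" using d ne assms(3) by (simp add: abs_if field_simps)
        finally show ?thesis using x by simp
      qed
      ultimately have "x \<in> (\<Union>x\<in>cball p R. ball x e)" by (meson UN_I mem_ball)
      then show ?thesis using e(2) by blast
    qed (use assms in auto)
  qed
  have wn0: "winding_number (circlepath p R) z = 0" if "z \<notin> cball p R" for z
    by (rule winding_number_zero_outside[of _ "cball p R"])
       (use that assms(3) in \<open>auto simp: path_image_circlepath_nonneg\<close>)
  have wn1: "winding_number (circlepath p R) z = 1" if "z \<in> ball p R" for z
    using winding_number_circlepath[of z p R] that by (simp add: dist_norm norm_minus_commute)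
  have "contour_integral (circlepath p R) f
      = 2 * pi * \<i> * (\<Sum>a\<in>P. winding_number (circlepath p R) a * residue f a)"
  proof (rule Residue_theorem)
    show "f holomorphic_on ball p (R + e) - P"
      using assms(5) sub holomorphic_on_subset by (metis Diff_mono order_refl)
    show "\<forall>z. z \<notin> ball p (R + e) \<longrightarrow> winding_number (circlepath p R) z = 0"
      using wn0 e(1) by auto
    show "path_image (circlepath p R) \<subseteq> ball p (R + e) - P"
      using assms e(1) by (auto simp: path_image_circlepath_nonneg)
  qed (use assms in auto)
  also have "(\<Sum>a\<in>P. winding_number (circlepath p R) a * residue f a)
      = (\<Sum>a\<in>P \<inter> ball p R. winding_number (circlepath p R) a * residue f a)"
  proof (rule sum.mono_neutral_right)
    show "\<forall>a\<in>P - P \<inter> ball p R. winding_number (circlepath p R) a * residue f a = 0"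
    proof
      fix a assume a: "a \<in> P - P \<inter> ball p R"
      then have "a \<notin> sphere p R" using assms(6) by auto
      then have "a \<notin> cball p R" using a by auto
      then show "winding_number (circlepath p R) a * residue f a = 0" by (simp add: wn0)
    qed
  qed (use assms in auto)
  also have "\<dots> = (\<Sum>a\<in>P \<inter> ball p R. residue f a)"
    by (intro sum.cong) (auto simp: wn1)
  finally show ?thesis .
qed

section \<open>Circle integrals depending on a parameter\<close>

lemma contour_integral_circlepath_integral:
  "contour_integral (circlepath p R) f
     = integral {0..1} (\<lambda>t. f (circlepath p R t) * (2 * pi * \<i> * R * exp (2 * of_real pi * \<i> * t)))"
  by (simp add: contour_integral_integral vector_derivative_circlepath)

lemma continuous_on_circlepath_param:
  assumes "0 \<le> R" "continuous_on (U \<times> sphere p R) (\<lambda>(u, w). g u w)"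
  shows "continuous_on (U \<times> {0..1})
    (\<lambda>(u, t). g u (circlepath p R t) * (2 * pi * \<i> * R * exp (2 * of_real pi * \<i> * of_real t)))"
proof -
  have "continuous_on (U \<times> {0..1}) ((\<lambda>(u, w). g u w) \<circ> (\<lambda>(u, t). (u, circlepath p R t)))"
  proof (rule continuous_on_compose)
    show "continuous_on (U \<times> {0..1}) (\<lambda>(u, t). (u, circlepath p R t))"
      unfolding circlepath split_def by (intro continuous_intros)
    have "circlepath p R t \<in> sphere p R" if "t \<in> {0..1}" for t
      using that path_image_circlepath_nonneg[OF assms(1), of p] by (auto simp: path_image_def)
    then have "(\<lambda>(u, t). (u, circlepath p R t)) ` (U \<times> {0..1}) \<subseteq> U \<times> sphere p R"
      by auto
    then show "continuous_on ((\<lambda>(u, t). (u, circlepath p R t)) ` (U \<times> {0..1})) (\<lambda>(u, w). g u w)"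
      using assms(2) continuous_on_subset by blast
  qed
  then have *: "continuous_on (U \<times> {0..1}) (\<lambda>x. g (fst x) (circlepath p R (snd x)))"
    by (simp add: comp_def split_def)
  show ?thesis unfolding split_def by (intro continuous_intros *)
qed

lemma continuous_on_contour_integral_circlepath_param:
  assumes "0 \<le> R" "continuous_on (U \<times> sphere p R) (\<lambda>(u, w). g u w)"
  shows "continuous_on U (\<lambda>u. contour_integral (circlepath p R) (g u))"
  unfolding contour_integral_circlepath_integral
  by (rule integral_continuous_on_param[where a = 0 and b = "1::real", unfolded cbox_interval])
     (rule continuous_on_circlepath_param[OF assms])

text \<open>Leibniz' rule for the parametrization of the circle over \<open>{0..1}\<close>. The
  parameter is real because it will be the step along a coordinate line.\<close>

lemma has_vector_derivative_contour_integral_circlepath: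
  assumes "0 \<le> R" "open U" "convex U" "\<tau> \<in> U"
    and der: "\<And>t w. t \<in> U \<Longrightarrow> w \<in> sphere p R \<Longrightarrow>
                ((\<lambda>t. g t w) has_vector_derivative g' t w) (at t)"
    and cont: "\<And>t. t \<in> U \<Longrightarrow> continuous_on (sphere p R) (g t)"
    and cont': "continuous_on (U \<times> sphere p R) (\<lambda>(t, w). g' t w)"
  shows "((\<lambda>t. contour_integral (circlepath p R) (g t)) has_vector_derivative
            contour_integral (circlepath p R) (g' \<tau>)) (at \<tau>)"
proof -
  have on: "circlepath p R t \<in> sphere p R" if "t \<in> {0..1}" for t
    using that path_image_circlepath_nonneg[OF assms(1), of p] by (auto simp: path_image_def)
  let ?e = "\<lambda>t. 2 * pi * \<i> * R * exp (2 * of_real pi * \<i> * of_real t)"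
  have "((\<lambda>s. integral (cbox 0 1) (\<lambda>t. g s (circlepath p R t) * ?e t)) has_vector_derivative
      integral (cbox 0 1) (\<lambda>t. g' \<tau> (circlepath p R t) * ?e t)) (at \<tau> within U)"
  proof (rule leibniz_rule_vector_derivative)
    fix s t :: real assume st: "s \<in> U" "t \<in> cbox 0 1"
    show "((\<lambda>s. g s (circlepath p R t) * ?e t) has_vector_derivative
        g' s (circlepath p R t) * ?e t) (at s within U)"
      by (intro has_vector_derivative_mult_left has_vector_derivative_at_within[OF der] on st)
         (use st in auto)
  next
    fix s :: real assume s: "s \<in> U"
    have "continuous_on {0..1} (\<lambda>t. g s (circlepath p R t))"
      by (rule continuous_on_compose2[OF cont[OF s]])
         (use on in \<open>auto simp: circlepath intro!: continuous_intros\<close>)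
    then show "(\<lambda>t. g s (circlepath p R t) * ?e t) integrable_on cbox 0 1"
      by (intro integrable_continuous continuous_intros) (auto simp: cbox_interval)
  next
    show "continuous_on (U \<times> cbox 0 1) (\<lambda>(s, t). g' s (circlepath p R t) * ?e t)"
      using continuous_on_circlepath_param[OF assms(1) cont'] by (simp add: cbox_interval)
  qed (use assms in auto)
  then show ?thesis
    using at_within_open[OF assms(4,2)] unfolding contour_integral_circlepath_integral
    by (simp add: cbox_interval)
qed

text \<open>The sum runs over a set: at a real \<open>z\<close> the two poles merge into one, whose
  residue is counted once. For non-real \<open>z\<close> and \<open>q = 1\<close> this is the
  divided difference of \<open>G\<close> at \<open>z\<close> and \<open>cnj z\<close>.\<close>

definition pair_residue :: "nat \<Rightarrow> (complex \<Rightarrow> complex) \<Rightarrow> complex \<Rightarrow> complex" where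
  "pair_residue q G z = (\<Sum>p\<in>{z, cnj z}. residue (\<lambda>w. G w / ((w - z) * (w - cnj z)) ^ q) p)"

text \<open>The circles of radius \<open>R\<close> around \<open>z\<close> and \<open>cnj z\<close> lie in \<open>D\<close> and either coincide or bound
  disjoint discs; together they then separate the poles \<open>y, cnj y\<close> from infinity for every \<open>y\<close>
  near \<open>z\<close>, real or not.\<close>

definition conj_radius :: "complex set \<Rightarrow> complex \<Rightarrow> real \<Rightarrow> bool" where
  "conj_radius D z R \<longleftrightarrow> 0 < R \<and> cball z R \<subseteq> D \<and> cball (cnj z) R \<subseteq> D \<and> (Im z = 0 \<or> R < \<bar>Im z\<bar>)"

lemma conj_radius_exists:
  assumes "open D" "\<forall>z\<in>D. cnj z \<in> D" "z \<in> D"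
  obtains R where "conj_radius D z R"
proof -
  obtain r1 where r1: "r1 > 0" "cball z r1 \<subseteq> D"
    using assms open_contains_cball by metis
  obtain r2 where r2: "r2 > 0" "cball (cnj z) r2 \<subseteq> D"
    using assms open_contains_cball by metis
  define r3 where "r3 = (if Im z = 0 then 1 else \<bar>Im z\<bar> / 2)"
  have r3: "r3 > 0" "Im z = 0 \<or> r3 < \<bar>Im z\<bar>" by (auto simp: r3_def)
  have "conj_radius D z (min r1 (min r2 r3))"
    using r1 r2 r3 unfolding conj_radius_def by (auto simp: subset_iff)
  then show ?thesis using that by blast
qed

lemma cnj_in_ball: "z \<in> ball a r \<Longrightarrow> cnj z \<in> ball (cnj a) r"
  by (metis complex_cnj_diff complex_mod_cnj dist_norm mem_ball)

text \<open>For non-real \<open>a\<close> the bound \<open>R < \<bar>Im a\<bar>\<close> puts the two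
  closed discs into opposite open half-planes, so each contains exactly one of \<open>z\<close> and
  \<open>cnj z\<close>. For real \<open>a\<close> both circles coincide and enclose both
  poles.\<close>

lemma conj_radius_poles:
  assumes "conj_radius D a R" "z \<in> ball a R" "p \<in> {a, cnj a}"
  shows "{z, cnj z} \<inter> sphere p R = {}"
    and "{z, cnj z} \<inter> ball p R = (if Im a = 0 then {z, cnj z} else if p = a then {z} else {cnj z})"
proof -
  have zc: "cnj z \<in> ball (cnj a) R" using cnj_in_ball[OF assms(2)] .
  have ni: "cnj z \<notin> cball a R \<and> z \<notin> cball (cnj a) R" if "Im a \<noteq> 0"
  proof -
    have lt: "R < \<bar>Im a\<bar>" using assms(1) that by (auto simp: conj_radius_def)
    have "\<bar>Im (a - z)\<bar> < R" using assms(2) abs_Im_le_cmod[of "a - z"] by (simp add: dist_norm)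
    then have "\<bar>Im a + Im z\<bar> > R" using lt by (auto simp: abs_if split: if_splits)
    then have "\<bar>Im (a - cnj z)\<bar> > R" "\<bar>Im (cnj a - z)\<bar> > R" by auto
    then have "cmod (a - cnj z) > R" "cmod (cnj a - z) > R"
      using abs_Im_le_cmod less_le_trans by blast+
    then show ?thesis by (simp add: dist_norm)
  qed
  have ra: "cnj a = a" if "Im a = 0" using that by (simp add: complex_eq_iff)
  show "{z, cnj z} \<inter> sphere p R = {}"
    using assms zc ni ra by (cases "Im a = 0") auto
  show "{z, cnj z} \<inter> ball p R = (if Im a = 0 then {z, cnj z} else if p = a then {z} else {cnj z})"
    using assms zc ni ra by (cases "Im a = 0") (auto split: if_splits)
qed

text \<open>The circles depend on \<open>a\<close> but not on \<open>z\<close>. This makes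
  \<open>pair_residue\<close> accessible to continuity and differentiation under the integral sign,
  also at real points, where the poles collide.\<close>

lemma pair_residue_contour:
  assumes "open D" "G holomorphic_on D" "conj_radius D a R" "z \<in> ball a R"
  shows "2 * pi * \<i> * pair_residue q G z =
    (\<Sum>p\<in>{a, cnj a}. contour_integral (circlepath p R) (\<lambda>w. G w / ((w - z) * (w - cnj z)) ^ q))"
proof -
  let ?f = "\<lambda>w. G w / ((w - z) * (w - cnj z)) ^ q"
  have holo: "?f holomorphic_on D - {z, cnj z}"
    by (intro holomorphic_intros holomorphic_on_subset[OF assms(2)]) auto
  have 1: "contour_integral (circlepath p R) ?f
      = 2 * pi * \<i> * (\<Sum>x\<in>{z, cnj z} \<inter> ball p R. residue ?f x)" if "p \<in> {a, cnj a}" for p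
    by (rule contour_integral_circlepath_residues[OF assms(1) _ _ _ holo])
       (use assms(3) that conj_radius_poles(1)[OF assms(3,4) that] in \<open>auto simp: conj_radius_def\<close>)
  show ?thesis
  proof (cases "Im a = 0")
    case True
    then have "cnj a = a" by (simp add: complex_eq_iff)
    then show ?thesis
      using 1[of a] conj_radius_poles(2)[OF assms(3,4), of a] True by (simp add: pair_residue_def)
  next
    case False
    then have ne: "a \<noteq> cnj a" by (auto simp: complex_eq_iff)
    have "z \<noteq> cnj z"
    proof
      assume "z = cnj z"
      then have "Im z = 0" by (simp add: complex_eq_iff)
      moreover have "\<bar>Im (a - z)\<bar> < R"
        using assms(4) abs_Im_le_cmod[of "a - z"] by (simp add: dist_norm)
      ultimately show False using assms(3) False by (auto simp: conj_radius_def)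
    qed
    then show ?thesis
      using 1[of a] 1[of "cnj a"] conj_radius_poles(2)[OF assms(3,4), of a] ne
        conj_radius_poles(2)[OF assms(3,4), of "cnj a"] False
      by (simp add: pair_residue_def distrib_left)
  qed
qed

lemma pair_residue_integrand_continuous:
  assumes "G holomorphic_on D" "conj_radius D a R" "p \<in> {a, cnj a}"
  shows "continuous_on (ball a R \<times> sphere p R) (\<lambda>(z, w). G w / ((w - z) * (w - cnj z)) ^ q)"
proof -
  have sub: "sphere p R \<subseteq> D" using assms(2,3) by (auto simp: conj_radius_def)
  have 1: "continuous_on (ball a R \<times> sphere p R) (\<lambda>x. G (snd x))"
    by (rule continuous_on_compose2[OF holomorphic_on_imp_continuous_on[OF assms(1)]])
       (use sub in \<open>auto intro!: continuous_intros\<close>)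
  have "w \<noteq> z \<and> w \<noteq> cnj z" if "z \<in> ball a R" "w \<in> sphere p R" for z w
    using conj_radius_poles(1)[OF assms(2) that(1) assms(3)] that(2) by blast
  then show ?thesis
    unfolding split_def by (intro continuous_intros 1) (auto simp del: mem_ball)
qed

lemma pair_residue_integrable:
  assumes "G holomorphic_on D" "conj_radius D a R" "p \<in> {a, cnj a}" "z \<in> ball a R"
  shows "(\<lambda>w. G w / ((w - z) * (w - cnj z)) ^ q) contour_integrable_on circlepath p R"
proof (rule contour_integrable_continuous_circlepath)
  have R: "0 \<le> R" using assms(2) by (auto simp: conj_radius_def)
  have "continuous_on (sphere p R) (\<lambda>w. G w / ((w - z) * (w - cnj z)) ^ q)"
  proof -
    have "continuous_on (sphere p R)
        ((\<lambda>(z, w). G w / ((w - z) * (w - cnj z)) ^ q) \<circ> (\<lambda>w. (z, w)))"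
      by (intro continuous_on_compose continuous_intros
            continuous_on_subset[OF pair_residue_integrand_continuous[OF assms(1-3), of q]])
         (use assms(4) in auto)
    then show ?thesis by (simp add: comp_def)
  qed
  then show "continuous_on (path_image (circlepath p R)) (\<lambda>w. G w / ((w - z) * (w - cnj z)) ^ q)"
    using R by (simp add: path_image_circlepath_nonneg)
qed

lemma conj_radius_gt_0: "conj_radius D a R \<Longrightarrow> 0 < R"
  by (simp add: conj_radius_def)

lemma pair_residue_contour':
  assumes "open D" "G holomorphic_on D" "conj_radius D a R" "z \<in> ball a R"
  shows "pair_residue q G z = (\<Sum>p\<in>{a, cnj a}. contour_integral (circlepath p R)
            (\<lambda>w. G w / ((w - z) * (w - cnj z)) ^ q)) / (2 * pi * \<i>)"
  using pair_residue_contour[OF assms, of q] by (simp add: field_simps)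

lemma continuous_on_pair_residue:
  assumes "open D" "\<forall>z\<in>D. cnj z \<in> D" "G holomorphic_on D"
  shows "continuous_on D (pair_residue q G)"
proof -
  have "isCont (pair_residue q G) a" if a: "a \<in> D" for a
  proof -
    obtain R where R: "conj_radius D a R" using conj_radius_exists[OF assms(1,2) a] .
    have "continuous_on (ball a R) (\<lambda>z. (\<Sum>p\<in>{a, cnj a}. contour_integral (circlepath p R)
            (\<lambda>w. G w / ((w - z) * (w - cnj z)) ^ q)) / (2 * pi * \<i>))"
      by (intro continuous_intros continuous_on_contour_integral_circlepath_param
           pair_residue_integrand_continuous[OF assms(3) R] less_imp_le[OF conj_radius_gt_0[OF R]]) auto
    then have "continuous_on (ball a R) (pair_residue q G)"
      by (rule continuous_on_eq) (simp add: pair_residue_contour'[OF assms(1,3) R])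
    then show ?thesis
      using conj_radius_gt_0[OF R] by (auto simp: continuous_on_eq_continuous_at)
  qed
  then show ?thesis using assms(1) by (simp add: continuous_on_eq_continuous_at)
qed

section \<open>Calculus rules for pair residues\<close>

lemma pair_residue_cong:
  assumes "open D" "\<forall>z\<in>D. cnj z \<in> D" "z \<in> D" "\<And>w. w \<in> D \<Longrightarrow> G w = H w"
  shows "pair_residue q G z = pair_residue q H z"
proof -
  have "residue (\<lambda>w. G w / ((w - z) * (w - cnj z)) ^ q) p
      = residue (\<lambda>w. H w / ((w - z) * (w - cnj z)) ^ q) p" if "p \<in> D" for p
  proof (rule residue_cong)
    show "\<forall>\<^sub>F w in at p. G w / ((w - z) * (w - cnj z)) ^ q = H w / ((w - z) * (w - cnj z)) ^ q"
      using eventually_at_in_open'[OF assms(1) that] by eventually_elim (simp add: assms(4))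
  qed simp
  then show ?thesis unfolding pair_residue_def using assms(2,3) by (intro sum.cong) auto
qed

text \<open>Residues ignore the values at the poles, so numerator and denominator may be multiplied
  by the kernel. This brings consecutive exponents to a common one, at the price of a numerator
  depending on \<open>z\<close>.\<close>

lemma pair_residue_shift: "pair_residue q G z = pair_residue (Suc q) (\<lambda>w. G w * ((w - z) * (w - cnj z))) z"
proof -
  have "residue (\<lambda>w. G w / ((w - z) * (w - cnj z)) ^ q) p
      = residue (\<lambda>w. G w * ((w - z) * (w - cnj z)) / ((w - z) * (w - cnj z)) ^ Suc q) p" for p
  proof (rule residue_cong)
    have "\<forall>\<^sub>F w in at p. w \<in> - {z, cnj z} - {p}"
    proof -
      have "\<forall>\<^sub>F w in at p. w \<noteq> z" "\<forall>\<^sub>F w in at p. w \<noteq> cnj z" "\<forall>\<^sub>F w in at p. w \<noteq> p"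
        by (auto simp: eventually_neq_at_within)
      then show ?thesis by eventually_elim auto
    qed
    then show "\<forall>\<^sub>F w in at p. G w / ((w - z) * (w - cnj z)) ^ q =
        G w * ((w - z) * (w - cnj z)) / ((w - z) * (w - cnj z)) ^ Suc q"
      by eventually_elim auto
  qed simp
  then show ?thesis unfolding pair_residue_def by simp
qed

lemma pair_residue_linear:
  assumes "open D" "\<forall>z\<in>D. cnj z \<in> D" "z \<in> D" "G holomorphic_on D" "H holomorphic_on D"
  shows "pair_residue q (\<lambda>w. c * G w + d * H w) z = c * pair_residue q G z + d * pair_residue q H z"
proof -
  obtain R where R: "conj_radius D z R" using conj_radius_exists[OF assms(1-3)] .
  have z: "z \<in> ball z R" using conj_radius_gt_0[OF R] by simp
  have GH: "(\<lambda>w. c * G w + d * H w) holomorphic_on D" using assms by (intro holomorphic_intros)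
  have *: "contour_integral (circlepath p R) (\<lambda>w. (c * G w + d * H w) / ((w - z) * (w - cnj z)) ^ q)
     = c * contour_integral (circlepath p R) (\<lambda>w. G w / ((w - z) * (w - cnj z)) ^ q)
     + d * contour_integral (circlepath p R) (\<lambda>w. H w / ((w - z) * (w - cnj z)) ^ q)"
    if p: "p \<in> {z, cnj z}" for p
  proof -
    note i = pair_residue_integrable[OF assms(4) R p z, of q] pair_residue_integrable[OF assms(5) R p z, of q]
    have "contour_integral (circlepath p R) (\<lambda>w. c * (G w / ((w - z) * (w - cnj z)) ^ q)
        + d * (H w / ((w - z) * (w - cnj z)) ^ q))
      = c * contour_integral (circlepath p R) (\<lambda>w. G w / ((w - z) * (w - cnj z)) ^ q)
      + d * contour_integral (circlepath p R) (\<lambda>w. H w / ((w - z) * (w - cnj z)) ^ q)"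
      using i by (simp add: contour_integral_add contour_integral_lmul contour_integrable_lmul
          del: times_divide_eq_right)
    then show ?thesis by (simp add: add_divide_distrib)
  qed
  have **: "(\<Sum>p\<in>{z, cnj z}. contour_integral (circlepath p R)
        (\<lambda>w. (c * G w + d * H w) / ((w - z) * (w - cnj z)) ^ q))
     = c * (\<Sum>p\<in>{z, cnj z}. contour_integral (circlepath p R)
        (\<lambda>w. G w / ((w - z) * (w - cnj z)) ^ q))
     + d * (\<Sum>p\<in>{z, cnj z}. contour_integral (circlepath p R)
        (\<lambda>w. H w / ((w - z) * (w - cnj z)) ^ q))"
    unfolding sum_distrib_left sum.distrib[symmetric] by (rule sum.cong[OF refl *])
  show ?thesis
    unfolding pair_residue_contour'[OF assms(1,4) R z] pair_residue_contour'[OF assms(1,5) R z]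
      pair_residue_contour'[OF assms(1) GH R z] ** by (simp add: add_divide_distrib)
qed

lemma pair_residue_sum:
  assumes "open D" "\<forall>z\<in>D. cnj z \<in> D" "z \<in> D" "finite I" "\<And>i. i \<in> I \<Longrightarrow> G i holomorphic_on D"
  shows "pair_residue q (\<lambda>w. \<Sum>i\<in>I. c i * G i w) z = (\<Sum>i\<in>I. c i * pair_residue q (G i) z)"
  using assms(4,5)
proof (induction I rule: finite_induct)
  case empty
  show ?case using pair_residue_linear[OF assms(1-3), of "\<lambda>_. 0" "\<lambda>_. 0" q 0 0] by simp
next
  case (insert i I)
  have "(\<lambda>w. \<Sum>i\<in>I. c i * G i w) holomorphic_on D"
    using insert by (intro holomorphic_intros) auto
  from pair_residue_linear[OF assms(1-3) insert.prems[of i] this, of q "c i" 1] insert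
  show ?case by simp
qed

text \<open>Integration by parts in \<open>w\<close>: a primitive of the integrand off the poles
  makes every circle integral in the contour formula vanish.\<close>

lemma pair_residue_derivative:
  assumes "open D" "\<forall>z\<in>D. cnj z \<in> D" "z \<in> D" "G holomorphic_on D"
    and "\<And>w. w \<in> D - {z, cnj z} \<Longrightarrow>
           (H has_field_derivative G w / ((w - z) * (w - cnj z)) ^ q) (at w)"
  shows "pair_residue q G z = 0"
proof -
  obtain R where R: "conj_radius D z R" using conj_radius_exists[OF assms(1-3)] .
  have z: "z \<in> ball z R" using conj_radius_gt_0[OF R] by simp
  have "((\<lambda>w. G w / ((w - z) * (w - cnj z)) ^ q) has_contour_integral 0) (circlepath p R)"
    if p: "p \<in> {z, cnj z}" for p
  proof (rule Cauchy_theorem_primitive)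
    show "(H has_field_derivative G w / ((w - z) * (w - cnj z)) ^ q) (at w within D - {z, cnj z})"
      if "w \<in> D - {z, cnj z}" for w
      using assms(5)[OF that] by (rule has_field_derivative_at_within)
    have "sphere p R \<subseteq> D" using R p by (auto simp: conj_radius_def)
    then show "path_image (circlepath p R) \<subseteq> D - {z, cnj z}"
      using conj_radius_poles(1)[OF R z p] conj_radius_gt_0[OF R]
      by (auto simp: path_image_circlepath_nonneg)
  qed auto
  then show ?thesis
    unfolding pair_residue_contour'[OF assms(1,4) R z]
    by (subst sum.neutral) (auto intro: contour_integral_unique)
qed

text \<open>There is no residue at infinity: on a large circle of radius \<open>R\<close> around
  both poles the integrand is of order \<open>1 / R ^ 2\<close>, so the integral is of order
  \<open>1 / R\<close> for every such \<open>R\<close>.\<close>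

lemma pair_residue_monomial:
  assumes "j + 2 \<le> 2 * q"
  shows "pair_residue q (\<lambda>w. w ^ j) z = 0"
proof -
  have bound: "cmod (2 * pi * \<i> * pair_residue q (\<lambda>w. w ^ j) z) \<le> 2 * pi * 4 ^ q / R"
    if R: "R \<ge> 2 * cmod z + 1" for R
  proof -
    have R0: "R \<ge> 1" using R norm_ge_zero[of z] by linarith
    \<comment> \<open>The centre \<open>0\<close> is real, so a single circle enclosing both poles
      represents the pair residue.\<close>
    have cr: "conj_radius UNIV 0 R" using R0 by (simp add: conj_radius_def)
    have z: "z \<in> ball 0 R" using R R0 by simp
    have hol: "(\<lambda>w. w ^ j) holomorphic_on UNIV" by (intro holomorphic_intros)
    let ?f = "\<lambda>w. w ^ j / ((w - z) * (w - cnj z)) ^ q"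
    have "2 * pi * \<i> * pair_residue q (\<lambda>w. w ^ j) z = contour_integral (circlepath 0 R) ?f"
      using pair_residue_contour[OF open_UNIV hol cr z, of q] by simp
    moreover have "(?f has_contour_integral contour_integral (circlepath 0 R) ?f) (circlepath 0 R)"
      using pair_residue_integrable[OF hol cr _ z, of 0 q] by (intro has_contour_integral_integral) simp
    ultimately have "(?f has_contour_integral 2 * pi * \<i> * pair_residue q (\<lambda>w. w ^ j) z) (circlepath 0 R)"
      by simp
    then have "cmod (2 * pi * \<i> * pair_residue q (\<lambda>w. w ^ j) z) \<le> (4 ^ q / R ^ 2) * (2 * pi * R)"
    proof (rule has_contour_integral_bound_circlepath)
      fix w :: complex assume w: "cmod (w - 0) = R"
      have "cmod (w - z) \<ge> R / 2" "cmod (w - cnj z) \<ge> R / 2"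
        using w R R0 norm_triangle_ineq2[of w z] norm_triangle_ineq2[of w "cnj z"] by auto
      then have "cmod (w - z) * cmod (w - cnj z) \<ge> (R / 2) * (R / 2)"
        using R0 by (intro mult_mono) auto
      then have le: "(cmod (w - z) * cmod (w - cnj z)) ^ q \<ge> ((R / 2) * (R / 2)) ^ q"
        using R0 by (intro power_mono) auto
      have pos: "0 < ((R / 2) * (R / 2)) ^ q" using R0 by simp
      have "cmod (?f w) = R ^ j / (cmod (w - z) * cmod (w - cnj z)) ^ q"
        using w by (simp add: norm_divide norm_mult norm_power)
      also have "\<dots> \<le> R ^ j / ((R / 2) * (R / 2)) ^ q"
        by (intro divide_left_mono le mult_pos_pos less_le_trans[OF pos le] pos) (use R0 in auto)
      also have "\<dots> = 4 ^ q * (R ^ j / R ^ (2 * q))"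
        by (simp add: power_mult_distrib power_divide power2_eq_square[symmetric] power_mult[symmetric])
      also have "R ^ j / R ^ (2 * q) \<le> 1 / R ^ 2"
      proof -
        have "R ^ (j + 2) \<le> R ^ (2 * q)" using R0 assms by (intro power_increasing) auto
        then show ?thesis using R0 by (simp add: field_simps power_add power2_eq_square)
      qed
      finally show "cmod (?f w) \<le> 4 ^ q / R ^ 2" by simp
    qed (use R0 in auto)
    also have "\<dots> = 2 * pi * 4 ^ q / R" using R0 by (simp add: power2_eq_square)
    finally show ?thesis .
  qed
  have "cmod (2 * pi * \<i> * pair_residue q (\<lambda>w. w ^ j) z) \<le> 0"
  proof (rule tendsto_lowerbound)
    show "((\<lambda>R. 2 * pi * 4 ^ q / R) \<longlongrightarrow> 0) at_top"
      by (intro tendsto_divide_0[OF tendsto_const] filterlim_at_top_imp_at_infinity filterlim_ident)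
    show "\<forall>\<^sub>F R in at_top. cmod (2 * pi * \<i> * pair_residue q (\<lambda>w. w ^ j) z) \<le> 2 * pi * 4 ^ q / R"
      using eventually_ge_at_top[of "2 * cmod z + 1"] by eventually_elim (rule bound)
  qed simp
  then show ?thesis by simp
qed

text \<open>The remainder is holomorphic on all of \<open>D\<close>, not only on a disc around
  \<open>0\<close>: each induction step divides \<open>Y w - Y 0\<close> by \<open>w\<close>, which
  leaves a removable singularity.\<close>

lemma holomorphic_taylor_split:
  assumes "open D" "0 \<in> D" "G holomorphic_on D"
  shows "\<exists>a Y. Y holomorphic_on D \<and> (\<forall>w\<in>D. G w = (\<Sum>j<n. a j * w ^ j) + w ^ n * Y w)"
proof (induction n)
  case 0
  show ?case using assms by (intro exI[of _ "\<lambda>_. 0"] exI[of _ G]) auto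
next
  case (Suc n)
  then obtain a Y where Y: "Y holomorphic_on D"
    "\<And>w. w \<in> D \<Longrightarrow> G w = (\<Sum>j<n. a j * w ^ j) + w ^ n * Y w" by blast
  define Z where "Z = (\<lambda>w. if w = 0 then deriv Y 0 else (Y w - Y 0) / (w - 0))"
  have "Z holomorphic_on D" unfolding Z_def using pole_lemma_open[OF Y(1) assms(1), of 0] .
  moreover have "G w = (\<Sum>j<Suc n. (if j = n then Y 0 else a j) * w ^ j) + w ^ Suc n * Z w"
    if "w \<in> D" for w
  proof -
    have "Y w = Y 0 + w * Z w" by (simp add: Z_def)
    then show ?thesis using Y(2)[OF that] by (simp add: algebra_simps)
  qed
  ultimately show ?case by (intro exI[of _ "\<lambda>j. if j = n then Y 0 else a j"] exI[of _ Z]) blast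
qed

text \<open>The identity expresses that \<open>pair_residue (Suc q)\<close> annihilates the derivative of \<open>w * H w / Q ^ q\<close>,
  where \<open>Q = (w - z) * (w - cnj z)\<close>. The differential equation for \<open>H\<close> is solvable once the
  Taylor polynomial of degree \<open>< q\<close>, which \<open>pair_residue q\<close> does not see, has been removed from \<open>G\<close>.\<close>

lemma pair_residue_almansi_step:
  assumes "open D" "\<forall>z\<in>D. cnj z \<in> D" "0 \<in> D" "starlike D" "G holomorphic_on D" "1 \<le> q"
  shows "\<exists>H. H holomorphic_on D \<and> (\<forall>z\<in>D. pair_residue q G z =
            of_real (cmod z ^ 2) * pair_residue (Suc q) H z - pair_residue (Suc q) (\<lambda>w. w ^ 2 * H w) z)"
proof -
  obtain a Y0 where Y0: "Y0 holomorphic_on D"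
    "\<And>w. w \<in> D \<Longrightarrow> G w = (\<Sum>j<q. a j * w ^ j) + w ^ q * Y0 w"
    using holomorphic_taylor_split[OF assms(1,3,5), of q] by blast
  \<comment> \<open>Starlikeness of \<open>D\<close> provides this primitive.\<close>
  obtain Y where Y: "\<And>w. w \<in> D \<Longrightarrow> (Y has_field_derivative - of_nat q * Y0 w) (at w)"
  proof -
    have h: "(\<lambda>w. - of_nat q * Y0 w) holomorphic_on D" by (intro holomorphic_intros Y0(1))
    have "\<exists>Y. \<forall>w\<in>D. (Y has_field_derivative - of_nat q * Y0 w) (at w)"
      by (rule holomorphic_starlike_primitive[OF holomorphic_on_imp_continuous_on[OF h]
            assms(4,1) finite.emptyI])
         (use holomorphic_on_imp_differentiable_at[OF h assms(1)] in auto)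
    then show ?thesis using that by blast
  qed
  have Yh: "Y holomorphic_on D" using Y assms(1) holomorphic_on_open by blast
  \<comment> \<open>The ansatz \<open>w ^ (q - 1) * Y w\<close> solves
    \<open>(w H)' = q (H - w ^ q * Y0)\<close>, because \<open>Y' = - q * Y0\<close>.\<close>
  define H where "H = (\<lambda>w. w ^ (q - 1) * Y w)"
  have Hh: "H holomorphic_on D" unfolding H_def by (intro holomorphic_intros Yh)
  have wH: "((\<lambda>w. w * H w) has_field_derivative of_nat q * (H w - w ^ q * Y0 w)) (at w)"
    if "w \<in> D" for w
  proof -
    have "((\<lambda>w. w ^ q * Y w) has_field_derivative
        of_nat q * w ^ (q - 1) * Y w + w ^ q * (- of_nat q * Y0 w)) (at w)"
      using Y[OF that] by (auto intro!: derivative_eq_intros)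
    moreover have "(\<lambda>w. w ^ q * Y w) = (\<lambda>w. w * H w)"
      using assms(6) by (auto simp: H_def power_eq_if)
    ultimately show ?thesis by (simp add: H_def algebra_simps)
  qed
  have "pair_residue q G z = of_real (cmod z ^ 2) * pair_residue (Suc q) H z - pair_residue (Suc q) (\<lambda>w. w ^ 2 * H w) z"
    if z: "z \<in> D" for z
  proof -
    note lin = pair_residue_linear[OF assms(1,2) z]
    let ?Q = "\<lambda>w. (w - z) * (w - cnj z)"
    have P: "pair_residue q (\<lambda>w. \<Sum>j<q. a j * w ^ j) z = 0"
    proof -
      have "j + 2 \<le> 2 * q" if "j < q" for j using that by linarith
      then show ?thesis
        using pair_residue_sum[OF assms(1,2) z, where I = "{..<q}" and G = "\<lambda>j w. w ^ j" and q = q and c = a]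
        by (simp add: pair_residue_monomial holomorphic_intros)
    qed
    have Ph: "(\<lambda>w. \<Sum>j<q. a j * w ^ j) holomorphic_on D" by (intro holomorphic_intros)
    have Rh: "(\<lambda>w. w ^ q * Y0 w) holomorphic_on D" by (intro holomorphic_intros Y0(1))
    have G: "pair_residue q G z = pair_residue q (\<lambda>w. w ^ q * Y0 w) z"
      using pair_residue_cong[where q = q, OF assms(1,2) z Y0(2)] lin[OF Ph Rh, where q = q and c = 1 and d = 1] P by simp
    \<comment> \<open>\<open>?E\<close> is the numerator of the derivative of
      \<open>w * H w / ?Q w ^ q\<close> over the denominator \<open>?Q w ^ Suc q\<close>; the factor
      \<open>2 * w - (z + cnj z)\<close> is the derivative of \<open>?Q\<close>.\<close>
    let ?E = "\<lambda>w. of_nat q * (H w - w ^ q * Y0 w) * ?Q w - of_nat q * (2 * w - (z + cnj z)) * (w * H w)"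
    have Eh: "?E holomorphic_on D" by (intro holomorphic_intros Hh Y0(1))
    have "pair_residue (Suc q) ?E z = 0"
    proof (rule pair_residue_derivative[OF assms(1,2) z Eh, of "\<lambda>w. w * H w / ?Q w ^ q"])
      fix w assume w: "w \<in> D - {z, cnj z}"
      then have Q0: "?Q w \<noteq> 0" by auto
      have dQ: "(?Q has_field_derivative (2 * w - (z + cnj z))) (at w)"
        by (auto intro!: derivative_eq_intros simp: algebra_simps)
      have "((\<lambda>w. w * H w / ?Q w ^ q) has_field_derivative
          (of_nat q * (H w - w ^ q * Y0 w) * ?Q w ^ q
            - w * H w * (of_nat q * ((2 * w - (z + cnj z)) * ?Q w ^ (q - Suc 0)))) / (?Q w ^ q * ?Q w ^ q)) (at w)"
        using w Q0 by (intro DERIV_divide wH DERIV_power[OF dQ]) auto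
      moreover have "(A * x ^ q - B * (C * (E * x ^ (q - Suc 0)))) / (x ^ q * x ^ q)
          = (A * x - C * E * B) / x ^ Suc q" if "x \<noteq> 0" for A B C E x :: complex
        using that assms(6) by (cases q) (auto simp: field_simps)
      ultimately show "((\<lambda>w. w * H w / ?Q w ^ q) has_field_derivative ?E w / ?Q w ^ Suc q) (at w)"
        using Q0 by simp
    qed
    \<comment> \<open>For the kernel \<open>Q\<close> and its derivative \<open>Q'\<close> one has
      \<open>Q - w Q' = z * cnj z - w ^ 2\<close>. This produces the factor
      \<open>cmod z ^ 2\<close> of the Almansi expansion.\<close>
    moreover have "?E = (\<lambda>w. of_nat q * (of_real (cmod z ^ 2) * H w - w ^ 2 * H w) +
        (- of_nat q) * (w ^ q * Y0 w * ?Q w))"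
      unfolding complex_norm_square by (auto simp: algebra_simps power2_eq_square)
    moreover have "(\<lambda>w. of_real (cmod z ^ 2) * H w - w ^ 2 * H w) holomorphic_on D"
      "(\<lambda>w. w ^ q * Y0 w * ?Q w) holomorphic_on D" by (intro holomorphic_intros Hh Y0(1))+
    ultimately have "of_nat q * pair_residue (Suc q) (\<lambda>w. of_real (cmod z ^ 2) * H w - w ^ 2 * H w) z
        - of_nat q * pair_residue (Suc q) (\<lambda>w. w ^ q * Y0 w * ?Q w) z = 0"
      using lin[where G = "\<lambda>w. of_real (cmod z ^ 2) * H w - w ^ 2 * H w" and q = "Suc q"
          and H = "\<lambda>w. w ^ q * Y0 w * ?Q w" and c = "of_nat q" and d = "- of_nat q"] by simp
    then have "pair_residue (Suc q) (\<lambda>w. of_real (cmod z ^ 2) * H w - w ^ 2 * H w) z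
        = pair_residue (Suc q) (\<lambda>w. w ^ q * Y0 w * ?Q w) z"
      using assms(6) by auto
    moreover have "(\<lambda>w. w ^ 2 * H w) holomorphic_on D" by (intro holomorphic_intros Hh)
    ultimately show ?thesis
      using lin[OF Hh, where H = "\<lambda>w. w ^ 2 * H w" and q = "Suc q" and c = "of_real (cmod z ^ 2)"
          and d = "-1"]
      by (simp add: G pair_residue_shift[of q "\<lambda>w. w ^ q * Y0 w"])
  qed
  then show ?thesis using Hh by blast
qed

text \<open>Iteration of \<open>pair_residue_almansi_step\<close>: the term of index
  \<open>k\<close> splits into one with factor \<open>cmod z ^ (2 * k + 2)\<close> and one with the
  old factor and numerator \<open>- w ^ 2 * L k w\<close>. The new numerators do not depend on
  \<open>z\<close>.\<close>

lemma pair_residue_almansi: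
  assumes "open D" "\<forall>z\<in>D. cnj z \<in> D" "0 \<in> D" "starlike D" "G holomorphic_on D"
  shows "\<exists>H. (\<forall>k\<le>n. H k holomorphic_on D) \<and>
     (\<forall>z\<in>D. pair_residue 1 G z = (\<Sum>k\<le>n. of_real (cmod z ^ (2 * k)) * pair_residue (Suc n) (H k) z))"
proof (induction n)
  case 0
  show ?case using assms(5) by (intro exI[of _ "\<lambda>_. G"]) simp
next
  case (Suc n)
  then obtain H where H: "\<And>k. k \<le> n \<Longrightarrow> H k holomorphic_on D"
    "\<And>z. z \<in> D \<Longrightarrow> pair_residue 1 G z = (\<Sum>k\<le>n. of_real (cmod z ^ (2 * k)) * pair_residue (Suc n) (H k) z)"
    by blast
  have "\<forall>k\<in>{..n}. \<exists>L. L holomorphic_on D \<and> (\<forall>z\<in>D. pair_residue (Suc n) (H k) z =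
      of_real (cmod z ^ 2) * pair_residue (Suc (Suc n)) L z - pair_residue (Suc (Suc n)) (\<lambda>w. w ^ 2 * L w) z)"
    using pair_residue_almansi_step[OF assms(1-4) H(1), of _ "Suc n"] by auto
  then obtain L where L: "\<And>k. k \<le> n \<Longrightarrow> L k holomorphic_on D"
    "\<And>k z. k \<le> n \<Longrightarrow> z \<in> D \<Longrightarrow> pair_residue (Suc n) (H k) z =
      of_real (cmod z ^ 2) * pair_residue (Suc (Suc n)) (L k) z - pair_residue (Suc (Suc n)) (\<lambda>w. w ^ 2 * L k w) z"
    unfolding bchoice_iff by (metis atMost_iff)
  \<comment> \<open>Continuing \<open>L\<close> by zero above \<open>n\<close> lets one formula for
    \<open>M\<close> cover the new top index \<open>Suc n\<close>; index \<open>0\<close> has no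
    predecessor to collect from.\<close>
  define L' where "L' = (\<lambda>k w. if k \<le> n then L k w else 0)"
  define M where "M = (\<lambda>k w. (if k = 0 then 0 else L' (k - 1) w) + (- 1) * (w ^ 2 * L' k w))"
  have L'h: "L' k holomorphic_on D" for k
    using L(1)[of k] by (cases "k \<le> n") (auto simp: L'_def)
  have Mh: "M k holomorphic_on D" for k
    unfolding M_def using L'h by (cases "k = 0") (auto intro!: holomorphic_intros)
  have "pair_residue 1 G z = (\<Sum>k\<le>Suc n. of_real (cmod z ^ (2 * k)) * pair_residue (Suc (Suc n)) (M k) z)"
    if z: "z \<in> D" for z
  proof -
    let ?K = "pair_residue (Suc (Suc n))" and ?r = "\<lambda>k. complex_of_real (cmod z ^ (2 * k))"
    have sqh: "(\<lambda>w. w ^ 2 * L' k w) holomorphic_on D" for k by (intro holomorphic_intros L'h)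
    have zero: "?K (\<lambda>w. 0) z = 0" using pair_residue_linear[OF assms(1,2) z L'h L'h, of _ 0 0 0 0] by simp
    have M0: "?K (M 0) z = - ?K (\<lambda>w. w ^ 2 * L' 0 w) z"
      using pair_residue_linear[OF assms(1,2) z L'h sqh, of _ 0 0 "-1" 0] by (simp add: M_def)
    have MS: "?K (M (Suc k)) z = ?K (L' k) z - ?K (\<lambda>w. w ^ 2 * L' (Suc k) w) z" for k
      using pair_residue_linear[OF assms(1,2) z L'h sqh, of _ 1 k "-1" "Suc k"] by (simp add: M_def)
    have top: "?K (\<lambda>w. w ^ 2 * L' (Suc n) w) z = 0" using zero by (simp add: L'_def)
    have "(\<Sum>k\<le>Suc n. ?r k * ?K (M k) z)
        = ?r 0 * ?K (M 0) z + (\<Sum>k\<le>n. ?r (Suc k) * ?K (M (Suc k)) z)"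
      by (rule sum.atMost_Suc_shift)
    also have "\<dots> = (\<Sum>k\<le>n. ?r (Suc k) * ?K (L' k) z)
        - (?r 0 * ?K (\<lambda>w. w ^ 2 * L' 0 w) z + (\<Sum>k\<le>n. ?r (Suc k) * ?K (\<lambda>w. w ^ 2 * L' (Suc k) w) z))"
      unfolding M0 MS by (simp add: right_diff_distrib sum_subtractf)
    also have "?r 0 * ?K (\<lambda>w. w ^ 2 * L' 0 w) z + (\<Sum>k\<le>n. ?r (Suc k) * ?K (\<lambda>w. w ^ 2 * L' (Suc k) w) z)
        = (\<Sum>k\<le>Suc n. ?r k * ?K (\<lambda>w. w ^ 2 * L' k w) z)"
      by (rule sum.atMost_Suc_shift[symmetric])
    also have "\<dots> = (\<Sum>k\<le>n. ?r k * ?K (\<lambda>w. w ^ 2 * L' k w) z)" by (simp add: top)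
    also have "(\<Sum>k\<le>n. ?r (Suc k) * ?K (L' k) z) - \<dots>
        = (\<Sum>k\<le>n. ?r k * (of_real (cmod z ^ 2) * ?K (L' k) z - ?K (\<lambda>w. w ^ 2 * L' k w) z))"
      unfolding sum_subtractf[symmetric]
      by (intro sum.cong) (auto simp: algebra_simps power2_eq_square)
    also have "\<dots> = (\<Sum>k\<le>n. ?r k * pair_residue (Suc n) (H k) z)"
      by (intro sum.cong) (auto simp: L(2)[OF _ z] L'_def)
    finally show ?thesis by (simp only: H(2)[OF z])
  qed
  then show ?case using Mh by blast
qed

section \<open>Directional derivatives and harmonic functions on a coordinate frame\<close>

text \<open>Openness along the directions \<open>v i\<close> only: a nonempty subset of a proper
  subspace is never open in the algebra, while partial derivatives see just these lines.\<close>

definition line_open :: "nat \<Rightarrow> (nat \<Rightarrow> 'a::alternative_star_algebra) \<Rightarrow> 'a set \<Rightarrow> bool" where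
  "line_open m v \<Omega> \<longleftrightarrow> (\<forall>x\<in>\<Omega>. \<forall>i\<le>m. \<forall>\<^sub>F t in nhds 0. x + t *\<^sub>R v i \<in> \<Omega>)"

lemma partial_deriv_cong:
  assumes "line_open m v \<Omega>" "x \<in> \<Omega>" "i \<le> m" "\<And>y. y \<in> \<Omega> \<Longrightarrow> f y = g y"
  shows "partial_deriv v i f x = partial_deriv v i g x"
  unfolding partial_deriv_def
proof (rule vector_derivative_cong_eq)
  have "\<forall>\<^sub>F t in nhds 0. x + t *\<^sub>R v i \<in> \<Omega>" using assms by (simp add: line_open_def)
  then show "\<forall>\<^sub>F t in nhds 0. t \<in> UNIV \<longrightarrow> f (x + t *\<^sub>R v i) = g (x + t *\<^sub>R v i)"
    by eventually_elim (simp add: assms(4))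
qed auto

lemma has_vector_derivative_line_cong:
  assumes "line_open m v \<Omega>" "x \<in> \<Omega>" "i \<le> m" "\<And>y. y \<in> \<Omega> \<Longrightarrow> f y = g y"
    and "((\<lambda>t. f (x + t *\<^sub>R v i)) has_vector_derivative d) (at 0)"
  shows "((\<lambda>t. g (x + t *\<^sub>R v i)) has_vector_derivative d) (at 0)"
proof -
  have "\<forall>\<^sub>F t in nhds 0. x + t *\<^sub>R v i \<in> \<Omega>" using assms by (simp add: line_open_def)
  then have "\<forall>\<^sub>F t in nhds 0. f (x + t *\<^sub>R v i) = g (x + t *\<^sub>R v i)"
    by eventually_elim (simp add: assms(4))
  then have "\<forall>\<^sub>F t in nhds 0. t \<in> UNIV \<longrightarrow> f (x + t *\<^sub>R v i) = g (x + t *\<^sub>R v i)"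
    by eventually_elim simp
  from iffD1[OF has_vector_derivative_cong_ev[OF this, of d] assms(5)] show ?thesis
    using assms(2,4) by simp
qed

lemma has_vector_derivative_partial_deriv:
  "(\<lambda>t::real. f (x + t *\<^sub>R v i)) differentiable at 0 \<Longrightarrow>
    ((\<lambda>t. f (x + t *\<^sub>R v i)) has_vector_derivative partial_deriv v i f x) (at 0)"
  by (simp add: partial_deriv_def vector_derivative_works)

lemma Ck_on_cong:
  assumes "line_open m v \<Omega>" "\<And>y. y \<in> \<Omega> \<Longrightarrow> f y = g y" "Ck_on k m v \<Omega> f"
  shows "Ck_on k m v \<Omega> g"
  using assms(2,3)
proof (induction k arbitrary: f g)
  case 0
  then show ?case using continuous_on_cong[of \<Omega> \<Omega> f g] by simp
next
  case (Suc k)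
  have "continuous_on \<Omega> g" using Suc.prems continuous_on_cong[of \<Omega> \<Omega> f g] by simp
  moreover have "(\<lambda>t::real. g (x + t *\<^sub>R v i)) differentiable at 0" if "i \<le> m" "x \<in> \<Omega>" for i x
  proof -
    have "(\<lambda>t::real. f (x + t *\<^sub>R v i)) differentiable at 0" using Suc.prems(2) that by simp
    then have "((\<lambda>t. f (x + t *\<^sub>R v i)) has_vector_derivative partial_deriv v i f x) (at 0)"
      by (rule has_vector_derivative_partial_deriv)
    from has_vector_derivative_line_cong[OF assms(1) that(2,1) Suc.prems(1) this]
    show ?thesis by (rule differentiableI_vector)
  qed
  moreover have "Ck_on k m v \<Omega> (partial_deriv v i g)" if "i \<le> m" for i
    using Suc.IH[of "partial_deriv v i f" "partial_deriv v i g"] Suc.prems that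
      partial_deriv_cong[OF assms(1) _ that, of _ f g] by auto
  ultimately show ?case by simp
qed

lemma partial_deriv_eq:
  "((\<lambda>t. f (x + t *\<^sub>R v i)) has_vector_derivative d) (at 0) \<Longrightarrow> partial_deriv v i f x = d"
  by (simp add: partial_deriv_def vector_derivative_at)

text \<open>Candidates \<open>f1\<close> and \<open>f2\<close> for the derivatives are handed in
  explicitly, so that harmonicity reduces to an algebraic computation with them.\<close>

lemma Ck_on_2I:
  assumes lo: "line_open m v \<Omega>"
    and f: "continuous_on \<Omega> f"
    and f1: "\<And>i x. i \<le> m \<Longrightarrow> x \<in> \<Omega> \<Longrightarrow>
      ((\<lambda>t. f (x + t *\<^sub>R v i)) has_vector_derivative f1 i x) (at 0)"
    and c1: "\<And>i. i \<le> m \<Longrightarrow> continuous_on \<Omega> (f1 i)"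
    and f2: "\<And>i j x. i \<le> m \<Longrightarrow> j \<le> m \<Longrightarrow> x \<in> \<Omega> \<Longrightarrow>
      ((\<lambda>t. f1 i (x + t *\<^sub>R v j)) has_vector_derivative f2 i j x) (at 0)"
    and c2: "\<And>i j. i \<le> m \<Longrightarrow> j \<le> m \<Longrightarrow> continuous_on \<Omega> (f2 i j)"
  shows "Ck_on 2 m v \<Omega> f"
    and "\<And>x. x \<in> \<Omega> \<Longrightarrow> laplacian m v f x = (\<Sum>i\<le>m. f2 i i x)"
proof -
  have p1: "f1 i x = partial_deriv v i f x" if "i \<le> m" "x \<in> \<Omega>" for i x
    using partial_deriv_eq[of f x v i "f1 i x"] f1[OF that] by simp
  have p2: "f2 i j x = partial_deriv v j (f1 i) x" if "i \<le> m" "j \<le> m" "x \<in> \<Omega>" for i j x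
    using partial_deriv_eq[of "f1 i" x v j "f2 i j x"] f2[OF that] by simp
  have C0: "Ck_on 0 m v \<Omega> (partial_deriv v j (f1 i))" if "i \<le> m" "j \<le> m" for i j
    using Ck_on_cong[OF lo, of "f2 i j" "partial_deriv v j (f1 i)" 0] p2[OF that] c2[OF that] by simp
  have C1': "Ck_on 1 m v \<Omega> (f1 i)" if "i \<le> m" for i
    using c1[OF that] C0[OF that] f2[OF that] by (auto intro: differentiableI_vector)
  have C1: "Ck_on 1 m v \<Omega> (partial_deriv v i f)" if "i \<le> m" for i
  proof (rule Ck_on_cong[where f = "f1 i", OF lo])
    show "f1 i y = partial_deriv v i f y" if "y \<in> \<Omega>" for y by (rule p1) fact+
  qed (rule C1'[OF that])
  then show "Ck_on 2 m v \<Omega> f"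
    unfolding numeral_2_eq_2 using f differentiableI_vector[OF f1] by auto
  show "laplacian m v f x = (\<Sum>i\<le>m. f2 i i x)" if "x \<in> \<Omega>" for x
    unfolding laplacian_def
    by (intro sum.cong refl)
       (use p1 p2 partial_deriv_cong[OF lo that, of _ "f1 _" "partial_deriv v _ f"] that in auto)
qed

lemma Ck_on_2D:
  assumes "Ck_on 2 m v \<Omega> f" "i \<le> m"
  shows "continuous_on \<Omega> f"
    and "\<And>x. x \<in> \<Omega> \<Longrightarrow>
      ((\<lambda>t. f (x + t *\<^sub>R v i)) has_vector_derivative partial_deriv v i f x) (at 0)"
    and "continuous_on \<Omega> (partial_deriv v i f)"
    and "\<And>j x. j \<le> m \<Longrightarrow> x \<in> \<Omega> \<Longrightarrow> ((\<lambda>t. partial_deriv v i f (x + t *\<^sub>R v j))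
      has_vector_derivative partial_deriv v j (partial_deriv v i f) x) (at 0)"
    and "\<And>j. j \<le> m \<Longrightarrow> continuous_on \<Omega> (partial_deriv v j (partial_deriv v i f))"
  using assms unfolding numeral_2_eq_2 by (auto intro: has_vector_derivative_partial_deriv)

lemma harmonic_on_sum:
  assumes lo: "line_open m v \<Omega>" and u: "\<And>k. k \<in> I \<Longrightarrow> harmonic_on m v \<Omega> (u k)"
  shows "harmonic_on m v \<Omega> (\<lambda>x. \<Sum>k\<in>I. a k *\<^sub>R u k x)"
proof -
  have C: "Ck_on 2 m v \<Omega> (u k)" if "k \<in> I" for k using u that by (simp add: harmonic_on_def)
  have 0: "continuous_on \<Omega> (\<lambda>x. \<Sum>k\<in>I. a k *\<^sub>R u k x)"
    by (intro continuous_intros Ck_on_2D(1)[OF C, of _ 0]) auto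
  have 1: "((\<lambda>t. \<Sum>k\<in>I. a k *\<^sub>R u k (x + t *\<^sub>R v i)) has_vector_derivative
      (\<Sum>k\<in>I. a k *\<^sub>R partial_deriv v i (u k) x)) (at 0)" if "i \<le> m" "x \<in> \<Omega>" for i x
    by (intro has_vector_derivative_sum
        bounded_linear.has_vector_derivative[OF bounded_linear_scaleR_right] Ck_on_2D(2)[OF C that])
  have 2: "continuous_on \<Omega> (\<lambda>x. \<Sum>k\<in>I. a k *\<^sub>R partial_deriv v i (u k) x)" if "i \<le> m" for i
    by (intro continuous_intros Ck_on_2D(3)[OF C that])
  have 3: "((\<lambda>t. \<Sum>k\<in>I. a k *\<^sub>R partial_deriv v i (u k) (x + t *\<^sub>R v j)) has_vector_derivative
      (\<Sum>k\<in>I. a k *\<^sub>R partial_deriv v j (partial_deriv v i (u k)) x)) (at 0)"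
    if "i \<le> m" "j \<le> m" "x \<in> \<Omega>" for i j x
    by (intro has_vector_derivative_sum
        bounded_linear.has_vector_derivative[OF bounded_linear_scaleR_right] Ck_on_2D(4)[OF C that])
  have 4: "continuous_on \<Omega> (\<lambda>x. \<Sum>k\<in>I. a k *\<^sub>R partial_deriv v j (partial_deriv v i (u k)) x)"
    if "i \<le> m" "j \<le> m" for i j
    by (intro continuous_intros Ck_on_2D(5)[OF C that])
  note I = Ck_on_2I[where ?f1.0 = "\<lambda>i x. \<Sum>k\<in>I. a k *\<^sub>R partial_deriv v i (u k) x"
      and ?f2.0 = "\<lambda>i j x. \<Sum>k\<in>I. a k *\<^sub>R partial_deriv v j (partial_deriv v i (u k)) x", OF lo 0 1 2 3 4]
  have "(\<Sum>i\<le>m. \<Sum>k\<in>I. a k *\<^sub>R partial_deriv v i (partial_deriv v i (u k)) x)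
      = (\<Sum>k\<in>I. a k *\<^sub>R laplacian m v (u k) x)" for x
    unfolding laplacian_def scaleR_sum_right by (rule sum.swap)
  then show ?thesis using u I by (simp add: harmonic_on_def)
qed

text \<open>At a maximum \<open>g'\<close> vanishes; if \<open>l\<close> were positive,
  \<open>g'\<close> would be positive just to the right and the mean value theorem would give a
  larger value of \<open>g\<close>.\<close>

lemma second_derivative_local_max:
  fixes g g' :: "real \<Rightarrow> real"
  assumes "\<forall>\<^sub>F t in nhds 0. (g has_real_derivative g' t) (at t)"
    and "(g' has_real_derivative l) (at 0)" and "\<forall>\<^sub>F t in nhds 0. g t \<le> g 0"
  shows "l \<le> 0"
proof (rule ccontr)
  assume "\<not> l \<le> 0"
  then have l: "l > 0" by simp
  obtain e1 where e1: "e1 > 0" "\<And>t. \<bar>t\<bar> < e1 \<Longrightarrow> (g has_real_derivative g' t) (at t)"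
    using assms(1) by (auto simp: eventually_nhds_metric dist_real_def)
  obtain e2 where e2: "e2 > 0" "\<And>t. \<bar>t\<bar> < e2 \<Longrightarrow> g t \<le> g 0"
    using assms(3) by (auto simp: eventually_nhds_metric dist_real_def)
  obtain e3 where e3: "e3 > 0" "\<And>h. 0 < h \<Longrightarrow> h < e3 \<Longrightarrow> g' 0 < g' (0 + h)"
    using DERIV_pos_inc_right[OF assms(2) l] by blast
  have "g' 0 = 0"
    by (rule DERIV_local_max[of g "g' 0" 0 e2]) (use e1 e2 in auto)
  then have pos: "0 < g' h" if "0 < h" "h < e3" for h using e3(2)[of h] that by simp
  define d where "d = min e1 (min e2 e3) / 2"
  have d: "0 < d" "d < e1" "d < e2" "d < e3" using e1(1) e2(1) e3(1) by (auto simp: d_def)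
  have "\<exists>z>0. z < d \<and> g d - g 0 = (d - 0) * g' z"
    by (rule MVT2[OF d(1)]) (use e1(2) d in auto)
  then obtain z where "0 < z" "z < d" "g d - g 0 = d * g' z" by auto
  then have "g d > g 0" using pos[of z] d by (metis diff_gt_0_iff_gt less_trans mult_pos_pos)
  then show False using e2(2)[of d] d by simp
qed

text \<open>The coordinates are total linear functionals dual to \<open>v\<close>, so that
  coordinate computations need no membership in the span.\<close>

locale coord_frame =
  fixes m :: nat and v :: "nat \<Rightarrow> 'a::alternative_star_algebra" and c :: "nat \<Rightarrow> 'a \<Rightarrow> real"
  assumes linear_c: "linear (c i)"
    and c_v: "i \<le> m \<Longrightarrow> j \<le> m \<Longrightarrow> c i (v j) = (if i = j then 1 else 0)"
begin

definition nsq :: "'a \<Rightarrow> real" where "nsq x = (\<Sum>i\<le>m. (c i x)\<^sup>2)"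

text \<open>For a point of a hypercomplex subspace this is the slice coordinate folded into the
  closed upper half-plane, as \<open>zeta_slice_point\<close> shows later.\<close>

definition zeta :: "'a \<Rightarrow> complex" where
  "zeta x = Complex (c 0 x) (sqrt (\<Sum>i=1..m. (c i x)\<^sup>2))"

lemma continuous_on_c [continuous_intros]: "continuous_on S (c i)"
  using linear_c linear_continuous_on linear_conv_bounded_linear by blast

lemma c_line: "i \<le> m \<Longrightarrow> j \<le> m \<Longrightarrow> c i (x + t *\<^sub>R v j) = c i x + (if i = j then t else 0)"
  using linear_c[of i] c_v[of i j] by (simp add: linear_add linear_scale)

lemma nsq_split: "nsq x = (c 0 x)\<^sup>2 + (\<Sum>i=1..m. (c i x)\<^sup>2)"
  unfolding nsq_def by (simp add: atMost_atLeast0 sum.atLeast_Suc_atMost)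

lemma cmod_zeta: "(cmod (zeta x))\<^sup>2 = nsq x"
  by (simp add: zeta_def cmod_power2 nsq_split sum_nonneg)

lemma continuous_on_nsq [continuous_intros]: "continuous_on S nsq"
  unfolding nsq_def by (intro continuous_intros)

lemma continuous_on_zeta [continuous_intros]: "continuous_on S zeta"
  unfolding zeta_def Complex_eq by (intro continuous_intros)

lemma nsq_line: "i \<le> m \<Longrightarrow> nsq (x + t *\<^sub>R v i) = nsq x + 2 * t * c i x + t\<^sup>2"
proof -
  assume i: "i \<le> m"
  have "nsq (x + t *\<^sub>R v i) = (\<Sum>j\<le>m. (c j x)\<^sup>2 + (if j = i then 2 * t * c i x + t\<^sup>2 else 0))"
    unfolding nsq_def by (intro sum.cong) (auto simp: c_line i power2_eq_square algebra_simps)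
  then show ?thesis using i by (simp add: nsq_def sum.distrib)
qed

text \<open>The kernel is polynomial in the coordinates of \<open>x\<close>; the square root in
  \<open>zeta\<close> has disappeared. This is why derivatives exist also on the real axis.\<close>

lemma zeta_kernel:
  "(w - zeta x) * (w - cnj (zeta x)) = w\<^sup>2 - of_real (2 * c 0 x) * w + of_real (nsq x)"
proof -
  have "(w - zeta x) * (w - cnj (zeta x)) = w\<^sup>2 - (zeta x + cnj (zeta x)) * w + zeta x * cnj (zeta x)"
    by (simp add: algebra_simps power2_eq_square)
  also have "zeta x + cnj (zeta x) = of_real (2 * c 0 x)"
    by (simp add: complex_add_cnj zeta_def)
  also have "zeta x * cnj (zeta x) = of_real (nsq x)"
    by (simp only: cmod_zeta[symmetric] complex_norm_square)
  finally show ?thesis .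
qed

lemma zeta_line_open:
  assumes "open D"
  shows "zeta x \<in> D \<Longrightarrow> \<forall>\<^sub>F t in nhds 0. zeta (x + t *\<^sub>R y) \<in> D"
proof -
  assume x: "zeta x \<in> D"
  have "continuous_on UNIV (\<lambda>t. zeta (x + t *\<^sub>R y))"
    by (rule continuous_on_compose2[OF continuous_on_zeta[of UNIV]]) (auto intro!: continuous_intros)
  then have "open ((\<lambda>t. zeta (x + t *\<^sub>R y)) -` D)"
    using assms continuous_on_open_vimage[of UNIV] by auto
  then have "\<forall>\<^sub>F t in nhds 0. t \<in> (\<lambda>t. zeta (x + t *\<^sub>R y)) -` D"
    by (rule eventually_nhds_in_open) (use x in simp)
  then show ?thesis by simp
qed

end

section \<open>Coordinate derivatives of pair residues\<close>

context coord_frame begin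

text \<open>Differentiation under the contour integral: the derivative of the kernel along
  \<open>v i\<close> is \<open>2 * c i x\<close>, minus \<open>2 * w\<close> if
  \<open>i = 0\<close>, and the power rule raises the exponent.\<close>

lemma has_vector_derivative_pair_residue_zeta:
  assumes "open D" "\<forall>z\<in>D. cnj z \<in> D" "G holomorphic_on D" "zeta x \<in> D" "i \<le> m"
  shows "((\<lambda>t. pair_residue q G (zeta (x + t *\<^sub>R v i))) has_vector_derivative
    of_nat (2 * q) * ((if i = 0 then pair_residue (Suc q) (\<lambda>w. w * G w) (zeta x) else 0)
      - of_real (c i x) * pair_residue (Suc q) G (zeta x))) (at 0)"
proof -
  obtain R where R: "conj_radius D (zeta x) R" using conj_radius_exists[OF assms(1,2,4)] .
  have zx: "zeta x \<in> ball (zeta x) R" using conj_radius_gt_0[OF R] by simp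
  \<comment> \<open>For steps shorter than \<open>e\<close> the moving pole stays in the disc around
    \<open>zeta x\<close>, so the same circles serve.\<close>
  obtain e where e: "e > 0" "\<And>t. t \<in> ball 0 e \<Longrightarrow> zeta (x + t *\<^sub>R v i) \<in> ball (zeta x) R"
    using zeta_line_open[OF open_ball zx, of "v i"] by (auto simp: eventually_nhds_metric dist_commute)
  define \<delta> :: complex where "\<delta> = (if i = 0 then 1 else 0)"
  \<comment> \<open>\<open>P s w\<close> is the kernel at \<open>x + s *\<^sub>R v i\<close>. The
    parameter \<open>s\<close> is complex so that the rules for complex derivatives apply before it
    is restricted to the reals.\<close>
  define P where "P = (\<lambda>s w. w\<^sup>2 - of_real (2 * c 0 x) * w + of_real (nsq x)
      + 2 * s * (of_real (c i x) - \<delta> * w) + s\<^sup>2)"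
  have P: "(w - zeta (x + t *\<^sub>R v i)) * (w - cnj (zeta (x + t *\<^sub>R v i))) = P (of_real t) w" for t w
    unfolding zeta_kernel P_def using assms(5)
    by (cases "i = 0") (simp_all add: nsq_line c_line \<delta>_def algebra_simps)
  have P0: "P (of_real t) w \<noteq> 0"
    if "t \<in> ball 0 e" "w \<in> sphere p R" "p \<in> {zeta x, cnj (zeta x)}" for t w p
    using conj_radius_poles(1)[OF R e(2)[OF that(1)] that(3)] that(2) P[of w t, symmetric] by auto
  define g' where "g' = (\<lambda>t w. - of_nat q * G w * (2 * (of_real (c i x) + of_real t - \<delta> * w))
      / P (of_real t) w ^ Suc q)"
  have cP: "continuous_on S (\<lambda>y. P (of_real (f y)) (h y))"
    if "continuous_on S f" "continuous_on S h" for S :: "'b::topological_space set" and f h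
    unfolding P_def by (intro continuous_intros that)
  have deriv: "((\<lambda>t. contour_integral (circlepath p R) (\<lambda>w. G w / P (of_real t) w ^ q))
      has_vector_derivative contour_integral (circlepath p R) (g' 0)) (at 0)"
    if p: "p \<in> {zeta x, cnj (zeta x)}" for p
  proof (rule has_vector_derivative_contour_integral_circlepath[where U = "ball 0 e"])
    have sub: "sphere p R \<subseteq> D" using R p by (auto simp: conj_radius_def)
    have cG: "continuous_on (sphere p R) G"
      using holomorphic_on_imp_continuous_on[OF assms(3)] sub continuous_on_subset by blast
    have cG2: "continuous_on (ball 0 e \<times> sphere p R) (\<lambda>y. G (snd y))"
      by (rule continuous_on_compose2[OF cG]) (auto intro!: continuous_intros)
    show "0 \<le> R" using conj_radius_gt_0[OF R] by simp
    show "continuous_on (sphere p R) (\<lambda>w. G w / P (of_real t) w ^ q)" if "t \<in> ball 0 e" for t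
      by (intro continuous_intros cG cP) (use P0[OF that _ p] in auto)
    show "continuous_on (ball 0 e \<times> sphere p R) (\<lambda>(t, w). g' t w)"
      unfolding g'_def split_def by (intro continuous_intros cG2 cP) (use P0[OF _ _ p] in auto)
    fix t w assume t: "t \<in> ball (0::real) e" and w: "w \<in> sphere p R"
    have dP: "((\<lambda>s. P s w) has_field_derivative 2 * (of_real (c i x) + s - \<delta> * w)) (at s)" for s
      unfolding P_def by (auto intro!: derivative_eq_intros simp: algebra_simps)
    have "((\<lambda>s. G w / P s w ^ q) has_field_derivative g' t w) (at (of_real t))"
    proof -
      have "((\<lambda>s. G w / P s w ^ q) has_field_derivative
          (0 * P (of_real t) w ^ q - G w * (of_nat q * (2 * (of_real (c i x) + of_real t - \<delta> * w)
            * P (of_real t) w ^ (q - Suc 0)))) / (P (of_real t) w ^ q * P (of_real t) w ^ q))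
          (at (of_real t))"
        using P0[OF t w p] by (intro DERIV_divide DERIV_const DERIV_power[OF dP]) auto
      moreover have "(0 * y ^ q - A * (of_nat q * (B * y ^ (q - Suc 0)))) / (y ^ q * y ^ q)
          = - of_nat q * A * B / y ^ Suc q" if "y \<noteq> 0" for A B y :: complex
        using that by (cases q) (auto simp: field_simps)
      ultimately show ?thesis using P0[OF t w p] by (simp add: g'_def)
    qed
    then show "((\<lambda>t. G w / P (of_real t) w ^ q) has_vector_derivative g' t w) (at t)"
      using has_vector_derivative_real_field by blast
  qed (use e in auto)
  have "((\<lambda>t. (\<Sum>p\<in>{zeta x, cnj (zeta x)}. contour_integral (circlepath p R)
          (\<lambda>w. G w / P (of_real t) w ^ q)) / (2 * pi * \<i>)) has_vector_derivative
        (\<Sum>p\<in>{zeta x, cnj (zeta x)}. contour_integral (circlepath p R) (g' 0)) / (2 * pi * \<i>)) (at 0)"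
    by (intro has_vector_derivative_divide has_vector_derivative_sum deriv)
  moreover have "(\<Sum>p\<in>{zeta x, cnj (zeta x)}. contour_integral (circlepath p R) (g' 0)) / (2 * pi * \<i>)
      = of_nat (2 * q) * ((if i = 0 then pair_residue (Suc q) (\<lambda>w. w * G w) (zeta x) else 0)
      - of_real (c i x) * pair_residue (Suc q) G (zeta x))"
  proof -
    have wG: "(\<lambda>w. w * G w) holomorphic_on D" by (intro holomorphic_intros assms(3))
    let ?L = "\<lambda>w. of_nat (2 * q) * \<delta> * (w * G w) + (- of_nat (2 * q) * of_real (c i x)) * G w"
    have L: "?L holomorphic_on D" by (intro holomorphic_intros assms(3))
    have "g' 0 = (\<lambda>w. ?L w / ((w - zeta x) * (w - cnj (zeta x))) ^ Suc q)"
      using P[of _ 0] by (auto simp: g'_def algebra_simps)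
    then show ?thesis
      using pair_residue_contour'[OF assms(1) L R zx, of "Suc q"]
        pair_residue_linear[OF assms(1,2,4) wG assms(3), of "Suc q" "of_nat (2 * q) * \<delta>"
          "- of_nat (2 * q) * of_real (c i x)"]
      by (simp add: \<delta>_def right_diff_distrib)
  qed
  ultimately have D: "((\<lambda>t. (\<Sum>p\<in>{zeta x, cnj (zeta x)}. contour_integral (circlepath p R)
          (\<lambda>w. G w / P (of_real t) w ^ q)) / (2 * pi * \<i>)) has_vector_derivative
      of_nat (2 * q) * ((if i = 0 then pair_residue (Suc q) (\<lambda>w. w * G w) (zeta x) else 0)
      - of_real (c i x) * pair_residue (Suc q) G (zeta x))) (at 0)"
    by simp
  show ?thesis
  proof (rule has_vector_derivative_transform_within_open[OF D, of "ball 0 e"])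
    fix t assume "t \<in> ball (0::real) e"
    from pair_residue_contour'[OF assms(1,3) R e(2)[OF this], of q]
    show "(\<Sum>p\<in>{zeta x, cnj (zeta x)}. contour_integral (circlepath p R)
          (\<lambda>w. G w / P (of_real t) w ^ q)) / (2 * pi * \<i>) = pair_residue q G (zeta (x + t *\<^sub>R v i))"
      by (simp add: P)
  qed (use e in auto)
qed

end

text \<open>Two simple poles. For a component of a stem function the quotient is
  \<open>Im (G z) / Im z\<close>, a coordinate of the spherical derivative.\<close>

lemma pair_residue_1_nonreal:
  assumes "open D" "\<forall>z\<in>D. cnj z \<in> D" "z \<in> D" "G holomorphic_on D" "Im z \<noteq> 0"
  shows "pair_residue 1 G z = (G z - G (cnj z)) / (2 * \<i> * of_real (Im z))"
proof -
  have ne: "z \<noteq> cnj z" using assms(5) by (auto simp: complex_eq_iff)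
  have r: "residue (\<lambda>w. G w / ((w - p) * (w - p'))) p = G p / (p - p')"
    if "p \<noteq> p'" "p \<in> D" for p p'
  proof -
    have "(\<lambda>w. G w / (w - p')) holomorphic_on D - {p'}"
      by (intro holomorphic_intros holomorphic_on_subset[OF assms(4)]) auto
    from residue_simple[OF _ _ this, of p] show ?thesis
      using that assms(1) by (simp add: mult.commute open_delete)
  qed
  have "cnj z - z = - (2 * \<i> * of_real (Im z))" "z - cnj z = 2 * \<i> * of_real (Im z)"
    by (auto simp: complex_eq_iff)
  moreover have "pair_residue 1 G z = G z / (z - cnj z) + G (cnj z) / (cnj z - z)"
    using r[of z "cnj z"] r[of "cnj z" z] ne assms(2,3) by (simp add: pair_residue_def mult.commute)
  ultimately show ?thesis using assms(5) by (simp add: diff_divide_distrib)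
qed

lemma has_vector_derivative_line_shift:
  fixes x w :: "'a::real_vector"
  assumes "((\<lambda>s. u (x + t *\<^sub>R w + s *\<^sub>R w)) has_vector_derivative d) (at 0)"
  shows "((\<lambda>s. u (x + s *\<^sub>R w)) has_vector_derivative d) (at t)"
proof -
  have "((\<lambda>s. s - t) has_vector_derivative 1) (at t)"
    by (auto intro!: derivative_eq_intros simp: has_real_derivative_iff_has_vector_derivative[symmetric])
  from vector_diff_chain_at[OF this, of "\<lambda>s. u (x + t *\<^sub>R w + s *\<^sub>R w)" d] assms
  have "((\<lambda>s. u (x + t *\<^sub>R w + (s - t) *\<^sub>R w)) has_vector_derivative d) (at t)"
    by (simp add: comp_def)
  moreover have "x + t *\<^sub>R w + (s - t) *\<^sub>R w = x + s *\<^sub>R w" for s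
    by (simp add: scaleR_left_diff_distrib)
  ultimately show ?thesis by simp
qed

section \<open>Axially symmetric harmonic functions\<close>

context coord_frame begin

text \<open>\<open>G\<close> gives a numerator for each basis vector. Real parts are taken because
  the numerators from the Almansi expansion are not known to satisfy
  \<open>G (cnj w) = cnj (G w)\<close>.\<close>

definition axial :: "nat \<Rightarrow> ('a \<Rightarrow> complex \<Rightarrow> complex) \<Rightarrow> 'a \<Rightarrow> 'a" where
  "axial q G x = (\<Sum>b\<in>Basis. Re (pair_residue q (G b) (zeta x)) *\<^sub>R b)"

text \<open>Each derivative raises the exponent; only direction \<open>0\<close> contributes a
  factor \<open>w\<close>, since \<open>c 0 x\<close> is the one coordinate that multiplies
  \<open>w\<close> in the kernel.\<close>

definition axial_deriv :: "nat \<Rightarrow> ('a \<Rightarrow> complex \<Rightarrow> complex) \<Rightarrow> nat \<Rightarrow> 'a \<Rightarrow> 'a" where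
  "axial_deriv q G i x = of_nat (2 * q) *\<^sub>R
     ((if i = 0 then axial (Suc q) (\<lambda>b w. w * G b w) x else 0) - c i x *\<^sub>R axial (Suc q) G x)"

definition axial_deriv2 :: "nat \<Rightarrow> ('a \<Rightarrow> complex \<Rightarrow> complex) \<Rightarrow> nat \<Rightarrow> nat \<Rightarrow> 'a \<Rightarrow> 'a" where
  "axial_deriv2 q G i j x = of_nat (2 * q) *\<^sub>R
     ((if i = 0 then axial_deriv (Suc q) (\<lambda>b w. w * G b w) j x else 0)
       - (c i x *\<^sub>R axial_deriv (Suc q) G j x + (if i = j then 1 else 0) *\<^sub>R axial (Suc q) G x))"

context
  fixes D :: "complex set"
  assumes D: "open D" "\<forall>z\<in>D. cnj z \<in> D"
begin

lemma has_vector_derivative_axial: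
  assumes "\<And>b. b \<in> Basis \<Longrightarrow> G b holomorphic_on D" "zeta x \<in> D" "i \<le> m"
  shows "((\<lambda>t. axial q G (x + t *\<^sub>R v i)) has_vector_derivative axial_deriv q G i x) (at 0)"
proof -
  let ?d = "\<lambda>b. of_nat (2 * q) * ((if i = 0 then pair_residue (Suc q) (\<lambda>w. w * G b w) (zeta x) else 0)
      - of_real (c i x) * pair_residue (Suc q) (G b) (zeta x))"
  have 1: "((\<lambda>t. axial q G (x + t *\<^sub>R v i)) has_vector_derivative (\<Sum>b\<in>Basis. Re (?d b) *\<^sub>R b)) (at 0)"
    unfolding axial_def
    by (intro has_vector_derivative_sum bounded_linear.has_vector_derivative[OF bounded_linear_scaleR_left]
        bounded_linear.has_vector_derivative[OF bounded_linear_Re]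
        has_vector_derivative_pair_residue_zeta[OF D] assms)
  have "Re (?d b) *\<^sub>R b = of_nat (2 * q) *\<^sub>R
     ((if i = 0 then Re (pair_residue (Suc q) (\<lambda>w. w * G b w) (zeta x)) *\<^sub>R b else 0)
       - c i x *\<^sub>R (Re (pair_residue (Suc q) (G b) (zeta x)) *\<^sub>R b))" for b
    by (simp add: algebra_simps)
  then have "(\<Sum>b\<in>Basis. Re (?d b) *\<^sub>R b) = axial_deriv q G i x"
    unfolding axial_deriv_def axial_def
    by (cases "i = 0")
       (simp_all add: sum_subtractf sum_negf scaleR_sum_right scaleR_right_diff_distrib)
  with 1 show ?thesis by simp
qed

lemma has_vector_derivative_axial_deriv:
  assumes "\<And>b. b \<in> Basis \<Longrightarrow> G b holomorphic_on D" "zeta x \<in> D" "i \<le> m" "j \<le> m"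
  shows "((\<lambda>t. axial_deriv q G i (x + t *\<^sub>R v j)) has_vector_derivative axial_deriv2 q G i j x) (at 0)"
proof -
  have c: "((\<lambda>t. c i (x + t *\<^sub>R v j)) has_field_derivative (if i = j then 1 else 0)) (at 0)"
    unfolding c_line[OF assms(3,4)] by (auto intro!: derivative_eq_intros)
  have h: "(\<lambda>w. w * G b w) holomorphic_on D" if "b \<in> Basis" for b
    using assms(1)[OF that] by (intro holomorphic_intros)
  have 1: "((\<lambda>t. if i = 0 then axial (Suc q) (\<lambda>b w. w * G b w) (x + t *\<^sub>R v j) else 0)
      has_vector_derivative (if i = 0 then axial_deriv (Suc q) (\<lambda>b w. w * G b w) j x else 0)) (at 0)"
    using has_vector_derivative_axial[of "\<lambda>b w. w * G b w", OF h assms(2,4)]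
    by auto
  have 2: "((\<lambda>t. c i (x + t *\<^sub>R v j) *\<^sub>R axial (Suc q) G (x + t *\<^sub>R v j)) has_vector_derivative
      (c i x *\<^sub>R axial_deriv (Suc q) G j x + (if i = j then 1 else 0) *\<^sub>R axial (Suc q) G x)) (at 0)"
    using has_vector_derivative_scaleR[OF c has_vector_derivative_axial[where q = "Suc q", OF assms(1,2,4)]]
    by simp
  show ?thesis
    unfolding axial_deriv_def axial_deriv2_def
    using 1 2 by (intro bounded_linear.has_vector_derivative[OF bounded_linear_scaleR_right]
        has_vector_derivative_diff) (auto simp: axial_deriv_def)
qed

lemma continuous_on_axial:
  assumes "\<And>b. b \<in> Basis \<Longrightarrow> G b holomorphic_on D" "\<forall>x\<in>\<Omega>. zeta x \<in> D"
  shows "continuous_on \<Omega> (axial q G)"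
  unfolding axial_def
  by (intro continuous_intros continuous_on_compose2[OF continuous_on_pair_residue[OF D] continuous_on_zeta] assms(1))
     (use assms(2) in auto)

lemma continuous_on_axial_deriv:
  assumes "\<And>b. b \<in> Basis \<Longrightarrow> G b holomorphic_on D" "\<forall>x\<in>\<Omega>. zeta x \<in> D"
  shows "continuous_on \<Omega> (axial_deriv q G i)"
proof -
  have h: "(\<lambda>w. w * G b w) holomorphic_on D" if "b \<in> Basis" for b
    using assms(1)[OF that] by (intro holomorphic_intros)
  have "continuous_on \<Omega> (\<lambda>x. if i = 0 then axial (Suc q) (\<lambda>b w. w * G b w) x else 0)"
    using continuous_on_axial[of "\<lambda>b w. w * G b w", OF h assms(2)] by (cases "i = 0") simp_all
  then show ?thesis
    unfolding axial_deriv_def by (intro continuous_intros continuous_on_axial assms)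
qed

lemma continuous_on_axial_deriv2:
  assumes "\<And>b. b \<in> Basis \<Longrightarrow> G b holomorphic_on D" "\<forall>x\<in>\<Omega>. zeta x \<in> D"
  shows "continuous_on \<Omega> (axial_deriv2 q G i j)"
proof -
  have h: "(\<lambda>w. w * G b w) holomorphic_on D" if "b \<in> Basis" for b
    using assms(1)[OF that] by (intro holomorphic_intros)
  have "continuous_on \<Omega> (\<lambda>x. if i = 0 then axial_deriv (Suc q) (\<lambda>b w. w * G b w) j x else 0)"
    using continuous_on_axial_deriv[of "\<lambda>b w. w * G b w", OF h assms(2)] by (cases "i = 0") simp_all
  then show ?thesis
    unfolding axial_deriv2_def by (intro continuous_intros continuous_on_axial continuous_on_axial_deriv assms)
qed

text \<open>This is \<open>pair_residue_shift\<close> with the kernel written out in coordinates. It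
  expresses exponent \<open>q\<close> through exponent \<open>Suc q\<close>, in the combination that
  the Laplacian produces.\<close>

lemma axial_shift:
  assumes "\<And>b. b \<in> Basis \<Longrightarrow> G b holomorphic_on D" "zeta x \<in> D"
  shows "axial q G x = axial (Suc q) (\<lambda>b w. w * (w * G b w)) x
      - (2 * c 0 x) *\<^sub>R axial (Suc q) (\<lambda>b w. w * G b w) x + nsq x *\<^sub>R axial (Suc q) G x"
proof -
  have "Re (pair_residue q (G b) (zeta x)) = Re (pair_residue (Suc q) (\<lambda>w. w * (w * G b w)) (zeta x))
      - (2 * c 0 x) * Re (pair_residue (Suc q) (\<lambda>w. w * G b w) (zeta x))
      + nsq x * Re (pair_residue (Suc q) (G b) (zeta x))" if b: "b \<in> Basis" for b
  proof -
    note lin = pair_residue_linear[OF D assms(2), where q = "Suc q"]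
    have h: "G b holomorphic_on D" "(\<lambda>w. w * G b w) holomorphic_on D"
      "(\<lambda>w. w * (w * G b w)) holomorphic_on D"
      using assms(1)[OF b] by (auto intro!: holomorphic_intros)
    then have h4: "(\<lambda>w. of_real (- (2 * c 0 x)) * (w * G b w) + of_real (nsq x) * G b w) holomorphic_on D"
      by (intro holomorphic_intros)
    have "(\<lambda>w. G b w * ((w - zeta x) * (w - cnj (zeta x)))) = (\<lambda>w. 1 * (w * (w * G b w)) +
        1 * (of_real (- (2 * c 0 x)) * (w * G b w) + of_real (nsq x) * G b w))"
      unfolding zeta_kernel by (auto simp: algebra_simps power2_eq_square)
    then have "pair_residue q (G b) (zeta x) = pair_residue (Suc q) (\<lambda>w. w * (w * G b w)) (zeta x)
      + (of_real (- (2 * c 0 x)) * pair_residue (Suc q) (\<lambda>w. w * G b w) (zeta x)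
      + of_real (nsq x) * pair_residue (Suc q) (G b) (zeta x))"
      unfolding pair_residue_shift[of q "G b"]
      using lin[OF h(3) h4, where c = 1 and d = 1]
        lin[OF h(2,1), where c = "of_real (- (2 * c 0 x))" and d = "of_real (nsq x)"] by simp
    then show ?thesis by simp
  qed
  then have "axial q G x = (\<Sum>b\<in>Basis. (Re (pair_residue (Suc q) (\<lambda>w. w * (w * G b w)) (zeta x))
      - (2 * c 0 x) * Re (pair_residue (Suc q) (\<lambda>w. w * G b w) (zeta x))
      + nsq x * Re (pair_residue (Suc q) (G b) (zeta x))) *\<^sub>R b)"
    unfolding axial_def by (intro sum.cong) auto
  then show ?thesis
    by (simp add: axial_def scaleR_left_diff_distrib scaleR_left_distrib sum.distrib sum_subtractf
        scaleR_sum_right)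
qed

text \<open>The kernel to the power \<open>- q\<close> is the Newton kernel of dimension
  \<open>m + 1\<close>: its exponent is half the dimension minus one, which is
  \<open>q\<close>.\<close>

lemma harmonic_on_axial:
  assumes G: "\<And>b. b \<in> Basis \<Longrightarrow> G b holomorphic_on D" and \<Omega>: "\<forall>x\<in>\<Omega>. zeta x \<in> D"
    and lo: "line_open m v \<Omega>" and m: "m = 2 * q + 1"
  shows "harmonic_on m v \<Omega> (axial q G)"
proof -
  have z: "zeta x \<in> D" if "x \<in> \<Omega>" for x using \<Omega> that by blast
  note I = Ck_on_2I[where ?f1.0 = "axial_deriv q G" and ?f2.0 = "axial_deriv2 q G", OF lo continuous_on_axial[OF G \<Omega>]
      has_vector_derivative_axial[OF G z] continuous_on_axial_deriv[OF G \<Omega>]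
      has_vector_derivative_axial_deriv[OF G z] continuous_on_axial_deriv2[OF G \<Omega>]]
  have "(\<Sum>i\<le>m. axial_deriv2 q G i i x) = 0" if x: "x \<in> \<Omega>" for x
  proof -
    let ?K = "axial (Suc (Suc q))" and ?q = "of_nat (2 * Suc q) :: real"
    let ?A = "?K (\<lambda>b w. w * (w * G b w)) x" and ?B = "?K (\<lambda>b w. w * G b w) x" and ?C = "?K G x"
    have 1: "(\<Sum>i\<le>m. if i = 0 then axial_deriv (Suc q) (\<lambda>b w. w * G b w) i x else 0) = ?q *\<^sub>R (?A - c 0 x *\<^sub>R ?B)"
      by (simp add: axial_deriv_def)
    have "(\<Sum>i\<le>m. c i x *\<^sub>R axial_deriv (Suc q) G i x)
        = (\<Sum>i\<le>m. (if i = 0 then (?q * c 0 x) *\<^sub>R ?B else 0) - (?q * (c i x)\<^sup>2) *\<^sub>R ?C)"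
      by (intro sum.cong) (auto simp: axial_deriv_def scaleR_right_diff_distrib power2_eq_square mult_ac)
    also have "\<dots> = ?q *\<^sub>R (c 0 x *\<^sub>R ?B - nsq x *\<^sub>R ?C)"
      by (simp add: sum_subtractf scaleR_right_diff_distrib nsq_def sum_distrib_left
          scaleR_sum_left[symmetric] del: of_nat_Suc)
    finally have 2: "(\<Sum>i\<le>m. c i x *\<^sub>R axial_deriv (Suc q) G i x) = ?q *\<^sub>R (c 0 x *\<^sub>R ?B - nsq x *\<^sub>R ?C)" .
    \<comment> \<open>Each of the \<open>m + 1 = 2 * Suc q\<close> directions contributes one copy.
      That their number equals the factor \<open>?q\<close> lets everything cancel by
      \<open>axial_shift\<close>.\<close>
    have 3: "(\<Sum>i\<le>m. (if i = i then 1 else 0) *\<^sub>R axial (Suc q) G x) = ?q *\<^sub>R axial (Suc q) G x"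
      using m by (simp add: sum_constant_scaleR del: sum_constant)
    have "(\<Sum>i\<le>m. axial_deriv2 q G i i x) = of_nat (2 * q) *\<^sub>R (?q *\<^sub>R (?A - c 0 x *\<^sub>R ?B)
        - (?q *\<^sub>R (c 0 x *\<^sub>R ?B - nsq x *\<^sub>R ?C) + ?q *\<^sub>R axial (Suc q) G x))"
      unfolding axial_deriv2_def scaleR_sum_right[symmetric] sum_subtractf sum.distrib 1 2 3 ..
    also have "?q *\<^sub>R (?A - c 0 x *\<^sub>R ?B) - (?q *\<^sub>R (c 0 x *\<^sub>R ?B - nsq x *\<^sub>R ?C) + ?q *\<^sub>R axial (Suc q) G x)
        = ?q *\<^sub>R (?A - (2 * c 0 x) *\<^sub>R ?B + nsq x *\<^sub>R ?C - axial (Suc q) G x)"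
      unfolding scaleR_right_distrib[symmetric] scaleR_right_diff_distrib[symmetric] mult_2 scaleR_left_distrib
      by (intro arg_cong[where f = "\<lambda>y. _ *\<^sub>R y"]) (simp add: scaleR_right_distrib)
    also have "\<dots> = 0" by (simp add: axial_shift[where q = "Suc q", OF G z[OF x]])
    finally show ?thesis by simp
  qed
  then show ?thesis unfolding harmonic_on_def using I by simp
qed

end

text \<open>Maximum principle: adding \<open>\<epsilon> * nsq\<close> to a coordinate of
  \<open>u\<close> makes the Laplacian positive, which excludes interior maxima; the boundary value
  \<open>\<epsilon> * r\<close> then tends to \<open>0\<close>.\<close>

lemma harmonic_zero_inside:
  fixes u :: "'a \<Rightarrow> 'a"
  assumes u: "harmonic_on m v \<Omega> u"
    and B: "{x \<in> span (v ` {..m}). nsq x \<le> r} \<subseteq> \<Omega>"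
    and sphere: "\<And>x. x \<in> span (v ` {..m}) \<Longrightarrow> nsq x = r \<Longrightarrow> u x = 0"
    and rep: "\<And>x. x \<in> span (v ` {..m}) \<Longrightarrow> x = (\<Sum>i\<le>m. c i x *\<^sub>R v i)"
    and x: "x \<in> span (v ` {..m})" "nsq x \<le> r"
  shows "u x = 0"
proof -
  let ?M = "span (v ` {..m})"
  let ?B = "{x \<in> ?M. nsq x \<le> r}"
  have C: "Ck_on 2 m v \<Omega> u" using u by (simp add: harmonic_on_def)
  \<comment> \<open>The norm of the type is unrelated to \<open>nsq\<close>; the two are compared
    through the coordinates.\<close>
  have "bounded ?B"
  proof (rule boundedI)
    fix y assume y: "y \<in> ?B"
    have "\<bar>c i y\<bar> \<le> sqrt r" if "i \<le> m" for i
    proof -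
      have "(c i y)\<^sup>2 \<le> nsq y" unfolding nsq_def using that by (intro member_le_sum) auto
      then have "(c i y)\<^sup>2 \<le> r" using y by simp
      then show ?thesis using real_le_rsqrt real_sqrt_abs real_sqrt_le_iff by metis
    qed
    then have "(\<Sum>i\<le>m. norm (c i y *\<^sub>R v i)) \<le> (\<Sum>i\<le>m. sqrt r * norm (v i))"
      by (intro sum_mono) (auto intro: mult_right_mono)
    then show "norm y \<le> (\<Sum>i\<le>m. sqrt r * norm (v i))"
      using rep[of y] y norm_sum[of "\<lambda>i. c i y *\<^sub>R v i" "{..m}"] by simp
  qed
  moreover have "closed ?B"
  proof -
    have "?B = ?M \<inter> {x. nsq x \<le> r}" by auto
    moreover have "closed {x. nsq x \<le> r}"
      by (intro closed_Collect_le continuous_intros)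
    ultimately show ?thesis using closed_subspace[OF subspace_span] by auto
  qed
  ultimately have comp: "compact ?B" by (simp add: compact_eq_bounded_closed)
  have le: "u x \<bullet> b \<le> \<epsilon> * r" if \<epsilon>: "\<epsilon> > 0" for \<epsilon> b
  proof -
    define \<psi> where "\<psi> = (\<lambda>y. u y \<bullet> b + \<epsilon> * nsq y)"
    have "continuous_on ?B \<psi>"
      unfolding \<psi>_def
      by (intro continuous_intros continuous_on_subset[OF Ck_on_2D(1)[OF C, of 0] B]) auto
    then obtain y where y: "y \<in> ?B" "\<And>z. z \<in> ?B \<Longrightarrow> \<psi> z \<le> \<psi> y"
      using continuous_attains_sup[OF comp] x by blast
    have "nsq y = r"
    proof (rule ccontr)
      assume "nsq y \<noteq> r"
      then have less: "nsq y < r" using y by simp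
      have ev: "\<forall>\<^sub>F t in nhds 0. y + t *\<^sub>R v i \<in> ?B" if i: "i \<le> m" for i
      proof -
        have "((\<lambda>t. nsq y + 2 * t * c i y + t\<^sup>2) \<longlongrightarrow> nsq y + 2 * 0 * c i y + 0\<^sup>2) (nhds 0)"
          by (intro tendsto_intros filterlim_ident)
        then have "\<forall>\<^sub>F t in nhds 0. nsq y + 2 * t * c i y + t\<^sup>2 < r"
          by (rule order_tendstoD(2)) (use less in simp)
        then have "\<forall>\<^sub>F t in nhds 0. nsq (y + t *\<^sub>R v i) \<le> r"
          by eventually_elim (simp add: nsq_line[OF i])
        moreover have "y + t *\<^sub>R v i \<in> ?M" for t
          using y i by (intro span_add span_scale) (auto intro: span_base)
        ultimately show ?thesis by simp
      qed
      have "partial_deriv v i (partial_deriv v i u) y \<bullet> b + 2 * \<epsilon> \<le> 0" if i: "i \<le> m" for i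
      proof (rule second_derivative_local_max)
        show "\<forall>\<^sub>F t in nhds 0. ((\<lambda>t. \<psi> (y + t *\<^sub>R v i)) has_real_derivative
            partial_deriv v i u (y + t *\<^sub>R v i) \<bullet> b + \<epsilon> * (2 * c i y + 2 * t)) (at t)"
          using ev[OF i]
        proof eventually_elim
          case (elim t)
          have "((\<lambda>s. u (y + s *\<^sub>R v i)) has_vector_derivative partial_deriv v i u (y + t *\<^sub>R v i)) (at t)"
            by (rule has_vector_derivative_line_shift) (use Ck_on_2D(2)[OF C i] elim B in blast)
          from bounded_linear.has_vector_derivative[OF bounded_linear_inner_left this, of b]
          have "((\<lambda>s. u (y + s *\<^sub>R v i) \<bullet> b) has_real_derivative
              partial_deriv v i u (y + t *\<^sub>R v i) \<bullet> b) (at t)"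
            by (simp add: has_real_derivative_iff_has_vector_derivative)
          then show ?case
            unfolding \<psi>_def nsq_line[OF i]
            by (auto intro!: derivative_eq_intros simp: algebra_simps)
        qed
        have "y \<in> \<Omega>" using y B by blast
        from bounded_linear.has_vector_derivative[OF bounded_linear_inner_left Ck_on_2D(4)[OF C i i this], of b]
        have "((\<lambda>s. partial_deriv v i u (y + s *\<^sub>R v i) \<bullet> b) has_real_derivative
            partial_deriv v i (partial_deriv v i u) y \<bullet> b) (at 0)"
          by (simp add: has_real_derivative_iff_has_vector_derivative)
        then show "((\<lambda>t. partial_deriv v i u (y + t *\<^sub>R v i) \<bullet> b + \<epsilon> * (2 * c i y + 2 * t))
            has_real_derivative partial_deriv v i (partial_deriv v i u) y \<bullet> b + 2 * \<epsilon>) (at 0)"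
          by (auto intro!: derivative_eq_intros)
        show "\<forall>\<^sub>F t in nhds 0. \<psi> (y + t *\<^sub>R v i) \<le> \<psi> (y + 0 *\<^sub>R v i)"
          using ev[OF i] by eventually_elim (use y(2) in simp)
      qed
      \<comment> \<open>Summed over all directions the Laplacian of \<open>u\<close> drops out, and
        only the positive contribution of \<open>\<epsilon> * nsq\<close> remains.\<close>
      then have "(\<Sum>i\<le>m. partial_deriv v i (partial_deriv v i u) y \<bullet> b + 2 * \<epsilon>) \<le> 0"
        by (intro sum_nonpos) auto
      moreover have "(\<Sum>i\<le>m. partial_deriv v i (partial_deriv v i u) y \<bullet> b) = 0"
        using u y B unfolding harmonic_on_def laplacian_def inner_sum_left[symmetric] by auto
      ultimately have "(1 + real m) * (2 * \<epsilon>) \<le> 0" by (simp add: sum.distrib)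
      moreover have "(1 + real m) * (2 * \<epsilon>) > 0" using \<epsilon> by simp
      ultimately show False by linarith
    qed
    then have "\<psi> y = \<epsilon> * r" using sphere[of y] y by (simp add: \<psi>_def)
    moreover have "\<psi> x \<le> \<psi> y" using y(2) x by simp
    moreover have "0 \<le> \<epsilon> * nsq x" using \<epsilon> by (simp add: nsq_def sum_nonneg)
    ultimately show ?thesis by (simp add: \<psi>_def)
  qed
  have np: "u x \<bullet> b \<le> 0" for b
  proof (rule tendsto_lowerbound)
    show "((\<lambda>\<epsilon>. \<epsilon> * r) \<longlongrightarrow> 0) (at_right 0)"
      by (auto intro!: tendsto_eq_intros)
    show "\<forall>\<^sub>F \<epsilon> in at_right 0. u x \<bullet> b \<le> \<epsilon> * r"
      using eventually_at_right_less[of "0::real"] by eventually_elim (rule le)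
  qed simp
  \<comment> \<open>In \<open>np\<close> the vector \<open>b\<close> is arbitrary; the choice
    \<open>b = u x\<close> finishes.\<close>
  then have "u x \<bullet> u x \<le> 0" by blast
  then show ?thesis by (metis inner_eq_zero_iff inner_ge_zero order_antisym)
qed

end

section \<open>Hypercomplex subspaces\<close>

declare unity_neq_zero [simp] unity_neq_zero[symmetric, simp]

lemma linear_mult_left: "linear (\<lambda>x::'a::alternative_star_algebra. x * y)"
  by (rule linearI) (simp_all add: mult_add_left mult_scale_left)

lemma linear_mult_right: "linear (\<lambda>y::'a::alternative_star_algebra. x * y)"
  by (rule linearI) (simp_all add: mult_add_right mult_scale_right)

lemma linear_star_conj: "linear (star_conj :: 'a::alternative_star_algebra \<Rightarrow> 'a)"
  by (rule linearI) (simp_all add: conj_add conj_scale)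

lemma bounded_bilinear_alg_mult:
  "bounded_bilinear ((*) :: 'a::alternative_star_algebra \<Rightarrow> 'a \<Rightarrow> 'a)"
  using linear_mult_left linear_mult_right
  by (auto simp: bilinear_conv_bounded_bilinear[symmetric] bilinear_def)

lemmas alg_mult_simps =
  linear_0[OF linear_mult_left] linear_0[OF linear_mult_right]
  linear_neg[OF linear_mult_left] linear_neg[OF linear_mult_right]
  linear_diff[OF linear_mult_left] linear_diff[OF linear_mult_right]
  mult_add_left mult_add_right mult_scale_left mult_scale_right unity_left unity_right

lemmas star_conj_simps =
  linear_0[OF linear_star_conj] linear_neg[OF linear_star_conj] linear_diff[OF linear_star_conj]
  conj_add conj_scale conj_conj conj_mult

lemma star_conj_one [simp]: "(1::'a::alternative_star_algebra)\<^sup>c = 1"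
  using conj_real[of 1] by simp

lemma real_of_alg_scaleR [simp]: "real_of_alg (r *\<^sub>R (1::'a::alternative_star_algebra)) = r"
  unfolding real_of_alg_def by (rule the_equality) (use unity_neq_zero in auto)

lemma left_alternative: "x * (x * y) = (x * x) * (y::'a::alternative_star_algebra)"
  using associator_left[of x y] by (simp add: associator_def)

text \<open>The rule \<open>J * (J * x) = - x\<close> comes from left alternativity and replaces
  associativity wherever an imaginary unit multiplies twice.\<close>

lemma imag_unitsD:
  assumes "J \<in> (imag_units :: 'a::alternative_star_algebra set)"
  shows "J\<^sup>c = - J" "J * J = - 1" "J \<noteq> 0" "J * (J * x) = - x" "- J \<in> imag_units"
proof -
  show c: "J\<^sup>c = - J"
    using assms by (simp add: imag_units_def alg_trace_def eq_neg_iff_add_eq_0 add.commute)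
  have "- (J * J) = 1"
    using assms by (simp add: imag_units_def alg_nsq_def c alg_mult_simps)
  then show JJ: "J * J = - 1" by (metis minus_minus)
  then show "J \<noteq> 0" by (auto simp: alg_mult_simps)
  show "J * (J * x) = - x" by (simp add: left_alternative JJ alg_mult_simps)
  show "- J \<in> imag_units"
    by (simp add: imag_units_def alg_trace_def alg_nsq_def c JJ alg_mult_simps star_conj_simps)
qed

lemma quadratic_coneE:
  assumes "x \<in> (quadratic_cone :: 'a::alternative_star_algebra set)"
  obtains \<alpha> \<beta> J where "J \<in> imag_units" "x = \<alpha> *\<^sub>R 1 + \<beta> *\<^sub>R J"
proof -
  obtain J where J: "J \<in> imag_units" "x \<in> span {1, J}"
    using assms by (auto simp: quadratic_cone_def)
  then obtain k where "x - k *\<^sub>R 1 \<in> span {J}" by (auto simp: span_breakdown_eq)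
  then obtain l where "x - k *\<^sub>R 1 = l *\<^sub>R J" by (auto simp: span_singleton)
  then have "x = k *\<^sub>R 1 + l *\<^sub>R J" by (simp add: algebra_simps)
  then show ?thesis using J that by blast
qed

lemma slice_point:
  assumes "J \<in> (imag_units :: 'a::alternative_star_algebra set)" "x = \<alpha> *\<^sub>R 1 + \<beta> *\<^sub>R J"
  shows "x\<^sup>c = \<alpha> *\<^sub>R 1 - \<beta> *\<^sub>R J" "x + x\<^sup>c = (2 * \<alpha>) *\<^sub>R 1" "x * x\<^sup>c = (\<alpha>\<^sup>2 + \<beta>\<^sup>2) *\<^sub>R 1"
    "alg_Im x = \<beta> *\<^sub>R J"
proof -
  show c: "x\<^sup>c = \<alpha> *\<^sub>R 1 - \<beta> *\<^sub>R J"
    using assms imag_unitsD[OF assms(1)] by (simp add: star_conj_simps)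
  show "x + x\<^sup>c = (2 * \<alpha>) *\<^sub>R 1"
    unfolding c unfolding assms(2) mult_2 scaleR_left_distrib by simp
  show "x * x\<^sup>c = (\<alpha>\<^sup>2 + \<beta>\<^sup>2) *\<^sub>R 1"
    unfolding c unfolding assms(2)
    by (simp add: alg_mult_simps imag_unitsD[OF assms(1)] algebra_simps power2_eq_square)
  have "x - x\<^sup>c = (2 * \<beta>) *\<^sub>R J" unfolding c unfolding assms(2) mult_2 scaleR_left_distrib by simp
  then show "alg_Im x = \<beta> *\<^sub>R J" by (simp add: alg_Im_def)
qed

lemma slice_point_real:
  assumes "J \<in> (imag_units :: 'a::alternative_star_algebra set)" "x = \<alpha> *\<^sub>R 1 + \<beta> *\<^sub>R J"
  shows "x \<in> real_line \<longleftrightarrow> \<beta> = 0"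
proof
  assume "x \<in> real_line"
  then obtain r where "x = r *\<^sub>R 1" by (auto simp: real_line_def)
  then have "alg_Im x = 0" by (simp add: alg_Im_def conj_scale)
  then show "\<beta> = 0" using slice_point(4)[OF assms] imag_unitsD(3)[OF assms(1)] by simp
qed (use assms in \<open>auto simp: real_line_def\<close>)

lemma alg_inverse_imag:
  assumes "J \<in> (imag_units :: 'a::alternative_star_algebra set)" "\<beta> \<noteq> 0"
  shows "alg_inverse (\<beta> *\<^sub>R J) = (- 1 / \<beta>) *\<^sub>R J"
  unfolding alg_inverse_def
proof (rule the_equality)
  show "\<beta> *\<^sub>R J * ((- 1 / \<beta>) *\<^sub>R J) = 1 \<and> (- 1 / \<beta>) *\<^sub>R J * (\<beta> *\<^sub>R J) = 1"
    using assms by (simp add: alg_mult_simps imag_unitsD[OF assms(1)])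
  fix y assume "\<beta> *\<^sub>R J * y = 1 \<and> y * (\<beta> *\<^sub>R J) = 1"
  then have "\<beta> *\<^sub>R (J * y) = 1" by (simp add: alg_mult_simps)
  \<comment> \<open>A further multiplication by \<open>J\<close> recovers \<open>y\<close>, by left
    alternativity.\<close>
  then have "J * (\<beta> *\<^sub>R (J * y)) = J" by (simp add: alg_mult_simps)
  then have "\<beta> *\<^sub>R (- y) = J" by (simp add: alg_mult_simps imag_unitsD[OF assms(1)])
  then have "(- 1 / \<beta>) *\<^sub>R J = (- 1 / \<beta>) *\<^sub>R (\<beta> *\<^sub>R (- y))" by simp
  then show "y = (- 1 / \<beta>) *\<^sub>R J" using assms(2) by simp
qed

lemma spherical_quotient_slice:
  assumes J: "J \<in> (imag_units :: 'a::alternative_star_algebra set)" and x: "x = \<alpha> *\<^sub>R 1 + \<beta> *\<^sub>R J"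
    and \<beta>: "\<beta> \<noteq> 0" and f: "f x = A + J * B" "f (x\<^sup>c) = A + (- J) * B"
  shows "spherical_quotient f x = (1 / \<beta>) *\<^sub>R B"
proof -
  have "f x - f (x\<^sup>c) = 2 *\<^sub>R (J * B)" unfolding f by (simp add: alg_mult_simps scaleR_2)
  then show ?thesis
    unfolding spherical_quotient_def slice_point(4)[OF J x] alg_inverse_imag[OF J \<beta>]
    using \<beta> by (simp add: alg_mult_simps imag_unitsD[OF J])
qed

text \<open>On \<open>M\<close> this is \<open>hc_inner\<close>: there
  \<open>x * y\<^sup>c + y * x\<^sup>c\<close> is real, and the auxiliary inner product with
  \<open>1\<close> reads off its coefficient. In this form it is linear on the whole algebra,
  without a definite description.\<close>

definition hc_coord :: "'a::alternative_star_algebra \<Rightarrow> 'a \<Rightarrow> real" where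
  "hc_coord y x = ((x * y\<^sup>c + y * x\<^sup>c) \<bullet> 1) / (2 * (1 \<bullet> (1::'a)))"

lemma linear_hc_coord: "linear (hc_coord y)"
  by (rule linearI)
     (simp_all add: hc_coord_def alg_mult_simps star_conj_simps inner_add_left add_divide_distrib
       algebra_simps)

lemma hc_coord_eq: "x * y\<^sup>c + y * x\<^sup>c = r *\<^sub>R 1 \<Longrightarrow> hc_coord y x = r / 2"
  by (simp add: hc_coord_def)

section \<open>Orthonormal coordinates and slices in a hypercomplex subspace\<close>

locale hc_frame =
  fixes M :: "'a::alternative_star_algebra set" and m :: nat and v :: "nat \<Rightarrow> 'a"
  assumes hyp: "hypercomplex_subspace M" and onb: "hc_orthonormal_basis M m v"
begin

lemma M_subspace: "subspace M" and M_cone: "M \<subseteq> quadratic_cone" and real_line_M: "real_line \<subseteq> M"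
  using hyp by (auto simp: hypercomplex_subspace_def)

lemma v_0: "v 0 = 1" and v_M: "i \<le> m \<Longrightarrow> v i \<in> M" and span_v: "span (v ` {..m}) = M"
  using onb by (auto simp: hc_orthonormal_basis_def)

lemma mult_conj_real: "x \<in> M \<Longrightarrow> \<exists>r. x * x\<^sup>c = r *\<^sub>R 1"
  using M_cone slice_point(3) quadratic_coneE by (metis subsetD)

text \<open>Polarization of \<open>mult_conj_real\<close>, which holds because \<open>M\<close> lies
  in the quadratic cone.\<close>

lemma polar_real:
  assumes "x \<in> M" "y \<in> M"
  shows "\<exists>r. x * y\<^sup>c + y * x\<^sup>c = r *\<^sub>R 1"
proof -
  have "x + y \<in> M" using assms M_subspace subspace_add by blast
  then obtain a b c where "(x + y) * (x + y)\<^sup>c = a *\<^sub>R 1" "x * x\<^sup>c = b *\<^sub>R 1" "y * y\<^sup>c = c *\<^sub>R 1"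
    using mult_conj_real assms by metis
  moreover have "x * y\<^sup>c + y * x\<^sup>c = (x + y) * (x + y)\<^sup>c - x * x\<^sup>c - y * y\<^sup>c"
    by (simp add: alg_mult_simps star_conj_simps)
  ultimately have "x * y\<^sup>c + y * x\<^sup>c = (a - b - c) *\<^sub>R 1" by (simp add: algebra_simps)
  then show ?thesis by blast
qed

text \<open>Orthonormality, given through \<open>real_of_alg\<close>, becomes an identity in the
  algebra, since \<open>polar_real\<close> shows that the polar form is real.\<close>

lemma v_polar:
  assumes "i \<le> m" "j \<le> m"
  shows "v i * (v j)\<^sup>c + v j * (v i)\<^sup>c = (if i = j then 2 else 0) *\<^sub>R 1"
proof -
  obtain r where r: "v i * (v j)\<^sup>c + v j * (v i)\<^sup>c = r *\<^sub>R 1"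
    using polar_real v_M assms by blast
  have "hc_inner (v i) (v j) = r / 2"
    using r by (simp add: hc_inner_def alg_trace_def conj_mult conj_conj)
  moreover have "hc_inner (v i) (v j) = (if i = j then 1 else 0)"
    using onb assms by (auto simp: hc_orthonormal_basis_def)
  ultimately show ?thesis using r by auto
qed

sublocale coord_frame m v "\<lambda>i. hc_coord (v i)"
proof (rule coord_frame.intro)
  show "linear (hc_coord (v i))" for i by (rule linear_hc_coord)
  fix i j assume "i \<le> m" "j \<le> m"
  then show "hc_coord (v i) (v j) = (if i = j then 1 else 0)"
    using hc_coord_eq[OF v_polar[of j i]] by auto
qed

abbreviation c :: "nat \<Rightarrow> 'a \<Rightarrow> real" where "c i \<equiv> hc_coord (v i)"

lemma expansion:
  assumes "x \<in> M"
  shows "x = (\<Sum>i\<le>m. c i x *\<^sub>R v i)"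
proof -
  have "x \<in> span (v ` {..m})" using assms span_v by simp
  then show ?thesis
  proof (rule span_induct)
    show "subspace {x. x = (\<Sum>i\<le>m. c i x *\<^sub>R v i)}"
      by (auto simp: subspace_def linear_0[OF linear_c] linear_add[OF linear_c] linear_scale[OF linear_c]
          scaleR_left_distrib sum.distrib scaleR_sum_right[symmetric] simp flip: scaleR_scaleR)
    fix x assume "x \<in> v ` {..m}"
    then obtain j where j: "j \<le> m" "x = v j" by auto
    have "(\<Sum>i\<le>m. c i (v j) *\<^sub>R v i) = (\<Sum>i\<le>m. if i = j then v i else 0)"
      by (intro sum.cong) (auto simp: c_v j)
    then show "x = (\<Sum>i\<le>m. c i x *\<^sub>R v i)" using j by simp
  qed
qed

lemma conj_v: "i \<le> m \<Longrightarrow> (v i)\<^sup>c = (if i = 0 then v i else - v i)"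
  using v_polar[of i 0] v_0 by (auto simp: alg_mult_simps eq_neg_iff_add_eq_0 add.commute)

lemma conj_expansion:
  assumes "x \<in> M"
  shows "x\<^sup>c = (\<Sum>i\<le>m. c i x *\<^sub>R (v i)\<^sup>c)"
  by (subst expansion[OF assms]) (simp add: linear_sum[OF linear_star_conj] conj_scale)

text \<open>A single product \<open>v i * (v j)\<^sup>c\<close> need not be real;
  \<open>v_polar\<close> only gives the symmetrized one, so the double sum is added to its
  transpose.\<close>

lemma mult_conj_nsq:
  assumes "x \<in> M"
  shows "x * x\<^sup>c = nsq x *\<^sub>R 1"
proof -
  let ?S = "\<Sum>i\<le>m. \<Sum>j\<le>m. (c i x * c j x) *\<^sub>R (v i * (v j)\<^sup>c)"
  have 2: "?S = (\<Sum>i\<le>m. \<Sum>j\<le>m. (c i x * c j x) *\<^sub>R (v j * (v i)\<^sup>c))"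
  proof -
    have "?S = (\<Sum>j\<le>m. \<Sum>i\<le>m. (c i x * c j x) *\<^sub>R (v i * (v j)\<^sup>c))" by (rule sum.swap)
    also have "\<dots> = (\<Sum>i\<le>m. \<Sum>j\<le>m. (c i x * c j x) *\<^sub>R (v j * (v i)\<^sup>c))"
      by (intro sum.cong refl) (metis mult.commute)
    finally show ?thesis .
  qed
  have 1: "x * x\<^sup>c = ?S"
    by (subst (1) expansion[OF assms], subst conj_expansion[OF assms])
       (simp add: linear_sum[OF linear_mult_left] linear_sum[OF linear_mult_right]
         mult_scale_left mult_scale_right scaleR_sum_right 2)
  have "?S + ?S = ?S + (\<Sum>i\<le>m. \<Sum>j\<le>m. (c i x * c j x) *\<^sub>R (v j * (v i)\<^sup>c))"
    by (rule arg_cong[OF 2])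
  also have "\<dots> = (\<Sum>i\<le>m. \<Sum>j\<le>m. (c i x * c j x) *\<^sub>R (v i * (v j)\<^sup>c + v j * (v i)\<^sup>c))"
    by (simp only: sum.distrib scaleR_right_distrib)
  also have "\<dots> = (\<Sum>i\<le>m. \<Sum>j\<le>m. if j = i then (2 * (c i x)\<^sup>2) *\<^sub>R 1 else 0)"
    by (intro sum.cong) (auto simp: v_polar power2_eq_square)
  also have "\<dots> = (2 * nsq x) *\<^sub>R 1"
    by (simp add: nsq_def sum_distrib_left scaleR_sum_left)
  finally have "2 *\<^sub>R ?S = 2 *\<^sub>R (nsq x *\<^sub>R 1)" by (simp add: scaleR_2 scaleR_left_distrib[symmetric])
  then show ?thesis unfolding 1 by (simp only: scaleR_cancel_left) simp
qed

lemma hc_norm_nsq: "x \<in> M \<Longrightarrow> hc_norm x ^ (2 * k) = nsq x ^ k"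
  by (simp add: hc_norm_def alg_nsq_def mult_conj_nsq power_mult nsq_def sum_nonneg)

text \<open>The trace determines \<open>\<alpha>\<close> and the norm determines
  \<open>\<beta>\<^sup>2\<close>; only the sign of \<open>\<beta>\<close> is lost, as it can be
  absorbed in \<open>J\<close>.\<close>

lemma zeta_slice_point:
  assumes "x \<in> M" "J \<in> imag_units" "x = \<alpha> *\<^sub>R 1 + \<beta> *\<^sub>R J"
  shows "zeta x = Complex \<alpha> \<bar>\<beta>\<bar>"
proof -
  have c0: "c 0 x = \<alpha>"
    using hc_coord_eq[of x "v 0" "2 * \<alpha>"] slice_point(2)[OF assms(2,3)] by (simp add: v_0 unity_left unity_right)
  have "nsq x *\<^sub>R (1::'a) = (\<alpha>\<^sup>2 + \<beta>\<^sup>2) *\<^sub>R 1"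
    using mult_conj_nsq[OF assms(1)] slice_point(3)[OF assms(2,3)] by simp
  then have "nsq x = \<alpha>\<^sup>2 + \<beta>\<^sup>2" by simp
  then have "(\<Sum>i=1..m. (c i x)\<^sup>2) = \<beta>\<^sup>2" using nsq_split[of x] c0 by simp
  then show ?thesis by (simp add: zeta_def c0)
qed

lemma slice_pointE:
  assumes "x \<in> M"
  obtains J where "J \<in> imag_units" "x = Re (zeta x) *\<^sub>R 1 + Im (zeta x) *\<^sub>R J"
proof -
  obtain J \<alpha> \<beta> where J: "J \<in> imag_units" "x = \<alpha> *\<^sub>R 1 + \<beta> *\<^sub>R J"
    using assms M_cone quadratic_coneE by blast
  show ?thesis
  proof (cases "\<beta> \<ge> 0")
    case True
    then show ?thesis using that[OF J(1)] J(2) zeta_slice_point[OF assms J] by simp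
  next
    case False
    then show ?thesis
      using that[OF imag_unitsD(5)[OF J(1)]] J(2) zeta_slice_point[OF assms J] by simp
  qed
qed

text \<open>\<open>D\<close> contains \<open>Complex \<alpha> \<beta>\<close> together with its
  conjugate, so the folding in \<open>zeta\<close> loses nothing.\<close>

lemma circular_set_zeta:
  assumes "\<forall>z\<in>D. cnj z \<in> D"
  shows "circular_set D \<inter> M = {x \<in> M. zeta x \<in> D}"
proof (intro set_eqI iffI)
  fix x assume "x \<in> circular_set D \<inter> M"
  then obtain \<alpha> \<beta> J where x: "x \<in> M" "J \<in> imag_units" "x = \<alpha> *\<^sub>R 1 + \<beta> *\<^sub>R J" "Complex \<alpha> \<beta> \<in> D"
    by (auto simp: circular_set_def)
  then have "Complex \<alpha> \<bar>\<beta>\<bar> \<in> D"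
    using assms by (cases "\<beta> \<ge> 0") (auto simp: complex_cnj dest!: bspec)
  then show "x \<in> {x \<in> M. zeta x \<in> D}" using zeta_slice_point[OF x(1-3)] x(1) by simp
next
  fix x assume x: "x \<in> {x \<in> M. zeta x \<in> D}"
  then obtain J where "J \<in> imag_units" "x = Re (zeta x) *\<^sub>R 1 + Im (zeta x) *\<^sub>R J"
    using slice_pointE by blast
  moreover have "Complex (Re (zeta x)) (Im (zeta x)) \<in> D" using x by simp
  ultimately show "x \<in> circular_set D \<inter> M" using x unfolding circular_set_def by blast
qed

text \<open>\<open>x\<^sup>c\<close> is a real number minus \<open>x\<close>, and in the slice it
  replaces \<open>J\<close> by \<open>- J\<close>. Functions of \<open>zeta\<close> thus cannot tell
  \<open>x\<close> from \<open>x\<^sup>c\<close>, which drives the symmetry argument for the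
  kernel.\<close>

lemma conj_M:
  assumes "x \<in> M"
  shows "x\<^sup>c \<in> M" "zeta (x\<^sup>c) = zeta x"
proof -
  obtain J where J: "J \<in> imag_units" "x = Re (zeta x) *\<^sub>R 1 + Im (zeta x) *\<^sub>R J"
    using slice_pointE[OF assms] .
  have x: "x\<^sup>c = Re (zeta x) *\<^sub>R 1 + Im (zeta x) *\<^sub>R (- J)"
    using slice_point(1)[OF J] by simp
  have "x\<^sup>c = (2 * Re (zeta x)) *\<^sub>R 1 - x"
    using slice_point(2)[OF J] by (metis add_diff_cancel_left')
  then show M: "x\<^sup>c \<in> M"
    using assms M_subspace real_line_M by (auto simp: real_line_def intro!: subspace_diff)
  have "Im (zeta x) \<ge> 0" by (simp add: zeta_def sum_nonneg)
  then show "zeta (x\<^sup>c) = zeta x"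
    using zeta_slice_point[OF M imag_unitsD(5)[OF J(1)] x] by simp
qed

lemma line_open_zeta:
  assumes "open D"
  shows "line_open m v {x \<in> M. zeta x \<in> D}"
  unfolding line_open_def
proof (intro ballI allI impI)
  fix x i assume x: "x \<in> {x \<in> M. zeta x \<in> D}" and i: "i \<le> m"
  have "x + t *\<^sub>R v i \<in> M" for t
    using x v_M[OF i] M_subspace by (auto intro: subspace_add subspace_scale)
  then show "\<forall>\<^sub>F t in nhds 0. x + t *\<^sub>R v i \<in> {x \<in> M. zeta x \<in> D}"
    using zeta_line_open[OF assms, of x "v i"] x by simp
qed

end

section \<open>Stem functions in coordinates\<close>

definition stem_comp :: "(complex \<Rightarrow> 'a \<times> 'a) \<Rightarrow> 'a::euclidean_space \<Rightarrow> complex \<Rightarrow> complex" where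
  "stem_comp F b w = Complex (fst (F w) \<bullet> b) (snd (F w) \<bullet> b)"

text \<open>Multiplication by the complex variable in the complexification; it gives the stem
  function of \<open>x * f x\<close>.\<close>

definition stem_mult :: "(complex \<Rightarrow> 'a \<times> 'a) \<Rightarrow> complex \<Rightarrow> 'a \<times> 'a::euclidean_space" where
  "stem_mult F w = (Re w *\<^sub>R fst (F w) - Im w *\<^sub>R snd (F w), Im w *\<^sub>R fst (F w) + Re w *\<^sub>R snd (F w))"

lemma stem_comp_mult: "stem_comp (stem_mult F) b w = w * stem_comp F b w"
  by (simp add: stem_comp_def stem_mult_def complex_eq_iff inner_diff_left inner_add_left)

lemma stem_function_mult: "stem_function D F \<Longrightarrow> stem_function D (stem_mult F)"
  by (simp add: stem_function_def stem_mult_def cplx_conj_def)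

text \<open>Since the real linear derivative \<open>L\<close> turns multiplication by
  \<open>\<i>\<close> into multiplication by \<open>\<i>\<close>, it is multiplication by the
  complex number \<open>L 1\<close>.\<close>

lemma holomorphic_stem_comp:
  assumes "open D" "stem_holomorphic D F"
  shows "stem_comp F b holomorphic_on D"
  unfolding holomorphic_on_open[OF assms(1)]
proof
  fix z assume "z \<in> D"
  then obtain F' where F': "(F has_derivative F') (at z)" "\<And>w. F' (\<i> * w) = cplx_imath (F' w)"
    using assms(2) unfolding stem_holomorphic_def by blast
  define L where "L = (\<lambda>w. of_real (fst (F' w) \<bullet> b) + \<i> * of_real (snd (F' w) \<bullet> b) :: complex)"
  have eq: "stem_comp F b = (\<lambda>w. of_real (fst (F w) \<bullet> b) + \<i> * of_real (snd (F w) \<bullet> b))"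
    by (auto simp: stem_comp_def Complex_eq)
  have d: "(stem_comp F b has_derivative L) (at z)"
    unfolding eq L_def
    by (intro derivative_intros has_derivative_inner_left bounded_linear.has_derivative[OF bounded_linear_of_real]
        bounded_linear.has_derivative[OF bounded_linear_fst] bounded_linear.has_derivative[OF bounded_linear_snd]
        bounded_linear.has_derivative[OF bounded_linear_inner_left] F'(1))
  have lin: "linear L" using d has_derivative_linear by blast
  have i: "L (\<i> * w) = \<i> * L w" for w
    by (simp add: L_def F'(2) cplx_imath_def complex_eq_iff)
  have "L w = L 1 * w" for w
  proof -
    have "w = Re w *\<^sub>R 1 + Im w *\<^sub>R (\<i> * 1)" by (simp add: complex_eq_iff)
    then have "L w = L (Re w *\<^sub>R 1 + Im w *\<^sub>R (\<i> * 1))" by (rule arg_cong)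
    also have "\<dots> = Re w *\<^sub>R L 1 + Im w *\<^sub>R (\<i> * L 1)"
      unfolding linear_add[OF lin] linear_scale[OF lin] i ..
    also have "\<dots> = L 1 * w" by (simp add: complex_eq_iff)
    finally show ?thesis .
  qed
  then have "L = (*) (L 1)" by blast
  then show "\<exists>f'. (stem_comp F b has_field_derivative f') (at z)"
    using d unfolding has_field_derivative_def by metis
qed

lemma stem_comp_cnj:
  "stem_function D F \<Longrightarrow> z \<in> D \<Longrightarrow> stem_comp F b (cnj z) = cnj (stem_comp F b z)"
  by (simp add: stem_function_def stem_comp_def cplx_conj_def complex_eq_iff)

lemma harmonic_on_diff:
  assumes "line_open m v \<Omega>" "harmonic_on m v \<Omega> u" "harmonic_on m v \<Omega> w"
  shows "harmonic_on m v \<Omega> (\<lambda>x. u x - w x)"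
  using harmonic_on_sum[of m v \<Omega> "{True, False}" "\<lambda>k. if k then u else w" "\<lambda>k. if k then 1 else - 1"] assms
  by simp

text \<open>The imaginary part of \<open>g z - C * z\<close> vanishes on the circle, hence on the
  disc by the maximum principle. A holomorphic function with real values is constant there by the
  open mapping theorem, and the identity theorem reaches all of \<open>D\<close>.\<close>

lemma holomorphic_affine:
  assumes "open D" "connected D" "g holomorphic_on D" "0 < r" "cball 0 r \<subseteq> D"
    and circ: "\<And>z. cmod z = r \<Longrightarrow> Im (g z) = C * Im z"
  shows "\<exists>d. \<forall>z\<in>D. g z = of_real C * z + d"
proof -
  define h where "h = (\<lambda>z. g z - of_real C * z)"
  have h: "h holomorphic_on D" unfolding h_def by (intro holomorphic_intros assms(3))
  have hb: "h holomorphic_on ball 0 r" "continuous_on (cball 0 r) h"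
    using h assms(5) holomorphic_on_subset holomorphic_on_imp_continuous_on
    by (meson ball_subset_cball order_trans continuous_on_subset)+
  have Im0: "Im (h z) = 0" if z: "z \<in> ball 0 r" for z
  proof -
    \<comment> \<open>The real part of \<open>\<i> * h z\<close> is minus the imaginary part of
      \<open>h z\<close>; the two signs of \<open>s\<close> bound it from both sides.\<close>
    have le: "Re (s * h z) \<le> 0" if s: "s = \<i> \<or> s = - \<i>" for s
    proof (rule maximum_real_frontier[of "\<lambda>z. s * h z" "ball 0 r"])
      show "Re (s * h w) \<le> 0" if "w \<in> frontier (ball 0 r)" for w
        using that s circ[of w] assms(4) by (auto simp: h_def)
    qed (use z assms(4) in \<open>auto intro!: holomorphic_intros continuous_intros hb\<close>)
    from le[of \<i>] le[of "- \<i>"] show ?thesis by simp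
  qed
  have "h constant_on ball 0 r"
  proof (rule ccontr)
    assume nc: "\<not> h constant_on ball 0 r"
    have "open (h ` ball 0 r)"
      by (rule open_mapping_thm[OF hb(1) _ _ _ _ nc]) auto
    then obtain e where e: "e > 0" "ball (h 0) e \<subseteq> h ` ball 0 r"
      using assms(4) open_contains_ball by (metis centre_in_ball imageI)
    have "h 0 + \<i> * of_real (e / 2) \<in> ball (h 0) e" using e(1) by (simp add: dist_norm norm_mult)
    then obtain w where "w \<in> ball 0 r" "h w = h 0 + \<i> * of_real (e / 2)" using e(2) by (metis imageE subsetD)
    then show False using Im0[of w] Im0[of 0] assms(4) e(1) by simp
  qed
  then obtain d where d: "\<And>z. z \<in> ball 0 r \<Longrightarrow> h z = d" by (auto simp: constant_on_def)
  have "h z = d" if "z \<in> D" for z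
    by (rule analytic_continuation_open[of "ball 0 r" D h "\<lambda>_. d"])
       (use assms h d that ball_subset_cball[of 0 r] in \<open>auto intro: subset_trans\<close>)
  then have "\<forall>z\<in>D. g z = of_real C * z + d" by (auto simp: h_def algebra_simps)
  then show ?thesis ..
qed

section \<open>Spherical derivatives, their Almansi decompositions and a product rule\<close>

context hc_frame begin

text \<open>Restricted to points of \<open>M\<close>, so that it applies to \<open>f\<close> and
  \<open>x * f x\<close> themselves, whose values off the domain are arbitrary.\<close>

definition slice_on :: "complex set \<Rightarrow> (complex \<Rightarrow> 'a \<times> 'a) \<Rightarrow> ('a \<Rightarrow> 'a) \<Rightarrow> bool" where
  "slice_on D F f \<longleftrightarrow> (\<forall>x\<in>M. \<forall>\<alpha> \<beta>. \<forall>J\<in>imag_units. x = \<alpha> *\<^sub>R 1 + \<beta> *\<^sub>R J \<longrightarrow> Complex \<alpha> \<beta> \<in> D \<longrightarrow>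
     f x = fst (F (Complex \<alpha> \<beta>)) + J * snd (F (Complex \<alpha> \<beta>)))"

lemma slice_on_mult:
  assumes "slice_on D F f"
  shows "slice_on D (stem_mult F) (\<lambda>x. x * f x)"
  unfolding slice_on_def
proof (intro ballI allI impI)
  fix x \<alpha> \<beta> J assume a: "x \<in> M" "J \<in> imag_units" "x = \<alpha> *\<^sub>R 1 + \<beta> *\<^sub>R J" "Complex \<alpha> \<beta> \<in> D"
  then have f: "f x = fst (F (Complex \<alpha> \<beta>)) + J * snd (F (Complex \<alpha> \<beta>))"
    using assms unfolding slice_on_def by blast
  show "x * f x = fst (stem_mult F (Complex \<alpha> \<beta>)) + J * snd (stem_mult F (Complex \<alpha> \<beta>))"
    unfolding f unfolding a(3)
    by (simp add: stem_mult_def alg_mult_simps imag_unitsD[OF a(2)] algebra_simps)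
qed

text \<open>Off the real line both sides are \<open>snd (F (zeta x))\<close> divided by
  \<open>Im (zeta x)\<close>. At real points continuity of \<open>axial\<close> identifies the limit
  in \<open>spherical_deriv\<close>, provided that non-real points accumulate there.\<close>

lemma spherical_deriv_axial:
  assumes D: "open D" "\<forall>z\<in>D. cnj z \<in> D" and F: "stem_function D F" "slice_on D F f"
    and holo: "\<And>b. b \<in> Basis \<Longrightarrow> stem_comp F b holomorphic_on D" and "1 \<le> m"
    and x: "x \<in> {x \<in> M. zeta x \<in> D}"
  shows "spherical_deriv {x \<in> M. zeta x \<in> D} f x = axial 1 (stem_comp F) x"
    and "Im (zeta x) \<noteq> 0 \<Longrightarrow> axial 1 (stem_comp F) x = (1 / Im (zeta x)) *\<^sub>R snd (F (zeta x))"
proof -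
  let ?\<Omega> = "{x \<in> M. zeta x \<in> D}"
  have real: "y \<in> real_line \<longleftrightarrow> Im (zeta y) = 0" if "y \<in> M" for y
    using slice_pointE[OF that] slice_point_real by metis
  have axial: "axial 1 (stem_comp F) y = (1 / Im (zeta y)) *\<^sub>R snd (F (zeta y))"
    if "y \<in> ?\<Omega>" "Im (zeta y) \<noteq> 0" for y
  proof -
    have z: "zeta y \<in> D" using that by simp
    have "Re (pair_residue 1 (stem_comp F b) (zeta y)) = (1 / Im (zeta y)) * (snd (F (zeta y)) \<bullet> b)"
      if b: "b \<in> Basis" for b
    proof -
      let ?g = "stem_comp F b (zeta y)"
      have "?g - cnj ?g = 2 * \<i> * of_real (Im ?g)" by (simp add: complex_eq_iff)
      then have "pair_residue 1 (stem_comp F b) (zeta y) = of_real (Im ?g / Im (zeta y))"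
        unfolding pair_residue_1_nonreal[OF D z holo[OF b] \<open>Im (zeta y) \<noteq> 0\<close>] stem_comp_cnj[OF F(1) z]
        using \<open>Im (zeta y) \<noteq> 0\<close> by simp
      then show ?thesis by (simp add: stem_comp_def)
    qed
    then have "axial 1 (stem_comp F) y = (\<Sum>b\<in>Basis. ((1 / Im (zeta y)) * (snd (F (zeta y)) \<bullet> b)) *\<^sub>R b)"
      unfolding axial_def by (intro sum.cong) auto
    also have "\<dots> = (1 / Im (zeta y)) *\<^sub>R (\<Sum>b\<in>Basis. (snd (F (zeta y)) \<bullet> b) *\<^sub>R b)"
      by (simp add: scaleR_sum_right)
    finally show ?thesis by (simp add: euclidean_representation)
  qed
  then show "Im (zeta x) \<noteq> 0 \<Longrightarrow> axial 1 (stem_comp F) x = (1 / Im (zeta x)) *\<^sub>R snd (F (zeta x))"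
    using x by blast
  have quot: "spherical_quotient f y = axial 1 (stem_comp F) y" if y: "y \<in> ?\<Omega>" "y \<notin> real_line" for y
  proof -
    have M: "y \<in> M" and z: "zeta y \<in> D" using y by auto
    have nz: "Im (zeta y) \<noteq> 0" using real[OF M] y(2) by simp
    obtain J where J: "J \<in> imag_units" "y = Re (zeta y) *\<^sub>R 1 + Im (zeta y) *\<^sub>R J"
      using slice_pointE[OF M] .
    have c: "y\<^sup>c = Re (zeta y) *\<^sub>R 1 + Im (zeta y) *\<^sub>R (- J)" using slice_point(1)[OF J] by simp
    have zD: "Complex (Re (zeta y)) (Im (zeta y)) \<in> D" using z by simp
    have "spherical_quotient f y = (1 / Im (zeta y)) *\<^sub>R snd (F (zeta y))"
    proof (rule spherical_quotient_slice[OF J nz])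
      show "f y = fst (F (zeta y)) + J * snd (F (zeta y))"
        using F(2) M J zD unfolding slice_on_def by (metis complex_surj)
      show "f (y\<^sup>c) = fst (F (zeta y)) + - J * snd (F (zeta y))"
        using F(2) conj_M(1)[OF M] imag_unitsD(5)[OF J(1)] c zD unfolding slice_on_def
        by (metis complex_surj)
    qed
    then show ?thesis using axial[OF y(1) nz] by simp
  qed
  show "spherical_deriv ?\<Omega> f x = axial 1 (stem_comp F) x"
  proof (cases "x \<in> real_line")
    case True
    have cont: "continuous_on ?\<Omega> (axial 1 (stem_comp F))"
      by (rule continuous_on_axial[OF D holo]) auto
    then have "(axial 1 (stem_comp F) \<longlongrightarrow> axial 1 (stem_comp F) x) (at x within ?\<Omega>)"
      using x unfolding continuous_on_def by blast
    then have "(axial 1 (stem_comp F) \<longlongrightarrow> axial 1 (stem_comp F) x) (at x within (?\<Omega> - real_line))"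
      by (rule tendsto_within_subset) auto
    moreover have "\<forall>\<^sub>F y in at x within (?\<Omega> - real_line). axial 1 (stem_comp F) y = spherical_quotient f y"
      unfolding eventually_at_filter by (rule always_eventually) (use quot in auto)
    ultimately have lim: "(spherical_quotient f \<longlongrightarrow> axial 1 (stem_comp F) x) (at x within (?\<Omega> - real_line))"
      by (rule Lim_transform_eventually)
    have c1: "c 1 x = 0"
    proof -
      obtain r where r: "x = r *\<^sub>R v 0" using True v_0 by (auto simp: real_line_def)
      show ?thesis unfolding r using c_v[of 1 0] \<open>1 \<le> m\<close> by (simp add: linear_scale[OF linear_c])
    qed
    \<comment> \<open>Non-real points near \<open>x\<close> are reached by moving along
      \<open>v 1\<close>.\<close>
    have "x islimpt (?\<Omega> - real_line)"
      unfolding islimpt_approachable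
    proof (intro allI impI)
      fix e :: real assume e: "e > 0"
      have "\<forall>\<^sub>F t in nhds 0. x + t *\<^sub>R v 1 \<in> ?\<Omega>"
        using line_open_zeta[OF D(1)] x \<open>1 \<le> m\<close> unfolding line_open_def by blast
      then obtain d where d: "d > 0" "\<And>t. \<bar>t\<bar> < d \<Longrightarrow> x + t *\<^sub>R v 1 \<in> ?\<Omega>"
        by (auto simp: eventually_nhds_metric dist_real_def)
      define t where "t = min (d / 2) (e / (2 * (norm (v 1) + 1)))"
      have np: "norm (v 1) + 1 > 0" using norm_ge_zero[of "v 1"] by linarith
      have t: "0 < t" "t < d" "t * (norm (v 1) + 1) < e"
      proof -
        show "0 < t" "t < d" using d e np by (auto simp: t_def)
        have "t * (norm (v 1) + 1) \<le> e / (2 * (norm (v 1) + 1)) * (norm (v 1) + 1)"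
          using np by (intro mult_right_mono) (auto simp: t_def)
        also have "\<dots> = e / 2" using np by (simp add: field_simps)
        finally show "t * (norm (v 1) + 1) < e" using e by simp
      qed
      have in\<Omega>: "x + t *\<^sub>R v 1 \<in> ?\<Omega>" using d(2)[of t] t by simp
      have "c 1 (x + t *\<^sub>R v 1) = t" using c_line[of 1 1 x t] c1 \<open>1 \<le> m\<close> by simp
      moreover have "(c 1 (x + t *\<^sub>R v 1))\<^sup>2 \<le> (\<Sum>i=1..m. (c i (x + t *\<^sub>R v 1))\<^sup>2)"
        using \<open>1 \<le> m\<close> by (intro member_le_sum) auto
      ultimately have "(\<Sum>i=1..m. (c i (x + t *\<^sub>R v 1))\<^sup>2) > 0"
        using t(1) by (metis less_le_trans zero_less_power)
      then have "Im (zeta (x + t *\<^sub>R v 1)) \<noteq> 0" by (simp add: zeta_def)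
      then have nr: "x + t *\<^sub>R v 1 \<notin> real_line" using real in\<Omega> by blast
      have "dist (x + t *\<^sub>R v 1) x = t * norm (v 1)" using t(1) by (simp add: dist_norm)
      also have "\<dots> \<le> t * (norm (v 1) + 1)" using t(1) by (intro mult_left_mono) auto
      also have "\<dots> < e" by (rule t(3))
      finally have "dist (x + t *\<^sub>R v 1) x < e" .
      then show "\<exists>x'\<in>?\<Omega> - real_line. x' \<noteq> x \<and> dist x' x < e"
        using in\<Omega> nr True by (intro bexI[of _ "x + t *\<^sub>R v 1"]) auto
    qed
    then have "\<not> trivial_limit (at x within (?\<Omega> - real_line))" by (simp add: trivial_limit_within)
    then show ?thesis using tendsto_Lim[OF _ lim] True by (simp add: spherical_deriv_def)
  next
    case False
    then show ?thesis using quot[OF x] by (simp add: spherical_deriv_def)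
  qed
qed

text \<open>This is \<open>pair_residue_almansi\<close> in each coordinate. The indices fit:
  \<open>Suc n = (m - 1) / 2\<close> is the harmonic exponent and \<open>n = (m - 3) / 2\<close> the
  last index of the decomposition.\<close>

lemma almansi_exists:
  assumes D: "open D" "\<forall>z\<in>D. cnj z \<in> D" "0 \<in> D" "starlike D"
    and G: "\<And>b. b \<in> Basis \<Longrightarrow> G b holomorphic_on D" and m: "m = 2 * Suc n + 1"
    and h: "\<And>x. x \<in> {x \<in> M. zeta x \<in> D} \<Longrightarrow> h x = axial 1 G x"
  shows "\<exists>H. (\<forall>k\<le>n. \<forall>b\<in>Basis. H k b holomorphic_on D) \<and>
    is_almansi_decomposition m v {x \<in> M. zeta x \<in> D} h (\<lambda>k. axial (Suc n) (H k))"
proof -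
  let ?\<Omega> = "{x \<in> M. zeta x \<in> D}"
  have "\<forall>b\<in>Basis. \<exists>H. (\<forall>k\<le>n. H k holomorphic_on D) \<and>
     (\<forall>z\<in>D. pair_residue 1 (G b) z = (\<Sum>k\<le>n. of_real (cmod z ^ (2 * k)) * pair_residue (Suc n) (H k) z))"
    using pair_residue_almansi[OF D G] by blast
  then obtain H where H: "\<And>b k. b \<in> Basis \<Longrightarrow> k \<le> n \<Longrightarrow> H b k holomorphic_on D"
    "\<And>b z. b \<in> Basis \<Longrightarrow> z \<in> D \<Longrightarrow>
      pair_residue 1 (G b) z = (\<Sum>k\<le>n. of_real (cmod z ^ (2 * k)) * pair_residue (Suc n) (H b k) z)"
    unfolding bchoice_iff by blast
  have "is_almansi_decomposition m v ?\<Omega> h (\<lambda>k. axial (Suc n) (\<lambda>b. H b k))"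
    unfolding is_almansi_decomposition_def
  proof (intro conjI allI impI ballI)
    have mn: "(m - 3) div 2 = n" using m by simp
    show "harmonic_on m v ?\<Omega> (axial (Suc n) (\<lambda>b. H b k))" if "k \<le> (m - 3) div 2" for k
      by (rule harmonic_on_axial[OF D(1,2)]) (use H(1) that mn line_open_zeta[OF D(1)] m in auto)
    fix x assume x: "x \<in> ?\<Omega>"
    have n: "hc_norm x ^ (2 * k) = cmod (zeta x) ^ (2 * k)" for k
      using hc_norm_nsq[of x k] x by (simp add: power_mult cmod_zeta)
    have "h x = (\<Sum>b\<in>Basis. (\<Sum>k\<le>n. hc_norm x ^ (2 * k) * Re (pair_residue (Suc n) (H b k) (zeta x))) *\<^sub>R b)"
      unfolding h[OF x] axial_def n using x by (intro sum.cong refl) (simp add: H(2)[unfolded One_nat_def] del: of_real_power)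
    also have "\<dots> = (\<Sum>k\<le>n. hc_norm x ^ (2 * k) *\<^sub>R axial (Suc n) (\<lambda>b. H b k) x)"
      unfolding axial_def scaleR_sum_left scaleR_sum_right by (subst sum.swap) simp
    finally show "h x = (\<Sum>k\<le>(m - 3) div 2. hc_norm x ^ (2 * k) *\<^sub>R axial (Suc n) (\<lambda>b. H b k) x)"
      by (simp add: mn)
  qed
  then show ?thesis using H(1) by (intro exI[of _ "\<lambda>k b. H b k"]) auto
qed

text \<open>The factor \<open>x\<^sup>c\<close> is real linear with derivative
  \<open>(v i)\<^sup>c\<close>, so its second derivatives vanish and only the mixed terms survive.
  The vanishing of a Fueter component becomes a first-order equation for \<open>w\<close>
  alone.\<close>

lemma laplacian_conj_mult:
  assumes lo: "line_open m v \<Omega>" and u: "harmonic_on m v \<Omega> u" and w: "harmonic_on m v \<Omega> w"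
    and x: "x \<in> \<Omega>"
  shows "laplacian m v (\<lambda>x. u x - x\<^sup>c * w x) x = - (2 *\<^sub>R (\<Sum>i\<le>m. (v i)\<^sup>c * partial_deriv v i w x))"
proof -
  interpret mult: bounded_bilinear "(*) :: 'a \<Rightarrow> 'a \<Rightarrow> 'a" by (rule bounded_bilinear_alg_mult)
  have bc: "bounded_linear (star_conj :: 'a \<Rightarrow> 'a)"
    using linear_star_conj linear_conv_bounded_linear by blast
  have U: "Ck_on 2 m v \<Omega> u" and W: "Ck_on 2 m v \<Omega> w" using u w by (auto simp: harmonic_on_def)
  have cc: "continuous_on \<Omega> (star_conj :: 'a \<Rightarrow> 'a)" by (rule linear_continuous_on[OF bc])
  have dc: "((\<lambda>t. (y + t *\<^sub>R v i)\<^sup>c) has_vector_derivative (v i)\<^sup>c) (at 0)" for y i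
    unfolding conj_add conj_scale by (auto intro!: derivative_eq_intros)
  have dmul: "((\<lambda>t. (y + t *\<^sub>R v i)\<^sup>c * h (y + t *\<^sub>R v i)) has_vector_derivative
      (v i)\<^sup>c * h y + y\<^sup>c * d) (at 0)"
    if "((\<lambda>t. h (y + t *\<^sub>R v i)) has_vector_derivative d) (at 0)" for y i h d
    using mult.has_vector_derivative[OF dc[of y i] that] by (simp add: add.commute)
  have cmul: "continuous_on \<Omega> (\<lambda>y. y\<^sup>c * h y)" if "continuous_on \<Omega> h" for h
    by (rule mult.continuous_on[OF cc that])
  have cmul': "continuous_on \<Omega> (\<lambda>y. a * h y)" if "continuous_on \<Omega> h" for h :: "'a \<Rightarrow> 'a" and a
    by (intro mult.continuous_on continuous_on_const that)
  have dmul': "((\<lambda>t. a * h (y + t *\<^sub>R v i)) has_vector_derivative a * d) (at 0)"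
    if "((\<lambda>t. h (y + t *\<^sub>R v i)) has_vector_derivative d) (at 0)" for y i d a and h :: "'a \<Rightarrow> 'a"
    by (rule bounded_linear.has_vector_derivative[OF mult.bounded_linear_right that])
  let ?p = "\<lambda>i. partial_deriv v i"
  have "laplacian m v (\<lambda>x. u x - x\<^sup>c * w x) x = (\<Sum>i\<le>m. ?p i (?p i u) x
      - ((v i)\<^sup>c * ?p i w x + ((v i)\<^sup>c * ?p i w x + x\<^sup>c * ?p i (?p i w) x)))"
  proof (rule Ck_on_2I(2)[OF lo _ _ _ _ _ x, where ?f1.0 = "\<lambda>i x. ?p i u x - ((v i)\<^sup>c * w x + x\<^sup>c * ?p i w x)"
        and ?f2.0 = "\<lambda>i j x. ?p j (?p i u) x
          - ((v i)\<^sup>c * ?p j w x + ((v j)\<^sup>c * ?p i w x + x\<^sup>c * ?p j (?p i w) x))"])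
    show "continuous_on \<Omega> (\<lambda>x. u x - x\<^sup>c * w x)"
      by (intro continuous_intros cmul Ck_on_2D(1)[OF U, of 0] Ck_on_2D(1)[OF W, of 0]) auto
    show "((\<lambda>t. u (y + t *\<^sub>R v i) - (y + t *\<^sub>R v i)\<^sup>c * w (y + t *\<^sub>R v i)) has_vector_derivative
        ?p i u y - ((v i)\<^sup>c * w y + y\<^sup>c * ?p i w y)) (at 0)" if "i \<le> m" "y \<in> \<Omega>" for i y
      by (intro has_vector_derivative_diff dmul Ck_on_2D(2)[OF U that] Ck_on_2D(2)[OF W that])
    show "continuous_on \<Omega> (\<lambda>x. ?p i u x - ((v i)\<^sup>c * w x + x\<^sup>c * ?p i w x))" if "i \<le> m" for i
      by (intro continuous_on_diff continuous_on_add cmul cmul' Ck_on_2D(3)[OF U that] Ck_on_2D(3)[OF W that]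
          Ck_on_2D(1)[OF W that])
    show "((\<lambda>t. ?p i u (y + t *\<^sub>R v j) - ((v i)\<^sup>c * w (y + t *\<^sub>R v j)
          + (y + t *\<^sub>R v j)\<^sup>c * ?p i w (y + t *\<^sub>R v j))) has_vector_derivative
        ?p j (?p i u) y - ((v i)\<^sup>c * ?p j w y + ((v j)\<^sup>c * ?p i w y + y\<^sup>c * ?p j (?p i w) y))) (at 0)"
      if "i \<le> m" "j \<le> m" "y \<in> \<Omega>" for i j y
      by (intro has_vector_derivative_diff has_vector_derivative_add dmul dmul'
          Ck_on_2D(4)[OF U that] Ck_on_2D(4)[OF W that] Ck_on_2D(2)[OF W that(2,3)])
    show "continuous_on \<Omega> (\<lambda>x. ?p j (?p i u) x
          - ((v i)\<^sup>c * ?p j w x + ((v j)\<^sup>c * ?p i w x + x\<^sup>c * ?p j (?p i w) x)))" if "i \<le> m" "j \<le> m" for i j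
      by (intro continuous_on_diff continuous_on_add cmul cmul' Ck_on_2D(5)[OF U that] Ck_on_2D(5)[OF W that]
          Ck_on_2D(3)[OF W that(2)] Ck_on_2D(3)[OF W that(1)])
  qed
  also have "\<dots> = laplacian m v u x - (2 *\<^sub>R (\<Sum>i\<le>m. (v i)\<^sup>c * ?p i w x) + x\<^sup>c * laplacian m v w x)"
    by (simp add: laplacian_def sum_subtractf sum.distrib scaleR_2 linear_sum[OF linear_mult_right])
  also have "\<dots> = - (2 *\<^sub>R (\<Sum>i\<le>m. (v i)\<^sup>c * ?p i w x))"
    using u w x by (simp add: harmonic_on_def alg_mult_simps)
  finally show ?thesis .
qed

end

section \<open>The kernel of the Fueter mapping\<close>

lemma real_vector_eq_minus_self:
  fixes x :: "'a::real_vector"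
  assumes "x = - x"
  shows "x = 0"
proof -
  have "2 *\<^sub>R x = 0" using assms by (simp only: scaleR_2 eq_neg_iff_add_eq_0)
  then show ?thesis by simp
qed

context hc_frame begin

lemma v_1_imag_unit: "1 \<le> m \<Longrightarrow> v 1 \<in> imag_units"
proof -
  assume "1 \<le> m"
  then have "2 *\<^sub>R (v 1 * (v 1)\<^sup>c) = 2 *\<^sub>R 1"
    using v_polar[of 1 1] by (simp add: scaleR_2)
  then have "v 1 * (v 1)\<^sup>c = 1" by (simp only: scaleR_cancel_left) simp
  moreover have "v 1 + (v 1)\<^sup>c = 0" using conj_v[OF \<open>1 \<le> m\<close>] by simp
  ultimately show ?thesis by (simp add: imag_units_def alg_trace_def alg_nsq_def)
qed

text \<open>\<open>w k\<close> will be the components picked by the choice operator and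
  \<open>axial N (H k)\<close> the explicit ones. They are compared only in sums weighted by
  \<open>r ^ (2 * k)\<close>, for which the maximum principle suffices.\<close>

lemma fueter_kernel_stem:
  fixes n :: nat and F :: "complex \<Rightarrow> 'a \<times> 'a"
  defines "N \<equiv> Suc n"
  assumes D: "open D" "\<forall>z\<in>D. cnj z \<in> D" and D0: "0 \<in> D" and star: "starlike D"
    and m: "m = 2 * N + 1"
    and F: "stem_function D F" "\<And>b. b \<in> Basis \<Longrightarrow> stem_comp F b holomorphic_on D"
    and quot: "\<And>x. x \<in> M \<Longrightarrow> zeta x \<in> D \<Longrightarrow> Im (zeta x) \<noteq> 0 \<Longrightarrow>
      h x = (1 / Im (zeta x)) *\<^sub>R snd (F (zeta x))"
    and H: "\<And>k b. k \<le> n \<Longrightarrow> b \<in> Basis \<Longrightarrow> H k b holomorphic_on D"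
    and w: "\<And>k. k \<le> n \<Longrightarrow> harmonic_on m v {x \<in> M. zeta x \<in> D} (w k)"
    and dec_w: "\<And>x. x \<in> M \<Longrightarrow> zeta x \<in> D \<Longrightarrow> h x = (\<Sum>k\<le>n. hc_norm x ^ (2 * k) *\<^sub>R w k x)"
    and dec_H: "\<And>x. x \<in> M \<Longrightarrow> zeta x \<in> D \<Longrightarrow> h x = (\<Sum>k\<le>n. hc_norm x ^ (2 * k) *\<^sub>R axial N (H k) x)"
    and dw: "\<And>k x. k \<le> n \<Longrightarrow> x \<in> M \<Longrightarrow> zeta x \<in> D \<Longrightarrow>
      (\<Sum>i\<le>m. (v i)\<^sup>c * partial_deriv v i (w k) x) = 0"
  shows "\<exists>C B. \<forall>z\<in>D. F z = (Re z *\<^sub>R C + B, Im z *\<^sub>R C)"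
proof -
  let ?\<Omega> = "{x \<in> M. zeta x \<in> D}"
  obtain r where r: "r > 0" "cball 0 r \<subseteq> D" using D(1) D0 open_contains_cball by metis
  let ?Bo = "{x \<in> M. zeta x \<in> ball 0 r}"
  have zeta_nsq: "cmod (zeta x) \<le> r \<longleftrightarrow> nsq x \<le> r\<^sup>2" for x
    using r(1) by (simp add: cmod_zeta[symmetric] abs_le_square_iff[symmetric])
  have B\<Omega>: "x \<in> ?\<Omega>" if "x \<in> M" "cmod (zeta x) \<le> r" for x using that r(2) by auto
  have Bo\<Omega>: "x \<in> ?\<Omega>" if "x \<in> ?Bo" for x using that r(2) by auto
  have loD: "line_open m v ?\<Omega>" and loB: "line_open m v ?Bo"
    using line_open_zeta[OF D(1)] line_open_zeta[OF open_ball] by blast+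
  have m1: "1 \<le> m" using m by simp
  \<comment> \<open>On the sphere of radius \<open>r\<close> the weights equal
    \<open>hc_norm x ^ (2 * k)\<close>, so \<open>K\<close> is a harmonic function agreeing with
    \<open>h\<close> there. \<open>E i\<close> is its derivative along \<open>v i\<close>, and
    \<open>P\<close> and \<open>W\<close> are the two parts of \<open>E\<close>.\<close>
  define K where "K = (\<lambda>x. \<Sum>k\<le>n. r ^ (2 * k) *\<^sub>R axial N (H k) x)"
  define E where "E = (\<lambda>i x. \<Sum>k\<le>n. r ^ (2 * k) *\<^sub>R axial_deriv N (H k) i x)"
  define P where "P = (\<lambda>x. \<Sum>k\<le>n. r ^ (2 * k) *\<^sub>R axial (Suc N) (\<lambda>b w. w * H k b w) x)"
  define W where "W = (\<lambda>x. \<Sum>k\<le>n. r ^ (2 * k) *\<^sub>R axial (Suc N) (H k) x)"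
  have harm: "harmonic_on m v ?\<Omega> (axial N (H k))" if "k \<le> n" for k
    by (rule harmonic_on_axial[OF D H[OF that] _ loD m]) auto
  define d where "d = (\<lambda>x. \<Sum>k\<in>{..n}. r ^ (2 * k) *\<^sub>R (w k x - axial N (H k) x))"
  have d0: "d x = 0" if x: "x \<in> M" "cmod (zeta x) \<le> r" for x
  proof (rule harmonic_zero_inside[of ?\<Omega> d "r\<^sup>2"])
    show "harmonic_on m v ?\<Omega> d"
      unfolding d_def by (intro harmonic_on_sum loD harmonic_on_diff w harm) auto
    show "{x \<in> span (v ` {..m}). nsq x \<le> r\<^sup>2} \<subseteq> ?\<Omega>"
      unfolding span_v using B\<Omega> zeta_nsq by blast
    show "d y = 0" if y: "y \<in> span (v ` {..m})" "nsq y = r\<^sup>2" for y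
    proof -
      have yM: "y \<in> M" and yD: "zeta y \<in> D" using y B\<Omega>[of y] zeta_nsq[of y] span_v by auto
      have "hc_norm y ^ (2 * k) = r ^ (2 * k)" for k
        using hc_norm_nsq[OF yM] y(2) by (simp add: power_mult)
      then show ?thesis
        using dec_w[OF yM yD] dec_H[OF yM yD] by (simp add: d_def scaleR_right_diff_distrib sum_subtractf)
    qed
  qed (use x zeta_nsq expansion span_v in auto)
  have E_eq: "E i x = of_nat (2 * N) *\<^sub>R ((if i = 0 then P x else 0) - c i x *\<^sub>R W x)" for i x
    by (cases "i = 0") (simp_all add: E_def P_def W_def axial_deriv_def scaleR_sum_right sum_subtractf sum_negf
        scaleR_right_diff_distrib mult_ac)
  have K_deriv: "((\<lambda>t. K (x + t *\<^sub>R v i)) has_vector_derivative E i x) (at 0)"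
    if "x \<in> ?\<Omega>" "i \<le> m" for x i
    unfolding K_def E_def using that
    by (intro has_vector_derivative_sum bounded_linear.has_vector_derivative[OF bounded_linear_scaleR_right]
        has_vector_derivative_axial[OF D] H) auto
  \<comment> \<open>On the open ball \<open>d\<close> vanishes identically, hence so do its
    derivatives; in this way the equation for the \<open>w k\<close> passes to
    \<open>K\<close>.\<close>
  have E_w: "E i x = (\<Sum>k\<le>n. r ^ (2 * k) *\<^sub>R partial_deriv v i (w k) x)" if x: "x \<in> ?Bo" and i: "i \<le> m" for x i
  proof -
    let ?S = "\<Sum>k\<in>{..n}. r ^ (2 * k) *\<^sub>R (partial_deriv v i (w k) x - axial_deriv N (H k) i x)"
    have x\<Omega>: "x \<in> ?\<Omega>" using Bo\<Omega>[OF x] .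
    have "((\<lambda>t. w k (x + t *\<^sub>R v i)) has_vector_derivative partial_deriv v i (w k) x) (at 0)"
      if "k \<le> n" for k
      using Ck_on_2D(2)[of m v ?\<Omega> "w k" i x] w[OF that] i x\<Omega> by (simp add: harmonic_on_def)
    moreover have "((\<lambda>t. axial N (H k) (x + t *\<^sub>R v i)) has_vector_derivative axial_deriv N (H k) i x) (at 0)"
      if "k \<le> n" for k
      using has_vector_derivative_axial[where x = x and i = i and q = N, OF D H[OF that]] x\<Omega> i by simp
    ultimately have "((\<lambda>t. d (x + t *\<^sub>R v i)) has_vector_derivative ?S) (at 0)"
      unfolding d_def
      by (intro has_vector_derivative_sum bounded_linear.has_vector_derivative[OF bounded_linear_scaleR_right]
          has_vector_derivative_diff) auto
    from has_vector_derivative_line_cong[OF loB x i _ this, of "\<lambda>_. 0"] d0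
    have "((\<lambda>t::real. 0) has_vector_derivative ?S) (at 0)" by simp
    then have "?S = 0" by (rule vector_derivative_unique_at[OF _ has_vector_derivative_const])
    then show ?thesis by (simp add: E_def scaleR_right_diff_distrib sum_subtractf)
  qed
  \<comment> \<open>Since \<open>x\<^sup>c\<close> is the sum of the
    \<open>c i x *\<^sub>R (v i)\<^sup>c\<close>, the first-order equation for \<open>K\<close>
    collapses to one relation between \<open>P\<close> and \<open>W\<close>.\<close>
  have PW: "P x = x\<^sup>c * W x" if x: "x \<in> ?Bo" for x
  proof -
    have "(\<Sum>i\<le>m. (v i)\<^sup>c * E i x)
        = (\<Sum>i\<le>m. \<Sum>k\<le>n. r ^ (2 * k) *\<^sub>R ((v i)\<^sup>c * partial_deriv v i (w k) x))"
      using E_w[OF x] by (intro sum.cong) (auto simp: linear_sum[OF linear_mult_right] mult_scale_right)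
    also have "\<dots> = (\<Sum>k\<le>n. r ^ (2 * k) *\<^sub>R (\<Sum>i\<le>m. (v i)\<^sup>c * partial_deriv v i (w k) x))"
      unfolding scaleR_sum_right by (rule sum.swap)
    also have "\<dots> = 0" using dw Bo\<Omega>[OF x] by simp
    finally have "0 = (\<Sum>i\<le>m. (v i)\<^sup>c * E i x)" by simp
    also have "\<dots> = (\<Sum>i\<le>m. of_nat (2 * N) *\<^sub>R ((if i = 0 then P x else 0) - (c i x *\<^sub>R (v i)\<^sup>c) * W x))"
      by (intro sum.cong) (auto simp: E_eq alg_mult_simps v_0)
    also have "\<dots> = of_nat (2 * N) *\<^sub>R (P x - x\<^sup>c * W x)"
      using conj_expansion[of x] x
      by (simp add: scaleR_sum_right[symmetric] sum_subtractf linear_sum[OF linear_mult_left] del: of_nat_mult)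
    finally show ?thesis by (simp add: N_def)
  qed
  have E0: "E i x = 0" if x: "x \<in> ?Bo" and i: "i \<le> m" for x i
  proof -
    have M: "x \<in> M" using x by simp
    \<comment> \<open>\<open>P\<close> and \<open>W\<close> depend on \<open>zeta x\<close> only, so
      the relation at \<open>x\<^sup>c\<close> reads \<open>P x = x * W x\<close>. Subtracting the
      two relations isolates the imaginary part of \<open>x\<close>.\<close>
    have "x\<^sup>c \<in> ?Bo" using x conj_M[OF M] by simp
    from PW[OF this] have P2: "P x = x * W x"
      using conj_M[OF M] by (simp add: P_def W_def axial_def conj_conj)
    obtain J where J: "J \<in> imag_units" "x = Re (zeta x) *\<^sub>R 1 + Im (zeta x) *\<^sub>R J"
      using slice_pointE[OF M] .
    have 1: "x * W x = Re (zeta x) *\<^sub>R W x + Im (zeta x) *\<^sub>R (J * W x)"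
      by (subst (1) J(2)) (simp add: alg_mult_simps)
    have 2: "x\<^sup>c * W x = Re (zeta x) *\<^sub>R W x - Im (zeta x) *\<^sub>R (J * W x)"
      by (subst slice_point(1)[OF J]) (simp add: alg_mult_simps)
    have "x * W x - x\<^sup>c * W x = 2 *\<^sub>R (Im (zeta x) *\<^sub>R (J * W x))"
      unfolding 1 2 scaleR_2 by simp
    then have ImJ: "Im (zeta x) *\<^sub>R (J * W x) = 0" using P2 PW[OF x] by simp
    have "W x = 0" if "J * W x = 0"
      using imag_unitsD(4)[OF J(1), of "W x"] that by (simp add: alg_mult_simps)
    then have Im: "Im (zeta x) = 0 \<or> W x = 0" using ImJ by auto
    have "P x = c 0 x *\<^sub>R W x" using P2 1 ImJ by (simp add: zeta_def)
    moreover have "c i x *\<^sub>R W x = 0" if "i \<noteq> 0"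
    proof (cases "W x = 0")
      case False
      then have "(\<Sum>j=1..m. (c j x)\<^sup>2) = 0" using Im by (simp add: zeta_def)
      then have "c i x = 0" using that i by (subst (asm) sum_nonneg_eq_0_iff) auto
      then show ?thesis by simp
    qed simp
    ultimately show ?thesis by (simp add: E_eq)
  qed
  have K_cont: "continuous_on ?\<Omega> K"
    unfolding K_def by (intro continuous_intros continuous_on_axial[OF D] H) auto
  \<comment> \<open>Only the interior of the segment has to lie in the open ball, where the
    derivatives of \<open>K\<close> vanish; continuity takes care of the endpoints, one of which
    will be on the sphere.\<close>
  have K_line: "K (x + t *\<^sub>R v i) = K x"
    if i: "i \<le> m" and inB: "\<And>s. 0 < s \<Longrightarrow> s < 1 \<Longrightarrow> x + (s * t) *\<^sub>R v i \<in> ?Bo"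
      and in\<Omega>: "\<And>s. 0 \<le> s \<Longrightarrow> s \<le> 1 \<Longrightarrow> x + (s * t) *\<^sub>R v i \<in> ?\<Omega>" for x t i
  proof (rule euclidean_eqI)
    fix b :: 'a assume "b \<in> Basis"
    have "K (x + (1 * t) *\<^sub>R v i) \<bullet> b = K (x + (0 * t) *\<^sub>R v i) \<bullet> b"
    proof (rule DERIV_isconst_end[of 0 1 "\<lambda>s. K (x + (s * t) *\<^sub>R v i) \<bullet> b"])
      show "continuous_on {0..1} (\<lambda>s. K (x + (s * t) *\<^sub>R v i) \<bullet> b)"
        by (intro continuous_intros continuous_on_compose2[OF K_cont]) (use in\<Omega> in auto)
      fix s :: real assume s: "0 < s" "s < 1"
      let ?y = "x + (s * t) *\<^sub>R v i"
      have "((\<lambda>\<tau>. K (?y + \<tau> *\<^sub>R v i)) has_vector_derivative 0) (at 0)"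
        using K_deriv[OF Bo\<Omega>[OF inB[OF s]] i] E0[OF inB[OF s] i] by simp
      then have "((\<lambda>\<tau>. K (x + \<tau> *\<^sub>R v i)) has_vector_derivative 0) (at (s * t))"
        by (rule has_vector_derivative_line_shift)
      moreover have "((\<lambda>s. s * t) has_vector_derivative t) (at s)"
        by (auto intro!: derivative_eq_intros simp: has_real_derivative_iff_has_vector_derivative[symmetric])
      ultimately have "((\<lambda>s. K (x + (s * t) *\<^sub>R v i)) has_vector_derivative t *\<^sub>R 0) (at s)"
        using vector_diff_chain_at[of "\<lambda>s. s * t" t s "\<lambda>\<tau>. K (x + \<tau> *\<^sub>R v i)" 0] by (simp add: comp_def)
      from bounded_linear.has_vector_derivative[OF bounded_linear_inner_left this, of b]
      show "((\<lambda>s. K (x + (s * t) *\<^sub>R v i) \<bullet> b) has_real_derivative 0) (at s)"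
        by (simp add: has_real_derivative_iff_has_vector_derivative)
    qed simp
    then show "K (x + t *\<^sub>R v i) \<bullet> b = K x \<bullet> b" by simp
  qed
  define C where "C = K 0"
  have plane: "\<alpha> *\<^sub>R v 0 + \<beta> *\<^sub>R v 1 \<in> M" "zeta (\<alpha> *\<^sub>R v 0 + \<beta> *\<^sub>R v 1) = Complex \<alpha> \<bar>\<beta>\<bar>" for \<alpha> \<beta>
  proof -
    show "\<alpha> *\<^sub>R v 0 + \<beta> *\<^sub>R v 1 \<in> M"
      using v_M[of 0] v_M[OF m1] M_subspace by (auto intro!: subspace_add subspace_scale)
    then show "zeta (\<alpha> *\<^sub>R v 0 + \<beta> *\<^sub>R v 1) = Complex \<alpha> \<bar>\<beta>\<bar>"
      by (rule zeta_slice_point[OF _ v_1_imag_unit[OF m1]]) (simp add: v_0)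
  qed
  \<comment> \<open>The path from \<open>0\<close> runs along the real axis to
    \<open>\<alpha>\<close> and then in direction \<open>v 1\<close> up to the sphere, where
    \<open>K\<close> equals \<open>h\<close>.\<close>
  have pos: "snd (F z) = Im z *\<^sub>R C" if z: "cmod z = r" "Im z > 0" for z
  proof -
    define \<alpha> \<beta> where "\<alpha> = Re z" and "\<beta> = Im z"
    have r2: "\<alpha>\<^sup>2 + \<beta>\<^sup>2 = r\<^sup>2" using z(1) by (simp add: \<alpha>_def \<beta>_def cmod_power2[symmetric])
    have \<beta>: "\<beta> > 0" using z(2) by (simp add: \<beta>_def)
    have le: "cmod (Complex a \<bar>b\<bar>) \<le> r \<longleftrightarrow> a\<^sup>2 + b\<^sup>2 \<le> r\<^sup>2"
      and less: "cmod (Complex a \<bar>b\<bar>) < r \<longleftrightarrow> a\<^sup>2 + b\<^sup>2 < r\<^sup>2" for a b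
      using r(1) real_sqrt_le_iff[of "a\<^sup>2 + b\<^sup>2" "r\<^sup>2"] real_sqrt_less_iff[of "a\<^sup>2 + b\<^sup>2" "r\<^sup>2"]
      by (simp_all add: complex_norm)
    have \<alpha>2: "\<alpha>\<^sup>2 < r\<^sup>2" using r2 zero_less_power[OF \<beta>, of 2] by linarith
    have sq: "s\<^sup>2 * a \<le> a" if "0 \<le> s" "s \<le> 1" "0 \<le> a" for s a :: real
      by (intro mult_left_le_one_le that power_le_one zero_le_power)
    have sq': "s\<^sup>2 * a < a" if "0 < s" "s < 1" "0 < a" for s a :: real
      using that power_strict_decreasing[of 0 2 s] by simp
    have "K (0 + \<alpha> *\<^sub>R v 0) = K 0"
    proof (rule K_line)
      fix s :: real
      have e: "0 + (s * \<alpha>) *\<^sub>R v 0 = (s * \<alpha>) *\<^sub>R v 0 + 0 *\<^sub>R v 1" by simp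
      have lt: "(s * \<alpha>)\<^sup>2 + 0\<^sup>2 < r\<^sup>2" if "0 \<le> s" "s \<le> 1"
        using sq[OF that, of "\<alpha>\<^sup>2"] \<alpha>2 by (simp add: power_mult_distrib)
      show "0 + (s * \<alpha>) *\<^sub>R v 0 \<in> ?Bo" if "0 < s" "s < 1"
        unfolding e using plane(1) less lt that by (simp only: plane(2) mem_Collect_eq mem_ball_0)
      show "0 + (s * \<alpha>) *\<^sub>R v 0 \<in> ?\<Omega>" if "0 \<le> s" "s \<le> 1"
        unfolding e by (rule B\<Omega>[OF plane(1)]) (use le lt[OF that] in \<open>simp only: plane(2)\<close>)
    qed simp
    moreover have "K (\<alpha> *\<^sub>R v 0 + \<beta> *\<^sub>R v 1) = K (\<alpha> *\<^sub>R v 0)"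
    proof (rule K_line)
      fix s :: real
      show "\<alpha> *\<^sub>R v 0 + (s * \<beta>) *\<^sub>R v 1 \<in> ?Bo" if "0 < s" "s < 1"
      proof -
        have "\<alpha>\<^sup>2 + (s * \<beta>)\<^sup>2 < r\<^sup>2"
          using sq'[OF that zero_less_power[OF \<beta>, of 2]] r2 unfolding power_mult_distrib by linarith
        then show ?thesis using plane(1) less by (simp only: plane(2) mem_Collect_eq mem_ball_0)
      qed
      show "\<alpha> *\<^sub>R v 0 + (s * \<beta>) *\<^sub>R v 1 \<in> ?\<Omega>" if "0 \<le> s" "s \<le> 1"
      proof (rule B\<Omega>[OF plane(1)])
        have "\<alpha>\<^sup>2 + (s * \<beta>)\<^sup>2 \<le> r\<^sup>2"
          using sq[OF that zero_le_power2[of \<beta>]] r2 unfolding power_mult_distrib by linarith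
        then show "cmod (zeta (\<alpha> *\<^sub>R v 0 + (s * \<beta>) *\<^sub>R v 1)) \<le> r" using le by (simp only: plane(2))
      qed
    qed (use m1 in simp)
    ultimately have Kx: "K (\<alpha> *\<^sub>R v 0 + \<beta> *\<^sub>R v 1) = C" by (simp add: C_def)
    let ?x = "\<alpha> *\<^sub>R v 0 + \<beta> *\<^sub>R v 1"
    have zx: "zeta ?x = z" using plane(2)[of \<alpha> \<beta>] \<beta> by (simp add: \<alpha>_def \<beta>_def)
    have zD: "zeta ?x \<in> D" using zx z(1) r(2) by auto
    have "hc_norm ?x ^ (2 * k) = r ^ (2 * k)" for k
      using hc_norm_nsq[OF plane(1), of \<alpha> \<beta> k] cmod_zeta[of ?x] zx z(1) by (simp add: power_mult)
    then have "h ?x = K ?x" using dec_H[OF plane(1) zD] by (simp add: K_def)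
    moreover have "h ?x = (1 / Im z) *\<^sub>R snd (F z)" using quot[OF plane(1) zD] zx z(2) by simp
    ultimately have "(1 / Im z) *\<^sub>R snd (F z) = C" using Kx by simp
    then have "Im z *\<^sub>R ((1 / Im z) *\<^sub>R snd (F z)) = Im z *\<^sub>R C" by simp
    then show ?thesis using z(2) by simp
  qed
  have snd_cnj: "snd (F (cnj z)) = - snd (F z)" if "z \<in> D" for z
    using F(1) that by (simp add: stem_function_def cplx_conj_def)
  have circ: "snd (F z) = Im z *\<^sub>R C" if z: "cmod z = r" for z
  proof -
    have zD: "z \<in> D" using z r(2) by auto
    consider "Im z > 0" | "Im z = 0" | "Im z < 0" by linarith
    then show ?thesis
    proof cases
      case 2
      then have "cnj z = z" by (simp add: complex_eq_iff)
      then have "snd (F z) = 0" using snd_cnj[OF zD] by (intro real_vector_eq_minus_self) simp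
      then show ?thesis using 2 by simp
    next
      case 3
      then show ?thesis using pos[of "cnj z"] z snd_cnj[OF zD] by simp
    qed (use pos z in auto)
  qed
  have "\<forall>b\<in>Basis. \<exists>d. \<forall>z\<in>D. stem_comp F b z = of_real (C \<bullet> b) * z + d"
    using circ
    by (intro ballI holomorphic_affine[OF D(1) starlike_imp_connected[OF star] F(2) r])
       (auto simp: stem_comp_def)
  then obtain e where e: "\<And>b z. b \<in> Basis \<Longrightarrow> z \<in> D \<Longrightarrow> stem_comp F b z = of_real (C \<bullet> b) * z + e b"
    unfolding bchoice_iff by blast
  define B where "B = (\<Sum>b\<in>Basis. Re (e b) *\<^sub>R b)"
  \<comment> \<open>Stem symmetry at \<open>0\<close> makes the constants \<open>e b\<close> real,
    so \<open>B\<close>, built from their real parts, captures them completely.\<close>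
  have "snd (F 0) = 0"
    using snd_cnj[OF D0] by (intro real_vector_eq_minus_self) simp
  then have Im_e: "Im (e b) = 0" if "b \<in> Basis" for b
    using e[OF that D0] by (simp add: stem_comp_def complex_eq_iff)
  have "F z = (Re z *\<^sub>R C + B, Im z *\<^sub>R C)" if z: "z \<in> D" for z
  proof -
    have "fst (F z) = Re z *\<^sub>R C + B"
      by (rule euclidean_eqI) (use e[OF _ z] in \<open>auto simp: stem_comp_def complex_eq_iff B_def inner_add_left mult.commute\<close>)
    moreover have "snd (F z) = Im z *\<^sub>R C"
      by (rule euclidean_eqI) (use e[OF _ z] Im_e in \<open>auto simp: stem_comp_def complex_eq_iff mult.commute\<close>)
    ultimately show ?thesis by (simp add: prod_eq_iff)
  qed
  then show ?thesis by blast
qed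

end

theorem proposition32:
  fixes M \<Omega> :: "'a::alternative_star_algebra set"
    and D :: "complex set"
    and m :: nat
    and v :: "nat \<Rightarrow> 'a"
    and f :: "'a \<Rightarrow> 'a"
  assumes "(imag_units :: 'a set) \<noteq> {}"
    and "hypercomplex_subspace M"
    and "m = dim M - 1" and "m \<ge> 3" and "odd m"
    and "hc_orthonormal_basis M m v"
    and "open D" and "\<forall>z\<in>D. cnj z \<in> D"
    and "\<Omega> = circular_set D \<inter> M"
    and "0 \<in> \<Omega>" and "\<forall>x\<in>\<Omega>. closed_segment 0 x \<subseteq> \<Omega>"
    and "slice_regular_restr D \<Omega> f"
    and "\<not> (\<forall>x y z :: 'a. (x * y) * z = x * (y * z)) \<longrightarrow>
           admissible M m v \<Omega> f \<and> admissible M m v \<Omega> (\<lambda>x. x * f x)"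
    and "\<forall>k\<le>(m - 3) div 2. \<forall>x\<in>\<Omega>. fueter_map m v \<Omega> f k x = 0"
  shows "\<exists>a b. \<forall>x\<in>\<Omega>. f x = x * a + b"
proof -
  interpret hc_frame M m v using assms(2,6) by unfold_locales
  note D = assms(7,8)
  have \<Omega>: "\<Omega> = {x \<in> M. zeta x \<in> D}" using assms(9) circular_set_zeta[OF D(2)] by simp
  have m1: "1 \<le> m" using assms(4) by simp
  obtain n where m: "m = 2 * Suc n + 1"
  proof -
    obtain j where "m = 2 * j + 1" using assms(5) oddE by blast
    then show ?thesis using assms(4) that[of "j - 1"] by simp
  qed
  have mn: "(m - 3) div 2 = n" using m by simp
  obtain g F where g: "\<And>x. x \<in> \<Omega> \<Longrightarrow> f x = g x" and F: "stem_function D F" "stem_holomorphic D F"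
    and ind: "induces_slice_function D F g"
    using assms(12) by (auto simp: slice_regular_restr_def slice_regular_def)
  have slice: "slice_on D F f"
    unfolding slice_on_def
  proof (intro ballI allI impI)
    fix x \<alpha> \<beta> J assume a: "x \<in> M" "J \<in> imag_units" "x = \<alpha> *\<^sub>R 1 + \<beta> *\<^sub>R J" "Complex \<alpha> \<beta> \<in> D"
    then have "x \<in> \<Omega>" using assms(9) by (auto simp: circular_set_def)
    then show "f x = fst (F (Complex \<alpha> \<beta>)) + J * snd (F (Complex \<alpha> \<beta>))"
      using g ind a unfolding induces_slice_function_def by simp
  qed
  have zeta_0: "zeta 0 = 0" by (simp add: zeta_def linear_0[OF linear_c] complex_eq_iff)
  have D0: "0 \<in> D" using assms(10) unfolding \<Omega> by (simp add: zeta_0)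
  \<comment> \<open>The point \<open>z\<close> is realized by
    \<open>Re z *\<^sub>R 1 + Im z *\<^sub>R v 1\<close> in \<open>\<Omega>\<close>. After scaling,
    \<open>zeta\<close> folds it into the upper half-plane, and conjugation invariance of
    \<open>D\<close> restores the sign.\<close>
  have star: "starlike D"
    unfolding starlike_def
  proof (intro bexI[OF _ D0] ballI subsetI)
    fix z y assume z: "z \<in> D" and y: "y \<in> closed_segment 0 z"
    then obtain t where t: "0 \<le> t" "t \<le> 1" "y = t *\<^sub>R z" by (auto simp: closed_segment_def)
    let ?x = "Re z *\<^sub>R 1 + Im z *\<^sub>R v 1"
    have u: "v 1 \<in> imag_units" using v_1_imag_unit[OF m1] .
    have xM: "?x \<in> M"
      using v_M[of 0] v_M[OF m1] M_subspace v_0 by (auto intro!: subspace_add subspace_scale)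
    moreover have "Complex (Re z) (Im z) \<in> D" using z by simp
    ultimately have "?x \<in> \<Omega>" using assms(9) u unfolding circular_set_def by blast
    then have "t *\<^sub>R ?x \<in> \<Omega>" using assms(11) t by (auto simp: closed_segment_def)
    moreover have tM: "t *\<^sub>R ?x \<in> M" using xM M_subspace by (rule subspace_scale[rotated])
    moreover have "zeta (t *\<^sub>R ?x) = Complex (t * Re z) \<bar>t * Im z\<bar>"
      by (rule zeta_slice_point[OF tM u]) (simp add: scaleR_right_distrib)
    ultimately have in_D: "Complex (t * Re z) \<bar>t * Im z\<bar> \<in> D" unfolding \<Omega> by simp
    have "y = Complex (t * Re z) \<bar>t * Im z\<bar> \<or> y = cnj (Complex (t * Re z) \<bar>t * Im z\<bar>)"
      unfolding t(3) by (auto simp: complex_eq_iff abs_if)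
    then show "y \<in> D" using in_D D(2) by blast
  qed
  have hol1: "stem_comp F b holomorphic_on D" for b by (rule holomorphic_stem_comp[OF D(1) F(2)])
  have hol2: "stem_comp (stem_mult F) b holomorphic_on D" for b
    unfolding stem_comp_mult by (intro holomorphic_intros hol1)
  let ?h1 = "spherical_deriv \<Omega> (\<lambda>y. y * f y)" and ?h2 = "spherical_deriv \<Omega> f"
  have sd: "?h2 x = axial 1 (stem_comp F) x"
    "Im (zeta x) \<noteq> 0 \<Longrightarrow> ?h2 x = (1 / Im (zeta x)) *\<^sub>R snd (F (zeta x))" if "x \<in> {x \<in> M. zeta x \<in> D}" for x
    using spherical_deriv_axial[OF D F(1) slice hol1 m1 that] unfolding \<Omega> by simp_all
  have sd1: "?h1 x = axial 1 (stem_comp (stem_mult F)) x" if "x \<in> {x \<in> M. zeta x \<in> D}" for x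
    using spherical_deriv_axial(1)[OF D stem_function_mult[OF F(1)] slice_on_mult[OF slice] hol2 m1 that]
    unfolding \<Omega> by simp
  obtain H where H: "\<And>k b. k \<le> n \<Longrightarrow> b \<in> Basis \<Longrightarrow> H k b holomorphic_on D"
    and alm2: "is_almansi_decomposition m v \<Omega> ?h2 (\<lambda>k. axial (Suc n) (H k))"
    using almansi_exists[OF D D0 star hol1 m sd(1)] unfolding \<Omega>[symmetric] by blast
  obtain H1 where alm1: "is_almansi_decomposition m v \<Omega> ?h1 (\<lambda>k. axial (Suc n) (H1 k))"
    using almansi_exists[OF D D0 star hol2 m sd1] unfolding \<Omega>[symmetric] by blast
  \<comment> \<open>The components are given by a choice operator; the explicit decompositions show
    that a choice exists, so \<open>u\<close> and \<open>w\<close> are decompositions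
    themselves.\<close>
  define u w where "u = almansi_component m v \<Omega> ?h1" and "w = almansi_component m v \<Omega> ?h2"
  have u: "is_almansi_decomposition m v \<Omega> ?h1 u"
    unfolding u_def almansi_component_def
    by (rule someI[of "is_almansi_decomposition m v \<Omega> ?h1"]) (rule alm1)
  have w: "is_almansi_decomposition m v \<Omega> ?h2 w"
    unfolding w_def almansi_component_def
    by (rule someI[of "is_almansi_decomposition m v \<Omega> ?h2"]) (rule alm2)
  have lo: "line_open m v \<Omega>" unfolding \<Omega> by (rule line_open_zeta[OF D(1)])
  have dw: "(\<Sum>i\<le>m. (v i)\<^sup>c * partial_deriv v i (w k) x) = 0" if k: "k \<le> n" and x: "x \<in> \<Omega>" for k x
  proof -
    have hu: "harmonic_on m v \<Omega> (u k)" and hw: "harmonic_on m v \<Omega> (w k)"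
      using u w k mn by (auto simp: is_almansi_decomposition_def)
    have "fueter_component m v \<Omega> f k = (\<lambda>x. u k x - x\<^sup>c * w k x)"
      by (auto simp: fueter_component_def u_def w_def)
    moreover have "laplacian m v (fueter_component m v \<Omega> f k) x = 0"
      using assms(14) k x mn by (simp add: fueter_map_def)
    ultimately have "laplacian m v (\<lambda>x. u k x - x\<^sup>c * w k x) x = 0" by simp
    then show ?thesis unfolding laplacian_conj_mult[OF lo hu hw x] by simp
  qed
  have "\<exists>C B. \<forall>z\<in>D. F z = (Re z *\<^sub>R C + B, Im z *\<^sub>R C)"
  proof (rule fueter_kernel_stem[OF D D0 star m F(1) hol1, of ?h2 H w])
    show "?h2 x = (1 / Im (zeta x)) *\<^sub>R snd (F (zeta x))" if "x \<in> M" "zeta x \<in> D" "Im (zeta x) \<noteq> 0" for x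
      using sd(2)[of x] that by simp
    show "?h2 x = (\<Sum>k\<le>n. hc_norm x ^ (2 * k) *\<^sub>R w k x)" if "x \<in> M" "zeta x \<in> D" for x
      using w that mn unfolding is_almansi_decomposition_def \<Omega> by simp
    show "?h2 x = (\<Sum>k\<le>n. hc_norm x ^ (2 * k) *\<^sub>R axial (Suc n) (H k) x)" if "x \<in> M" "zeta x \<in> D" for x
      using alm2 that mn unfolding is_almansi_decomposition_def \<Omega> by simp
    show "harmonic_on m v {x \<in> M. zeta x \<in> D} (w k)" if "k \<le> n" for k
      using w that mn unfolding is_almansi_decomposition_def \<Omega> by simp
    show "(\<Sum>i\<le>m. (v i)\<^sup>c * partial_deriv v i (w k) x) = 0" if "k \<le> n" "x \<in> M" "zeta x \<in> D" for k x
      using dw[OF that(1), of x] that \<Omega> by simp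
  qed (rule H)
  then obtain C B where CB: "\<And>z. z \<in> D \<Longrightarrow> F z = (Re z *\<^sub>R C + B, Im z *\<^sub>R C)" by blast
  have "f x = x * C + B" if x: "x \<in> \<Omega>" for x
  proof -
    obtain \<alpha> \<beta> J where a: "x \<in> M" "J \<in> imag_units" "x = \<alpha> *\<^sub>R 1 + \<beta> *\<^sub>R J" "Complex \<alpha> \<beta> \<in> D"
      using x assms(9) by (auto simp: circular_set_def)
    then have "f x = fst (F (Complex \<alpha> \<beta>)) + J * snd (F (Complex \<alpha> \<beta>))"
      using slice unfolding slice_on_def by blast
    then show ?thesis unfolding CB[OF a(4)] unfolding a(3) by (simp add: alg_mult_simps)
  qed
  then show ?thesis by blast
qed

end
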